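(* Let $G$ be a finite group and let $K/\mathbb{Q}$ be a finite Galois extension with Galois group isomorphic to $G$ such that all nontrivial inertia groups (at finite primes) are of order $2$. Then there exists a quadratic extension $E/\mathbb{Q}$ such that $\mathrm{Gal}(KE/E)\cong G$ and $KE/E$ is unramified at all primes of $E$, finite and infinite.
   Context: All fields are taken inside a fixed algebraic closure of $\mathbb{Q}$. An infinite prime of $E$ is unramified in $KE$ unless it is real and some prime of $KE$ above it is complex. *)

theory Defs
  imports
    Complex_Main
    "HOL-Computational_Algebra.Polynomial"
    "HOL-Algebra.Algebra"
    "HOL-Algebra.Algebraic_Closure_Type"
begin

text \<open>
  All fields are subfields of the complex numbers. Every field that occurs is finite over
  \<open>\<rat>\<close>, hence consists of algebraic numbers, so the fixed algebraic closure of \<open>\<rat>\<close> is the one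
  inside \<open>\<complex>\<close>.
\<close>

abbreviation \<C>\<C> :: "complex ring" where
  "\<C>\<C> \<equiv> ring_of_type_algebra"

definition field_ext :: "complex set \<Rightarrow> complex set \<Rightarrow> bool" where
  "field_ext F L \<longleftrightarrow> subfield F \<C>\<C> \<and> subfield L \<C>\<C> \<and> F \<subseteq> L"

definition quadratic_ext :: "complex set \<Rightarrow> complex set \<Rightarrow> bool" where
  "quadratic_ext F L \<longleftrightarrow> field_ext F L \<and> ring.dimension \<C>\<C> 2 F L"

definition compositum :: "complex set \<Rightarrow> complex set \<Rightarrow> complex set" where
  "compositum K E = generate_field \<C>\<C> (K \<union> E)"

text \<open>
  As in \<^const>\<open>BijGroup\<close>, automorphisms of \<open>L\<close> are extensional functions, so that distinct
  elements differ on \<open>L\<close>.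
\<close>

definition galois_group :: "complex set \<Rightarrow> complex set \<Rightarrow> (complex \<Rightarrow> complex) monoid" where
  "galois_group L F = (BijGroup L)
     \<lparr>carrier := {\<sigma> \<in> Bij L. \<sigma> \<in> ring_hom (\<C>\<C>\<lparr>carrier := L\<rparr>) (\<C>\<C>\<lparr>carrier := L\<rparr>)
                            \<and> (\<forall>x\<in>F. \<sigma> x = x)}\<rparr>"

definition finite_galois_ext :: "complex set \<Rightarrow> complex set \<Rightarrow> bool" where
  "finite_galois_ext F L \<longleftrightarrow> field_ext F L \<and> ring.finite_dimension \<C>\<C> F L \<and>
     {x \<in> L. \<forall>\<sigma> \<in> carrier (galois_group L F). \<sigma> x = x} = F"

definition ring_of_integers :: "complex set \<Rightarrow> complex ring" where
  "ring_of_integers L = \<C>\<C>\<lparr>carrier := {x \<in> L. algebraic_int x}\<rparr>"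

definition finite_primes :: "complex set \<Rightarrow> complex set set" where
  "finite_primes L = {P. primeideal P (ring_of_integers L) \<and> P \<noteq> {0}}"

definition inertia_group ::
  "complex set \<Rightarrow> complex set \<Rightarrow> complex set \<Rightarrow> (complex \<Rightarrow> complex) set" where
  "inertia_group L F P =
     {\<sigma> \<in> carrier (galois_group L F). \<forall>x \<in> carrier (ring_of_integers L). \<sigma> x - x \<in> P}"

text \<open>
  The exponent of \<open>Q\<close> in the factorization of the ideal of the integers of \<open>L\<close> generated by the
  prime \<open>P\<close> of a subfield; powers of \<open>Q\<close> are taken in the monoid of ideals.
\<close>

definition ramification_index :: "complex set \<Rightarrow> complex set \<Rightarrow> complex set \<Rightarrow> nat" where
  "ramification_index L Q P =
     (GREATEST n::nat.
        Idl\<^bsub>ring_of_integers L\<^esub> P \<subseteq> Q [^]\<^bsub>ideals_set (ring_of_integers L)\<^esub> n)"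

text \<open>Residue fields of finite primes are finite, so residue extensions are separable.\<close>

definition unramified_at_finite :: "complex set \<Rightarrow> complex set \<Rightarrow> complex set \<Rightarrow> bool" where
  "unramified_at_finite E L P \<longleftrightarrow>
     (\<forall>Q \<in> finite_primes L. Q \<inter> E = P \<longrightarrow> ramification_index L Q P = 1)"

text \<open>An infinite prime is a class of complex embeddings modulo complex conjugation.\<close>

definition embeddings :: "complex set \<Rightarrow> (complex \<Rightarrow> complex) set" where
  "embeddings L = ring_hom (\<C>\<C>\<lparr>carrier := L\<rparr>) \<C>\<C> \<inter> extensional L"

definition infinite_primes :: "complex set \<Rightarrow> (complex \<Rightarrow> complex) set set" where
  "infinite_primes L = {{\<sigma>, \<lambda>x\<in>L. cnj (\<sigma> x)} | \<sigma>. \<sigma> \<in> embeddings L}"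

definition real_prime :: "complex set \<Rightarrow> (complex \<Rightarrow> complex) set \<Rightarrow> bool" where
  "real_prime L v \<longleftrightarrow> (\<forall>\<sigma>\<in>v. \<sigma> ` L \<subseteq> \<real>)"

definition lies_above_infinite ::
  "complex set \<Rightarrow> (complex \<Rightarrow> complex) set \<Rightarrow> (complex \<Rightarrow> complex) set \<Rightarrow> bool" where
  "lies_above_infinite E w v \<longleftrightarrow> (\<lambda>\<tau>. restrict \<tau> E) ` w = v"

definition unramified_at_infinite ::
  "complex set \<Rightarrow> complex set \<Rightarrow> (complex \<Rightarrow> complex) set \<Rightarrow> bool" where
  "unramified_at_infinite E L v \<longleftrightarrow>
     \<not> (real_prime E v \<and>
        (\<exists>w \<in> infinite_primes L. lies_above_infinite E w v \<and> \<not> real_prime L w))"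

definition unramified_everywhere :: "complex set \<Rightarrow> complex set \<Rightarrow> bool" where
  "unramified_everywhere E L \<longleftrightarrow>
     (\<forall>P \<in> finite_primes E. unramified_at_finite E L P) \<and>
     (\<forall>v \<in> infinite_primes E. unramified_at_infinite E L v)"

end

theory Submission
  imports Defs "Jordan_Normal_Form.Char_Poly"
begin

text \<open>
  Idea. Choose an imaginary quadratic field \<open>E = \<rat>(\<surd>d)\<close> that absorbs all ramification of \<open>K\<close>. At an
  odd prime \<open>p\<close> ramified in \<open>K\<close> it suffices that \<open>p\<close> divides \<open>d\<close> exactly once. At 2, let
  \<open>F\<close> be the fixed field of an inertia group \<open>{1, \<tau>}\<close> and \<open>K = F(\<surd>a)\<close>. Since \<open>\<tau>\<close> commutes with the
  decomposition group, the square class of \<open>a\<close> is Frobenius invariant, which forces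
  one of \<open>\<plusminus>a\<close>, \<open>\<plusminus>2a\<close> to be congruent to 1 modulo 4 up to squares of \<open>F\<close>, so that \<open>d\<close> can be chosen in
  the class of \<open>a\<close>. By conjugacy of the primes above 2 this class does not depend on the prime. In both
  cases an automorphism in an inertia group of \<open>KE/E\<close> that is nontrivial on \<open>K\<close> would negate
  \<open>w = \<surd>(ad)\<close>, suitably scaled; but \<open>w\<close> is a local unit, and at 2 even \<open>(1 + w) / 2\<close> is locally integral.

  No completions are needed: trivial inertia implies unramifiedness by an independence of characters
  argument applied to traces, and \<open>\<surd>d \<notin> K\<close> is arranged by varying an auxiliary prime factor of \<open>d\<close>.
\<close>

section \<open>Algebraic integers\<close>

text \<open>\<open>E\<close> is imaginary so that it has no real embedding, which settles the
  infinite primes at once. At the finite primes hypothesis and conclusion use different notions: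
  inertia groups for \<open>K\<close>, exponents of prime ideals for \<open>KE\<close>. The bridge
  is that trivial inertia makes a prime \<open>Q\<close> locally generated by
  \<open>Q \<inter> E\<close>; Nakayama's lemma then excludes
  \<open>Q \<inter> E \<subseteq> Q^2\<close>. The same descent, applied to the integers fixed by
  \<open>\<tau>\<close>, shows that the residue characteristic \<open>p\<close> is a uniformizer of
  \<open>F\<close> at \<open>Q\<close>. Hence \<open>a\<close> may be taken to be a local unit or
  \<open>p\<close> times a local unit. For odd \<open>p\<close> the first case would contradict
  ramification, so one factor \<open>p\<close> in \<open>d\<close> cancels the ramification. At 2
  this is not enough: units of \<open>F\<close> have many square classes, while a single rational
  \<open>d\<close> has to serve all primes above 2. The signs and the factor 2 are the only freedom
  left, and they suffice because invariance under Frobenius pushes the obstruction into the field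
  with two elements. Localization at \<open>Q\<close> is expressed throughout by a multiplier
  \<open>s\<close> outside \<open>Q\<close>.\<close>

lemma algebraic_int_eigenvalue:
  fixes v :: "nat \<Rightarrow> complex" and A :: "nat \<Rightarrow> nat \<Rightarrow> int"
  assumes eq: "\<And>i. i < n \<Longrightarrow> x * v i = (\<Sum>j<n. of_int (A i j) * v j)"
    and k: "k < n" "v k \<noteq> 0"
  shows "algebraic_int x"
proof -
  define M where "M = mat n n (\<lambda>(i, j). A i j)"
  define M' where "M' = (map_mat of_int M :: complex mat)"
  have M: "M \<in> carrier_mat n n" and M': "M' \<in> carrier_mat n n"
    by (auto simp: M_def M'_def)
  have "M' *\<^sub>v vec n v = x \<cdot>\<^sub>v vec n v"
    by (rule eq_vecI)
       (auto simp: M'_def M_def scalar_prod_def eq atLeast0LessThan intro!: sum.cong)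
  moreover have "vec n v \<noteq> 0\<^sub>v n"
    using k by (metis index_vec index_zero_vec(1))
  ultimately have "eigenvalue M' x"
    unfolding eigenvalue_def eigenvector_def using M' by (intro exI[of _ "vec n v"]) auto
  hence "poly (char_poly M') x = 0"
    using eigenvalue_root_char_poly[OF M'] by simp
  moreover have "char_poly M' = map_poly of_int (char_poly M)"
    unfolding M'_def by (rule of_int_hom.char_poly_hom[OF M])
  moreover have "lead_coeff (char_poly M) = 1"
    using degree_monic_char_poly[OF M] by simp
  ultimately show ?thesis
    unfolding algebraic_int_altdef_ipoly by metis
qed

definition int_span :: "complex set \<Rightarrow> complex set" where
  "int_span S = {\<Sum>s\<in>S. of_int (c s) * s | c. True}"

lemma int_span_add: "a \<in> int_span S \<Longrightarrow> b \<in> int_span S \<Longrightarrow> a + b \<in> int_span S"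
proof -
  assume "a \<in> int_span S" "b \<in> int_span S"
  then obtain c d where "a = (\<Sum>s\<in>S. of_int (c s) * s)" "b = (\<Sum>s\<in>S. of_int (d s) * s)"
    by (auto simp: int_span_def)
  hence "a + b = (\<Sum>s\<in>S. of_int (c s + d s) * s)"
    by (simp add: sum.distrib algebra_simps)
  thus ?thesis unfolding int_span_def by (intro CollectI exI[of _ "\<lambda>s. c s + d s"]) auto
qed

lemma int_span_0: "0 \<in> int_span S"
proof -
  have "0 = (\<Sum>s\<in>S. of_int 0 * s)" by simp
  thus ?thesis unfolding int_span_def by (intro CollectI exI[of _ "\<lambda>_. 0"]) auto
qed

lemma int_span_cmult: "a \<in> int_span S \<Longrightarrow> of_int k * a \<in> int_span S"
proof -
  assume "a \<in> int_span S"
  then obtain c where "a = (\<Sum>s\<in>S. of_int (c s) * s)"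
    by (auto simp: int_span_def)
  hence "of_int k * a = (\<Sum>s\<in>S. of_int (k * c s) * s)"
    by (simp add: sum_distrib_left algebra_simps)
  thus ?thesis unfolding int_span_def by (intro CollectI exI[of _ "\<lambda>s. k * c s"]) auto
qed

lemma int_span_sum: "(\<And>i. i \<in> I \<Longrightarrow> f i \<in> int_span S) \<Longrightarrow> sum f I \<in> int_span S"
  by (induction I rule: infinite_finite_induct) (auto intro: int_span_add int_span_0)

lemma int_span_superset: "finite S \<Longrightarrow> s \<in> S \<Longrightarrow> s \<in> int_span S"
proof -
  assume "finite S" "s \<in> S"
  hence "s = (\<Sum>t\<in>S. of_int (if t = s then 1 else 0) * t)"
    by (simp add: if_distrib[of "\<lambda>x. x * _"] if_distrib[of of_int] cong: if_cong)
  thus ?thesis unfolding int_span_def by (intro CollectI exI[of _ "\<lambda>t. if t = s then 1 else 0"]) auto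
qed

lemma int_span_mult_closed:
  assumes "\<And>s. s \<in> S \<Longrightarrow> x * s \<in> int_span T" "a \<in> int_span S"
  shows "x * a \<in> int_span T"
proof -
  obtain c where "a = (\<Sum>s\<in>S. of_int (c s) * s)"
    using assms(2) by (auto simp: int_span_def)
  hence "x * a = (\<Sum>s\<in>S. of_int (c s) * (x * s))"
    by (simp add: sum_distrib_left algebra_simps)
  thus ?thesis using assms(1) by (auto intro!: int_span_sum int_span_cmult)
qed

text \<open>Integrality in terms of modules: multiplication by \<open>x\<close> preserves the
  finitely generated group spanned by \<open>S\<close>. Two integers that share such a group also
  have their sum and product acting on it.\<close>

definition stable_under :: "complex set \<Rightarrow> complex \<Rightarrow> bool" where
  "stable_under S x \<longleftrightarrow> (\<forall>s\<in>S. x * s \<in> int_span S)"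

text \<open>The elements of \<open>S\<close> form an eigenvector of an integer matrix with
  eigenvalue \<open>x\<close>; the element 1 provides the nonzero entry.\<close>

lemma algebraic_int_stable:
  assumes "finite S" "1 \<in> S" "stable_under S x"
  shows "algebraic_int x"
proof -
  obtain f where f: "bij_betw f {..<card S} S"
    using assms(1) ex_bij_betw_nat_finite[of S] by (auto simp: atLeast0LessThan)
  have "\<forall>s\<in>S. \<exists>c. x * s = (\<Sum>t\<in>S. of_int (c t) * t)"
    using assms(3) by (auto simp: stable_under_def int_span_def)
  then obtain C where C: "\<And>s. s \<in> S \<Longrightarrow> x * s = (\<Sum>t\<in>S. of_int (C s t) * t)"
    by metis
  obtain k where k: "k < card S" "f k = 1"
    using f assms(2) by (metis bij_betwE bij_betw_imp_surj_on imageE lessThan_iff)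
  show ?thesis
  proof (rule algebraic_int_eigenvalue[of "card S" x f "\<lambda>i j. C (f i) (f j)" k])
    fix i assume "i < card S"
    hence "f i \<in> S" using f by (auto dest: bij_betwE)
    thus "x * f i = (\<Sum>j<card S. of_int (C (f i) (f j)) * f j)"
      using C sum.reindex_bij_betw[OF f, of "\<lambda>t. of_int (C (f i) t) * t"] by simp
  qed (use k in auto)
qed

text \<open>Take the products \<open>y^i * s\<close> with \<open>i < n\<close>. Multiplication by
  \<open>y\<close> shifts \<open>i\<close>, and the hypothesis rewrites the overflow at
  \<open>n\<close>; elements stable on \<open>S\<close> act on the factor \<open>s\<close> alone.
  Thus further integers can be adjoined without losing the earlier ones.\<close>

lemma int_span_adjoin:
  fixes y :: complex
  assumes S: "finite S" "1 \<in> S" and y: "\<And>s. s \<in> S \<Longrightarrow> y ^ n * s \<in> int_span ((\<lambda>(i, s). y ^ i * s) ` ({..<n} \<times> S))"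
    and n: "n > 0"
  shows "\<exists>T. finite T \<and> 1 \<in> T \<and> stable_under T y \<and> (\<forall>x. stable_under S x \<longrightarrow> stable_under T x)"
proof -
  define T where "T = (\<lambda>(i, s). y ^ i * s) ` ({..<n} \<times> S)"
  have fin: "finite T" using S by (auto simp: T_def)
  have TI: "y ^ i * s \<in> T" if "i < n" "s \<in> S" for i s
    using that by (auto simp: T_def image_iff)
  have "1 \<in> T" using TI[of 0 1] n S by simp
  have "y * t \<in> int_span T" if t: "t \<in> T" for t
  proof -
    obtain i s where t_eq: "i < n" "s \<in> S" "t = y ^ i * s" using t by (auto simp: T_def)
    show ?thesis
    proof (cases "Suc i = n")
      case True
      hence "y * t = y ^ n * s" using t_eq by (auto simp: mult.assoc)
      with y[OF t_eq(2)] show ?thesis by (simp only: T_def)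
    next
      case False
      thus ?thesis using t_eq TI[of "Suc i" s] fin by (auto intro!: int_span_superset simp: mult.assoc)
    qed
  qed
  moreover have "x * t \<in> int_span T" if x: "\<And>s. s \<in> S \<Longrightarrow> x * s \<in> int_span S" and t: "t \<in> T" for x t
  proof -
    obtain i s where t_eq: "i < n" "s \<in> S" "t = y ^ i * s" using t by (auto simp: T_def)
    have "y ^ i * (x * s) \<in> int_span T"
      by (rule int_span_mult_closed[of S "y ^ i" T "x * s"])
         (use x t_eq TI fin in \<open>auto simp: stable_under_def intro: int_span_superset\<close>)
    thus ?thesis by (simp add: t_eq mult_ac)
  qed
  ultimately have "stable_under T y" "\<forall>x. stable_under S x \<longrightarrow> stable_under T x"
    unfolding stable_under_def by simp_all
  with fin \<open>1 \<in> T\<close> show ?thesis by blast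
qed

lemma int_span_adjoin_algebraic_int:
  fixes y :: complex
  assumes S: "finite S" "1 \<in> S" and y: "algebraic_int y"
  shows "\<exists>T. finite T \<and> 1 \<in> T \<and> stable_under T y \<and> (\<forall>x. stable_under S x \<longrightarrow> stable_under T x)"
proof -
  obtain p where p: "poly (map_poly of_int p) y = 0" "lead_coeff p = (1::int)"
    using y unfolding algebraic_int_altdef_ipoly by auto
  define n where "n = degree p"
  have n: "n > 0"
  proof (rule Nat.gr0I)
    assume "n = 0"
    then obtain c where "p = [:c:]" unfolding n_def by (auto elim: degree_eq_zeroE)
    thus False using p by auto
  qed
  have "0 = (\<Sum>i\<le>n. of_int (coeff p i) * y ^ i)"
    using p(1) by (simp add: poly_altdef n_def degree_map_poly coeff_map_poly)
  also have "{..n} = insert n {..<n}" by auto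
  also have "(\<Sum>i\<in>\<dots>. of_int (coeff p i) * y ^ i) = y ^ n + (\<Sum>i<n. of_int (coeff p i) * y ^ i)"
    using p(2) by (subst sum.insert) (auto simp: n_def)
  finally have yn: "y ^ n = (\<Sum>i<n. of_int (- coeff p i) * y ^ i)"
    by (simp add: sum_negf eq_neg_iff_add_eq_0)
  have "y ^ n * s \<in> int_span ((\<lambda>(i, s). y ^ i * s) ` ({..<n} \<times> S))" (is "_ \<in> int_span ?T") if "s \<in> S" for s
  proof -
    have "y ^ n * s = (\<Sum>i<n. of_int (- coeff p i) * (y ^ i * s))"
      unfolding yn sum_distrib_right by (simp add: mult.assoc)
    moreover have "y ^ i * s \<in> int_span ?T" if "i < n" for i
      by (rule int_span_superset) (use that \<open>s \<in> S\<close> S in \<open>auto simp: image_iff\<close>)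
    ultimately show ?thesis by (auto intro!: int_span_sum int_span_cmult simp del: of_int_minus)
  qed
  from int_span_adjoin[OF S this n] show ?thesis .
qed

text \<open>Multiplying an equation of degree \<open>n\<close> with leading coefficient
  \<open>k n\<close> by \<open>(k n)^(n - 1)\<close> makes it monic in
  \<open>k n * x\<close>.\<close>

lemma algebraic_imp_int_multiple_algebraic_int:
  assumes "algebraic (x::complex)"
  shows "\<exists>a::int. a \<noteq> 0 \<and> algebraic_int (of_int a * x)"
proof -
  obtain p where p: "\<And>i. coeff p i \<in> \<int>" "p \<noteq> 0" "poly p x = 0"
    using assms by (auto simp: algebraic_def)
  define n where "n = degree p"
  have "\<forall>i. \<exists>k. coeff p i = of_int k" using p(1) by (auto elim: Ints_cases)
  then obtain k where k: "\<And>i. coeff p i = of_int (k i)" by metis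
  define y where "y = of_int (k n) * x"
  have kn: "k n \<noteq> 0" using p(2) k[of n] by (auto simp: n_def)
  have n: "n > 0"
  proof (rule Nat.gr0I)
    assume "n = 0"
    then obtain c where "p = [:c:]" unfolding n_def by (auto elim: degree_eq_zeroE)
    thus False using p by auto
  qed
  have "0 = (\<Sum>i\<le>n. of_int (k i) * x ^ i)"
    using p(3) by (simp add: poly_altdef n_def k)
  also have "{..n} = insert n {..<n}" by auto
  also have "(\<Sum>i\<in>\<dots>. of_int (k i) * x ^ i) = of_int (k n) * x ^ n + (\<Sum>i<n. of_int (k i) * x ^ i)"
    by (subst sum.insert) auto
  finally have eq: "of_int (k n) * x ^ n = - (\<Sum>i<n. of_int (k i) * x ^ i)"
    by (simp add: eq_neg_iff_add_eq_0)
  have "y ^ n = of_int (k n) ^ (n - 1) * (of_int (k n) * x ^ n)"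
    using n unfolding y_def power_mult_distrib by (cases n) auto
  also have "\<dots> = (\<Sum>i<n. of_int (- k i * k n ^ (n - 1 - i)) * y ^ i)"
    unfolding eq y_def power_mult_distrib sum_negf[symmetric] sum_distrib_left
  proof (rule sum.cong)
    fix i assume "i \<in> {..<n}"
    hence "n - 1 = (n - 1 - i) + i" by auto
    hence "(of_int (k n) :: complex) ^ (n - 1) = of_int (k n) ^ (n - 1 - i) * of_int (k n) ^ i"
      by (metis power_add)
    thus "of_int (k n) ^ (n - 1) * - (of_int (k i) * x ^ i) =
        of_int (- k i * k n ^ (n - 1 - i)) * (of_int (k n) ^ i * x ^ i)" by simp
  qed simp
  finally have yn: "y ^ n = (\<Sum>i<n. of_int (- k i * k n ^ (n - 1 - i)) * y ^ i)" .
  have "y ^ n * s \<in> int_span ((\<lambda>(i, s). y ^ i * s) ` ({..<n} \<times> {1}))" (is "_ \<in> int_span ?T") if "s \<in> {1}" for s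
  proof -
    have "y ^ i \<in> int_span ?T" if "i < n" for i
      by (rule int_span_superset) (use that in \<open>auto simp: image_iff\<close>)
    hence "y ^ n \<in> int_span ?T"
      unfolding yn by (intro int_span_sum int_span_cmult) simp
    thus ?thesis using that by simp
  qed
  from int_span_adjoin[OF _ _ this n] obtain T where "finite T" "1 \<in> T" "stable_under T y" by auto
  hence "algebraic_int y" by (rule algebraic_int_stable)
  thus ?thesis using kn unfolding y_def by blast
qed

lemma int_span_stable_pair:
  assumes x: "algebraic_int x" and y: "algebraic_int (y::complex)"
  shows "\<exists>T. finite T \<and> 1 \<in> T \<and> stable_under T x \<and> stable_under T y"
proof -
  obtain S where S: "finite S" "1 \<in> S" "stable_under S x"
    using int_span_adjoin_algebraic_int[of "{1}" x] x by auto
  show ?thesis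
    using int_span_adjoin_algebraic_int[OF S(1,2) y] S(3) by blast
qed

lemma algebraic_int_add [intro]:
  assumes "algebraic_int x" and "algebraic_int (y::complex)"
  shows "algebraic_int (x + y)"
proof -
  obtain T where T: "finite T" "1 \<in> T" "stable_under T x" "stable_under T y"
    using int_span_stable_pair[OF assms] by blast
  hence "stable_under T (x + y)"
    by (auto simp: stable_under_def distrib_right intro: int_span_add)
  with T show ?thesis by (intro algebraic_int_stable)
qed

lemma algebraic_int_mult [intro]:
  assumes "algebraic_int x" and "algebraic_int (y::complex)"
  shows "algebraic_int (x * y)"
proof -
  obtain T where T: "finite T" "1 \<in> T" "stable_under T x" "stable_under T y"
    using int_span_stable_pair[OF assms] by blast
  hence "stable_under T (x * y)"
    by (auto simp: stable_under_def mult.assoc intro: int_span_mult_closed)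
  with T show ?thesis by (intro algebraic_int_stable)
qed

lemma algebraic_int_diff [intro]:
  "algebraic_int x \<Longrightarrow> algebraic_int (y::complex) \<Longrightarrow> algebraic_int (x - y)"
  using algebraic_int_add[of x "- y"] by simp

lemma algebraic_int_of_int [simp, intro]: "algebraic_int (of_int n)"
  by (rule int_imp_algebraic_int) auto

lemma algebraic_int_sum [intro]:
  "(\<And>i. i \<in> I \<Longrightarrow> algebraic_int (f i :: complex)) \<Longrightarrow> algebraic_int (sum f I)"
  by (induction I rule: infinite_finite_induct) auto

lemma algebraic_int_prod [intro]:
  "(\<And>i. i \<in> I \<Longrightarrow> algebraic_int (f i :: complex)) \<Longrightarrow> algebraic_int (prod f I)"
  by (induction I rule: infinite_finite_induct) auto

lemma algebraic_int_power [intro]: "algebraic_int (x::complex) \<Longrightarrow> algebraic_int (x ^ n)"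
  by (induction n) auto

lemma algebraic_int_quadratic:
  assumes "algebraic_int b" "algebraic_int e" "(t::complex)\<^sup>2 = b * t + e"
  shows "algebraic_int t"
proof -
  obtain S where S: "finite S" "1 \<in> S" "stable_under S b" "stable_under S e"
    using int_span_stable_pair[OF assms(1,2)] by blast
  let ?T = "(\<lambda>(i, s). t ^ i * s) ` ({..<2} \<times> S)"
  have T: "finite ?T" using S by auto
  have TI: "t ^ i * s \<in> int_span ?T" if "i < 2" "s \<in> S" for i s
    by (rule int_span_superset) (use that T in \<open>auto simp: image_iff\<close>)
  have "t\<^sup>2 * s \<in> int_span ?T" if "s \<in> S" for s
  proof -
    have "t\<^sup>2 * s = t * (b * s) + 1 * (e * s)" by (simp add: assms(3) algebra_simps)
    moreover have "t * (b * s) \<in> int_span ?T"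
      using int_span_mult_closed[of S t ?T "b * s"] TI[of 1] S(3) that by (simp add: stable_under_def)
    moreover have "1 * (e * s) \<in> int_span ?T"
      using int_span_mult_closed[of S 1 ?T "e * s"] TI[of 0] S(4) that by (simp add: stable_under_def)
    ultimately show ?thesis by (simp only: int_span_add)
  qed
  from int_span_adjoin[OF S(1,2) this] obtain T where "finite T" "1 \<in> T" "stable_under T t"
    by auto
  thus ?thesis by (intro algebraic_int_stable)
qed

lemma algebraic_int_square_root: "algebraic_int (x\<^sup>2) \<Longrightarrow> algebraic_int (x::complex)"
  by (rule algebraic_int_quadratic[of 0 "x\<^sup>2"]) auto

text \<open>A monic equation of \<open>a\<close> does not vanish modulo \<open>p\<close>;
  \<open>i\<close> is the position of its lowest coefficient not divisible by \<open>p\<close>, and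
  \<open>c\<close> is that coefficient. The case \<open>p = 0\<close> is included and yields integer
  multiples of \<open>a\<close>. For prime \<open>p\<close> the relation yields both inverses modulo
  a prime ideal and powers locally divisible by \<open>p\<close>.\<close>

lemma algebraic_int_imp_decomposition:
  fixes a :: complex and p :: int
  assumes a: "algebraic_int a" and p: "\<bar>p\<bar> \<noteq> 1"
  shows "\<exists>i c h t. \<not> p dvd c \<and>
    a ^ i * (of_int c + a * poly (map_poly of_int h) a) = of_int p * poly (map_poly of_int t) a"
proof -
  obtain f where f: "poly (map_poly of_int f) a = 0" "lead_coeff f = (1::int)"
    using a unfolding algebraic_int_altdef_ipoly by auto
  have "\<exists>i c h t. \<not> p dvd c \<and> f = monom 1 i * pCons c h + smult p t" if "\<exists>i. \<not> p dvd coeff f i" for f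
    using that
  proof (induction f)
    case (pCons b g)
    show ?case
    proof (cases "p dvd b")
      case False
      thus ?thesis by (intro exI[of _ 0] exI[of _ b] exI[of _ g]) auto
    next
      case True
      then obtain d where d: "b = p * d" by auto
      obtain i where "\<not> p dvd coeff (pCons b g) i" using pCons.prems by auto
      hence "\<exists>i. \<not> p dvd coeff g i" using True by (auto simp: coeff_pCons split: nat.splits)
      then obtain i c h t where *: "\<not> p dvd c" "g = monom 1 i * pCons c h + smult p t"
        using pCons.IH by blast
      have "pCons b g = monom 1 (Suc i) * pCons c h + smult p (pCons d t)"
        by (simp add: *(2) d monom_Suc)
      thus ?thesis using *(1) by blast
    qed
  qed auto
  moreover have "\<not> p dvd coeff f (degree f)" using f(2) p by (auto simp: zdvd1_eq)
  ultimately obtain i c h t where *: "\<not> p dvd c" "f = monom 1 i * pCons c h + smult p t" by blast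
  have "poly (map_poly of_int f) a = a ^ i * (of_int c + a * poly (map_poly of_int h) a) +
      of_int p * poly (map_poly of_int t) a"
    unfolding *(2) of_int_poly_hom.hom_add of_int_poly_hom.hom_mult poly_add poly_mult
    by (simp add: of_int_hom.map_poly_pCons_hom of_int_hom.map_poly_hom_smult of_int_hom.map_poly_hom_monom poly_monom)
  hence "a ^ i * (of_int c + a * poly (map_poly of_int h) a) = of_int p * poly (map_poly of_int (- t)) a"
    using f(1) by (simp add: of_int_poly_hom.hom_uminus eq_neg_iff_add_eq_0)
  with *(1) show ?thesis by blast
qed

section \<open>Subfields of the complex numbers and primes of their rings of integers\<close>

hide_const (open) Divisibility.prime

lemma CC_simps [simp]:
  "carrier \<C>\<C> = UNIV" "x \<otimes>\<^bsub>\<C>\<C>\<^esub> y = x * y" "x \<oplus>\<^bsub>\<C>\<C>\<^esub> y = x + y" "\<one>\<^bsub>\<C>\<C>\<^esub> = 1" "\<zero>\<^bsub>\<C>\<C>\<^esub> = 0"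
  by (auto simp: ring_of_type_algebra_def)

lemma field_CC: "field \<C>\<C>"
  by (rule field_from_type_algebra)

lemma cring_CC: "cring \<C>\<C>"
  by (rule cring_from_type_algebra)

lemma ring_CC: "ring \<C>\<C>"
  by (rule ring_from_type_algebra)

lemma CC_a_inv [simp]: "\<ominus>\<^bsub>\<C>\<C>\<^esub> x = - x"
  by (rule abelian_group.minus_equality[OF ring.is_abelian_group[OF ring_CC]]) auto

lemma CC_m_inv: "x \<noteq> 0 \<Longrightarrow> inv\<^bsub>\<C>\<C>\<^esub> x = inverse x"
  by (rule comm_monoid.comm_inv_char[OF cring.axioms(2)[OF cring_CC]]) auto

lemma subfield_CC_iff:
  "subfield L \<C>\<C> \<longleftrightarrow>
    1 \<in> L \<and> (\<forall>x\<in>L. \<forall>y\<in>L. x - y \<in> L \<and> x * y \<in> L) \<and> (\<forall>x\<in>L. inverse x \<in> L)" (is "?l \<longleftrightarrow> ?r")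
proof
  assume L: ?l
  note L' = subringE[OF subfieldE(1)[OF L]]
  have "inverse x \<in> L" if "x \<in> L" for x
    using ring.subfield_m_inv(1)[OF ring_CC L, of x] that by (cases "x = 0") (auto simp: CC_m_inv)
  moreover have "x - y \<in> L" if "x \<in> L" "y \<in> L" for x y
    using L'(7)[of x "- y"] L'(5)[of y] that by simp
  ultimately show ?r
    using L'(3,6) by simp
next
  assume R: ?r
  have 0: "0 \<in> L" using R by (metis diff_self)
  have m: "- x \<in> L" if "x \<in> L" for x using R that 0 by (metis diff_0)
  have "x + y \<in> L" if "x \<in> L" "y \<in> L" for x y using R that m by (metis diff_minus_eq_add)
  hence "subring L \<C>\<C>"
    using R m by (intro ring.subringI[OF ring_CC]) auto
  thus ?l by (rule field.subfieldI'[OF field_CC]) (use R in \<open>auto simp: CC_m_inv\<close>)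
qed

locale complex_subfield =
  fixes L :: "complex set"
  assumes subfield_L: "subfield L \<C>\<C>"
begin

lemma one_in [simp, intro]: "1 \<in> L"
  and diff_in [intro]: "x \<in> L \<Longrightarrow> y \<in> L \<Longrightarrow> x - y \<in> L"
  and mult_in [intro]: "x \<in> L \<Longrightarrow> y \<in> L \<Longrightarrow> x * y \<in> L"
  and inverse_in [intro]: "x \<in> L \<Longrightarrow> inverse x \<in> L"
  using subfield_L unfolding subfield_CC_iff by auto

lemma zero_in [simp, intro]: "0 \<in> L"
  using diff_in[of 1 1] by simp

lemma minus_in [intro]: "x \<in> L \<Longrightarrow> - x \<in> L"
  using diff_in[of 0 x] by simp

lemma add_in [intro]: "x \<in> L \<Longrightarrow> y \<in> L \<Longrightarrow> x + y \<in> L"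
  using diff_in[of x "- y"] by auto

lemma divide_in [intro]: "x \<in> L \<Longrightarrow> y \<in> L \<Longrightarrow> x / y \<in> L"
  by (auto simp: divide_inverse)

lemma power_in [intro]: "x \<in> L \<Longrightarrow> x ^ n \<in> L"
  by (induction n) auto

lemma sum_in [intro]: "(\<And>i. i \<in> I \<Longrightarrow> f i \<in> L) \<Longrightarrow> sum f I \<in> L"
  by (induction I rule: infinite_finite_induct) auto

lemma prod_in [intro]: "(\<And>i. i \<in> I \<Longrightarrow> f i \<in> L) \<Longrightarrow> prod f I \<in> L"
  by (induction I rule: infinite_finite_induct) auto

lemma of_nat_in [simp, intro]: "of_nat n \<in> L"
  by (induction n) auto

lemma of_int_in [simp, intro]: "of_int n \<in> L"
  by (cases n) auto

lemma numeral_in [simp, intro]: "numeral n \<in> L"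
  using of_nat_in[of "numeral n"] by simp

abbreviation OL :: "complex set" where "OL \<equiv> carrier (ring_of_integers L)"

lemma OL_iff: "x \<in> OL \<longleftrightarrow> x \<in> L \<and> algebraic_int x"
  by (simp add: ring_of_integers_def)

lemma OL_imp_in [dest]: "x \<in> OL \<Longrightarrow> x \<in> L"
  by (simp add: OL_iff)

lemma OL_add [intro]: "x \<in> OL \<Longrightarrow> y \<in> OL \<Longrightarrow> x + y \<in> OL"
  and OL_mult [intro]: "x \<in> OL \<Longrightarrow> y \<in> OL \<Longrightarrow> x * y \<in> OL"
  and OL_diff [intro]: "x \<in> OL \<Longrightarrow> y \<in> OL \<Longrightarrow> x - y \<in> OL"
  and OL_minus [intro]: "x \<in> OL \<Longrightarrow> - x \<in> OL"
  and OL_power [intro]: "x \<in> OL \<Longrightarrow> x ^ n \<in> OL"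
  and OL_of_int [simp, intro]: "of_int k \<in> OL"
  and OL_sum [intro]: "(\<And>i. i \<in> I \<Longrightarrow> f i \<in> OL) \<Longrightarrow> sum f I \<in> OL"
  and OL_prod [intro]: "(\<And>i. i \<in> I \<Longrightarrow> f i \<in> OL) \<Longrightarrow> prod f I \<in> OL"
  by (auto simp: OL_iff)

lemma OL_0 [simp, intro]: "0 \<in> OL" and OL_1 [simp, intro]: "1 \<in> OL"
  and OL_numeral [simp, intro]: "numeral k \<in> OL" and OL_of_nat [simp, intro]: "of_nat n \<in> OL"
  using OL_of_int[of 0] OL_of_int[of 1] OL_of_int[of "numeral k"] OL_of_int[of "int n"] by simp_all

lemma OL_poly [intro]: "x \<in> OL \<Longrightarrow> poly (map_poly of_int p) x \<in> OL"
  by (induction p) (auto simp: of_int_hom.map_poly_pCons_hom)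

lemma ring_of_integers_simps [simp]:
  "x \<otimes>\<^bsub>ring_of_integers L\<^esub> y = x * y" "x \<oplus>\<^bsub>ring_of_integers L\<^esub> y = x + y"
  "\<one>\<^bsub>ring_of_integers L\<^esub> = 1" "\<zero>\<^bsub>ring_of_integers L\<^esub> = 0"
  by (auto simp: ring_of_integers_def ring_of_type_algebra_def)

lemma cring_ring_of_integers: "cring (ring_of_integers L)"
proof (rule cringI)
  show "abelian_group (ring_of_integers L)"
    by (rule abelian_groupI) (auto simp: intro: bexI[of _ "- _"])
  show "Group.comm_monoid (ring_of_integers L)"
    by (rule comm_monoidI) auto
qed (auto simp: algebra_simps)

lemma ideal_ring_of_integers_iff:
  "ideal P (ring_of_integers L) \<longleftrightarrow>
     P \<subseteq> OL \<and> 0 \<in> P \<and> (\<forall>x\<in>P. \<forall>y\<in>P. x + y \<in> P) \<and> (\<forall>x\<in>P. \<forall>a\<in>OL. a * x \<in> P)" (is "_ \<longleftrightarrow> ?r")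
proof
  interpret R: cring "ring_of_integers L" by (rule cring_ring_of_integers)
  assume "ideal P (ring_of_integers L)"
  then interpret ideal P "ring_of_integers L" .
  show ?r using a_subset zero_closed a_closed I_l_closed by auto
next
  interpret R: cring "ring_of_integers L" by (rule cring_ring_of_integers)
  assume r: ?r
  show "ideal P (ring_of_integers L)"
  proof (rule idealI)
    show "ring (ring_of_integers L)" by (rule R.ring_axioms)
    show "subgroup P (add_monoid (ring_of_integers L))"
    proof (rule R.add.subgroupI)
      fix a assume "a \<in> P"
      hence "- 1 * a \<in> P" using r OL_minus[OF OL_1] by blast
      moreover have "\<ominus>\<^bsub>ring_of_integers L\<^esub> a = - a"
        by (rule R.minus_equality) (use r \<open>a \<in> P\<close> in auto)
      ultimately show "\<ominus>\<^bsub>ring_of_integers L\<^esub> a \<in> P" by simp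
    qed (use r in auto)
  qed (use r in \<open>auto simp: mult.commute\<close>)
qed

lemma finite_primes_iff:
  "P \<in> finite_primes L \<longleftrightarrow>
     P \<subseteq> OL \<and> 0 \<in> P \<and> (\<forall>x\<in>P. \<forall>y\<in>P. x + y \<in> P) \<and> (\<forall>x\<in>P. \<forall>a\<in>OL. a * x \<in> P) \<and>
     1 \<notin> P \<and> P \<noteq> {0} \<and> (\<forall>x\<in>OL. \<forall>y\<in>OL. x * y \<in> P \<longrightarrow> x \<in> P \<or> y \<in> P)" (is "_ \<longleftrightarrow> ?r")
proof -
  have "P = OL \<longleftrightarrow> 1 \<in> P" if "ideal P (ring_of_integers L)"
    using that OL_1 unfolding ideal_ring_of_integers_iff by (metis mult.right_neutral subsetI subset_antisym)
  hence "P \<in> finite_primes L \<longleftrightarrow> ideal P (ring_of_integers L) \<and> 1 \<notin> P \<and> P \<noteq> {0} \<and>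
      (\<forall>x\<in>OL. \<forall>y\<in>OL. x * y \<in> P \<longrightarrow> x \<in> P \<or> y \<in> P)"
    unfolding finite_primes_def primeideal_def primeideal_axioms_def
    using cring_ring_of_integers by (simp, metis)
  thus ?thesis
    unfolding ideal_ring_of_integers_iff by (simp add: conj_assoc)
qed

end

locale prime_of_subfield = complex_subfield +
  fixes Q :: "complex set"
  assumes Q: "Q \<in> finite_primes L"
begin

lemma Q_OL [dest]: "x \<in> Q \<Longrightarrow> x \<in> OL"
  and Q_0 [simp, intro]: "0 \<in> Q"
  and Q_add [intro]: "x \<in> Q \<Longrightarrow> y \<in> Q \<Longrightarrow> x + y \<in> Q"
  and Q_mult [intro]: "x \<in> Q \<Longrightarrow> a \<in> OL \<Longrightarrow> a * x \<in> Q"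
  and Q_1 [simp]: "1 \<notin> Q"
  and Q_nontrivial: "Q \<noteq> {0}"
  and Q_prime: "x \<in> OL \<Longrightarrow> y \<in> OL \<Longrightarrow> x * y \<in> Q \<Longrightarrow> x \<in> Q \<or> y \<in> Q"
  using Q unfolding finite_primes_iff by auto

lemma Q_mult' [intro]: "x \<in> Q \<Longrightarrow> a \<in> OL \<Longrightarrow> x * a \<in> Q"
  using Q_mult[of x a] by (simp add: mult.commute)

lemma Q_minus [intro]: "x \<in> Q \<Longrightarrow> - x \<in> Q"
  using Q_mult[of x "- 1"] OL_minus[OF OL_1] by simp

lemma Q_minus_iff [simp]: "- x \<in> Q \<longleftrightarrow> x \<in> Q"
  using Q_minus[of x] Q_minus[of "- x"] by auto

lemma Q_diff [intro]: "x \<in> Q \<Longrightarrow> y \<in> Q \<Longrightarrow> x - y \<in> Q"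
  using Q_add[of x "- y"] by auto

lemma Q_diff_commute: "x - y \<in> Q \<longleftrightarrow> y - x \<in> Q"
  using Q_minus_iff[of "x - y"] by simp

lemma Q_diff_iff: "x - y \<in> Q \<Longrightarrow> x \<in> Q \<longleftrightarrow> y \<in> Q"
  using Q_add[of "x - y" y] Q_diff[of x "x - y"] by auto

lemma Q_diff_trans: "x - y \<in> Q \<Longrightarrow> y - z \<in> Q \<Longrightarrow> x - z \<in> Q"
  using Q_add[of "x - y" "y - z"] by simp

lemma Q_diff_mult:
  assumes "x - y \<in> Q" "x' - y' \<in> Q" "x \<in> OL" "y' \<in> OL"
  shows "x * x' - y * y' \<in> Q"
proof -
  have "x * x' - y * y' = x * (x' - y') + y' * (x - y)" by (simp add: algebra_simps)
  thus ?thesis using assms by (simp only: Q_add Q_mult)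
qed

lemma Q_diff_power: "x - y \<in> Q \<Longrightarrow> x \<in> OL \<Longrightarrow> y \<in> OL \<Longrightarrow> x ^ n - y ^ n \<in> Q"
  by (induction n) (auto intro!: Q_diff_mult)

lemma Q_sum [intro]: "(\<And>i. i \<in> I \<Longrightarrow> f i \<in> Q) \<Longrightarrow> sum f I \<in> Q"
  by (induction I rule: infinite_finite_induct) auto

lemma Q_prod_iff: "finite I \<Longrightarrow> (\<And>i. i \<in> I \<Longrightarrow> f i \<in> OL) \<Longrightarrow> prod f I \<in> Q \<longleftrightarrow> (\<exists>i\<in>I. f i \<in> Q)"
proof (induction I rule: finite_induct)
  case (insert i I)
  have "prod f I \<in> OL" using insert by auto
  thus ?case using insert Q_prime[of "f i" "prod f I"] by auto
qed auto

lemma notin_mult: "x \<in> OL \<Longrightarrow> y \<in> OL \<Longrightarrow> x \<notin> Q \<Longrightarrow> y \<notin> Q \<Longrightarrow> x * y \<notin> Q"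
  using Q_prime by blast

lemma Q_power_iff: "x \<in> OL \<Longrightarrow> n > 0 \<Longrightarrow> x ^ n \<in> Q \<longleftrightarrow> x \<in> Q"
proof (induction n)
  case (Suc n)
  thus ?case using Q_prime[of x "x ^ n"] by (cases "n = 0") auto
qed auto

end

text \<open>The decomposition modulo 0: after cancelling a power of \<open>x\<close>, an equation of
  \<open>x\<close> has a nonzero constant term.\<close>

lemma exists_nonzero_int_multiple:
  assumes "algebraic_int x" "x \<noteq> (0::complex)"
  shows "\<exists>c h. c \<noteq> 0 \<and> of_int c = x * poly (map_poly of_int h) x"
proof -
  have "\<exists>i c h t. \<not> 0 dvd c \<and> x ^ i * (of_int c + x * poly (map_poly of_int h) x)
      = of_int 0 * poly (map_poly of_int t) x"
    by (rule algebraic_int_imp_decomposition) (use assms in auto)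
  then obtain i c h t where *: "\<not> 0 dvd c" "x ^ i * (of_int c + x * poly (map_poly of_int h) x)
      = of_int 0 * poly (map_poly of_int t) x"
    by blast
  hence "of_int c = x * poly (map_poly of_int (- h)) x"
    using assms(2) by (simp add: of_int_poly_hom.hom_uminus eq_neg_iff_add_eq_0)
  with *(1) show ?thesis by (intro exI[of _ c] exI[of _ "- h"]) auto
qed

section \<open>Residue characteristic and maximality of nonzero primes\<close>

context prime_of_subfield
begin

lemma exists_prime_int_in_Q: "\<exists>p. prime p \<and> of_nat p \<in> Q"
proof -
  obtain x where x: "x \<in> Q" "x \<noteq> 0" using Q_nontrivial by auto
  then obtain c h where c: "c \<noteq> 0" "of_int c = x * poly (map_poly of_int h) x"
    using exists_nonzero_int_multiple[of x] by (metis OL_iff Q_OL)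
  have "of_int c \<in> Q" using x c by auto
  hence "of_int \<bar>c\<bar> \<in> Q" by (cases "c \<ge> 0") auto
  hence "of_nat (nat \<bar>c\<bar>) \<in> Q" by simp
  moreover have "nat \<bar>c\<bar> \<noteq> 0" using c by simp
  moreover have "(of_nat n \<in> Q \<longrightarrow> (\<exists>p. prime p \<and> of_nat p \<in> Q))" if "n \<noteq> 0" for n :: nat
    using that
  proof (induction n rule: prime_divisors_induct)
    case (factor p x)
    thus ?case using Q_prime[of "of_nat p" "of_nat x"] by auto
  qed auto
  ultimately show ?thesis by blast
qed

definition res_char :: nat where "res_char = (SOME p. prime p \<and> of_nat p \<in> Q)"

lemma prime_res_char: "prime res_char" and res_char_in_Q: "of_nat res_char \<in> Q"
  using someI_ex[OF exists_prime_int_in_Q] unfolding res_char_def by auto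

lemma of_int_in_Q_iff: "of_int n \<in> Q \<longleftrightarrow> int res_char dvd n"
proof
  assume "int res_char dvd n"
  then obtain m where "n = int res_char * m" by auto
  thus "of_int n \<in> Q" using res_char_in_Q by auto
next
  assume n: "of_int n \<in> Q"
  show "int res_char dvd n"
  proof (rule ccontr)
    assume "\<not> int res_char dvd n"
    hence "Rings.coprime (int res_char) n"
      using prime_res_char by (simp add: prime_imp_coprime)
    then obtain u v where "u * int res_char + v * n = 1"
      using bezout_int[of "int res_char" n] by (auto simp: coprime_iff_gcd_eq_1)
    hence "of_int (u * int res_char + v * n) = (1::complex)" by (simp only: of_int_1)
    hence "of_int u * of_nat res_char + of_int v * of_int n = (1::complex)" by simp
    moreover have "of_int u * of_nat res_char + of_int v * of_int n \<in> Q"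
      using n res_char_in_Q by auto
    ultimately show False by simp
  qed
qed

lemma of_nat_in_Q_iff: "of_nat n \<in> Q \<longleftrightarrow> res_char dvd n"
  using of_int_in_Q_iff[of "int n"] by simp

lemma res_char_eq: "prime p \<Longrightarrow> of_nat p \<in> Q \<Longrightarrow> p = res_char"
  using of_nat_in_Q_iff prime_res_char by (metis primes_dvd_imp_eq)

text \<open>Modulo the residue characteristic, \<open>a^i * (c + a * h(a))\<close> vanishes. Since
  \<open>a^i\<close> is not in \<open>Q\<close>, \<open>c + a * h(a)\<close> is, and
  \<open>c\<close> is invertible modulo the residue characteristic.\<close>

lemma Q_maximal:
  assumes a: "a \<in> OL" "a \<notin> Q"
  shows "\<exists>b\<in>OL. a * b - 1 \<in> Q"
proof -
  have p: "\<bar>int res_char\<bar> \<noteq> 1" using prime_res_char by (auto dest: prime_gt_1_nat)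
  obtain i c h t where *: "\<not> int res_char dvd c" "a ^ i * (of_int c + a * poly (map_poly of_int h) a)
      = of_int (int res_char) * poly (map_poly of_int t) a"
    using algebraic_int_imp_decomposition[of a "int res_char"] a p by (metis OL_iff Q_OL)
  let ?h = "poly (map_poly of_int h) a"
  have h: "?h \<in> OL" and "poly (map_poly of_int t) a \<in> OL" using a by auto
  hence "a ^ i * (of_int c + a * ?h) \<in> Q"
    using res_char_in_Q unfolding *(2) by auto
  moreover have "a ^ i \<notin> Q" using a Q_power_iff[of a i] by (cases "i = 0") auto
  ultimately have in_Q: "of_int c + a * ?h \<in> Q"
    using Q_prime[of "a ^ i" "of_int c + a * ?h"] a h by blast
  have "Rings.coprime (int res_char) c"
    using prime_res_char *(1) by (simp add: prime_imp_coprime)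
  then obtain u v where "u * int res_char + v * c = 1"
    using bezout_int[of "int res_char" c] by (auto simp: coprime_iff_gcd_eq_1)
  hence "of_int (u * int res_char + v * c) = (1::complex)" by (simp only: of_int_1)
  hence uv: "of_int u * of_nat res_char + of_int v * of_int c = (1::complex)" by simp
  have "a * (of_int (-v) * ?h) - 1 =
      - (of_int v * (of_int c + a * ?h)) - of_int u * of_nat res_char"
    using uv by (simp add: algebra_simps)
  also have "\<dots> \<in> Q" using in_Q res_char_in_Q by (intro Q_diff Q_minus Q_mult) auto
  finally show ?thesis using h by blast
qed

text \<open>In the localization at \<open>Q\<close>, every element of \<open>Q\<close> is nilpotent
  modulo the residue characteristic: for \<open>a\<close> in \<open>Q\<close> the factor
  \<open>c + a * h(a)\<close> is congruent to \<open>c\<close> and hence a local unit. One further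
  factor \<open>a\<close> makes the exponent positive.\<close>

lemma Q_power_multiple:
  assumes a: "a \<in> Q"
  shows "\<exists>n>0. \<exists>s\<in>OL - Q. \<exists>t\<in>OL. s * a ^ n = of_nat res_char * t"
proof -
  have p: "\<bar>int res_char\<bar> \<noteq> 1" using prime_res_char by (auto dest: prime_gt_1_nat)
  obtain i c h t where *: "\<not> int res_char dvd c" "a ^ i * (of_int c + a * poly (map_poly of_int h) a)
      = of_int (int res_char) * poly (map_poly of_int t) a"
    using algebraic_int_imp_decomposition[of a "int res_char"] a p by (metis OL_iff Q_OL)
  let ?h = "poly (map_poly of_int h) a"
  have h: "?h \<in> OL" and t: "poly (map_poly of_int t) a \<in> OL" using a by auto
  have "of_int c \<notin> Q" using *(1) by (simp add: of_int_in_Q_iff)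
  hence "of_int c + a * ?h \<notin> Q"
    using a h Q_diff_iff[of "of_int c + a * ?h" "of_int c"] by auto
  moreover have eq: "(of_int c + a * ?h) * a ^ Suc i = of_nat res_char * (a * poly (map_poly of_int t) a)"
    using *(2) by (simp add: mult_ac)
  moreover have "a * poly (map_poly of_int t) a \<in> OL" "of_int c + a * ?h \<in> OL"
    using t h a by auto
  ultimately show ?thesis by (intro exI[of _ "Suc i"] conjI bexI[where x = "of_int c + a * ?h"]
        bexI[where x = "a * poly (map_poly of_int t) a"]) (auto simp del: power_Suc)
qed

end

section \<open>Galois groups and decomposition groups\<close>

lemma galois_group_iff:
  "\<sigma> \<in> carrier (galois_group L E) \<longleftrightarrow>
    \<sigma> \<in> extensional L \<and> bij_betw \<sigma> L L \<and>
    (\<forall>x\<in>L. \<forall>y\<in>L. \<sigma> (x + y) = \<sigma> x + \<sigma> y \<and> \<sigma> (x * y) = \<sigma> x * \<sigma> y) \<and> \<sigma> 1 = 1 \<and> (\<forall>x\<in>E. \<sigma> x = x)"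
  unfolding galois_group_def Ring.ring_hom_def Bij_def by (auto simp: bij_betw_def)

lemma galois_group_mult:
  "\<sigma> \<in> carrier (galois_group L E) \<Longrightarrow> \<tau> \<in> carrier (galois_group L E) \<Longrightarrow>
    \<sigma> \<otimes>\<^bsub>galois_group L E\<^esub> \<tau> = compose L \<sigma> \<tau>"
  by (simp add: galois_group_def BijGroup_def)

lemma galois_group_one: "\<one>\<^bsub>galois_group L E\<^esub> = (\<lambda>x\<in>L. x)"
  by (simp add: galois_group_def BijGroup_def)

text \<open>The finiteness of the automorphism group is a separate assumption: for \<open>K\<close>
  it is transported from the given finite group, for the compositum from \<open>K\<close>, each time
  along an isomorphism.\<close>

locale finite_galois =
  fixes E L :: "complex set"
  assumes galois: "finite_galois_ext E L"
    and finite_G [simp]: "finite (carrier (galois_group L E))"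

sublocale finite_galois \<subseteq> complex_subfield L
  using galois by (intro complex_subfield.intro) (auto simp: finite_galois_ext_def field_ext_def)

context complex_subfield
begin

lemmas [simp] = add_in diff_in mult_in inverse_in minus_in divide_in power_in OL_imp_in
  OL_add OL_diff OL_mult OL_minus OL_power

end

context finite_galois
begin

abbreviation "G \<equiv> carrier (galois_group L E)"

lemma E_subset: "E \<subseteq> L"
  using galois by (auto simp: finite_galois_ext_def field_ext_def)

lemma fixed_imp_in_E: "x \<in> L \<Longrightarrow> (\<And>\<sigma>. \<sigma> \<in> G \<Longrightarrow> \<sigma> x = x) \<Longrightarrow> x \<in> E"
  using galois by (auto simp: finite_galois_ext_def)

lemma G_bij: "\<sigma> \<in> G \<Longrightarrow> bij_betw \<sigma> L L"
  and G_extensional: "\<sigma> \<in> G \<Longrightarrow> \<sigma> \<in> extensional L"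
  unfolding galois_group_iff by blast+

lemma G_ext: "\<sigma> \<in> G \<Longrightarrow> \<tau> \<in> G \<Longrightarrow> (\<And>x. x \<in> L \<Longrightarrow> \<sigma> x = \<tau> x) \<Longrightarrow> \<sigma> = \<tau>"
  by (rule extensionalityI[of _ L]) (auto intro: G_extensional)

lemma G_id [simp]: "(\<lambda>x\<in>L. x) \<in> G"
  using E_subset by (auto simp: galois_group_iff bij_betw_def inj_on_def)

lemma G_in [simp]: "\<sigma> \<in> G \<Longrightarrow> x \<in> L \<Longrightarrow> \<sigma> x \<in> L"
  and G_add [simp]: "\<sigma> \<in> G \<Longrightarrow> x \<in> L \<Longrightarrow> y \<in> L \<Longrightarrow> \<sigma> (x + y) = \<sigma> x + \<sigma> y"
  and G_mult [simp]: "\<sigma> \<in> G \<Longrightarrow> x \<in> L \<Longrightarrow> y \<in> L \<Longrightarrow> \<sigma> (x * y) = \<sigma> x * \<sigma> y"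
  and G_1 [simp]: "\<sigma> \<in> G \<Longrightarrow> \<sigma> 1 = 1"
  and G_E [simp]: "\<sigma> \<in> G \<Longrightarrow> z \<in> E \<Longrightarrow> \<sigma> z = z"
  by (auto simp: galois_group_iff bij_betw_def)

lemma G_0 [simp]: "\<sigma> \<in> G \<Longrightarrow> \<sigma> 0 = 0"
  using G_add[of \<sigma> 0 0] by simp

lemma G_minus [simp]: "\<sigma> \<in> G \<Longrightarrow> x \<in> L \<Longrightarrow> \<sigma> (- x) = - \<sigma> x"
  using G_add[of \<sigma> x "- x"] by (simp add: minus_in add_eq_0_iff)

lemma G_diff [simp]: "\<sigma> \<in> G \<Longrightarrow> x \<in> L \<Longrightarrow> y \<in> L \<Longrightarrow> \<sigma> (x - y) = \<sigma> x - \<sigma> y"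
  using G_add[of \<sigma> x "- y"] by (simp add: minus_in)

lemma G_eq_iff [simp]: "\<sigma> \<in> G \<Longrightarrow> x \<in> L \<Longrightarrow> y \<in> L \<Longrightarrow> \<sigma> x = \<sigma> y \<longleftrightarrow> x = y"
  using bij_betw_imp_inj_on[OF G_bij, of \<sigma>] inj_on_eq_iff by fastforce

lemma G_eq_0_iff [simp]: "\<sigma> \<in> G \<Longrightarrow> x \<in> L \<Longrightarrow> \<sigma> x = 0 \<longleftrightarrow> x = 0"
  using G_eq_iff[of \<sigma> x 0] by simp

lemma G_power [simp]: "\<sigma> \<in> G \<Longrightarrow> x \<in> L \<Longrightarrow> \<sigma> (x ^ n) = \<sigma> x ^ n"
  by (induction n) (auto simp: power_in)

lemma G_inverse [simp]: "\<sigma> \<in> G \<Longrightarrow> x \<in> L \<Longrightarrow> \<sigma> (inverse x) = inverse (\<sigma> x)"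
proof (cases "x = 0")
  case False
  assume *: "\<sigma> \<in> G" "x \<in> L"
  hence "\<sigma> x * \<sigma> (inverse x) = 1"
    using False G_mult[of \<sigma> x "inverse x"] by (auto simp: inverse_in)
  thus ?thesis by (rule inverse_unique[symmetric])
qed auto

lemma G_divide [simp]: "\<sigma> \<in> G \<Longrightarrow> x \<in> L \<Longrightarrow> y \<in> L \<Longrightarrow> \<sigma> (x / y) = \<sigma> x / \<sigma> y"
  by (simp add: divide_inverse inverse_in)

lemma G_of_nat [simp]: "\<sigma> \<in> G \<Longrightarrow> \<sigma> (of_nat n) = of_nat n"
  by (induction n) auto

lemma G_of_int [simp]: "\<sigma> \<in> G \<Longrightarrow> \<sigma> (of_int n) = of_int n"
  by (cases n) (auto simp flip: of_nat_Suc)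

lemma G_sum [simp]: "\<sigma> \<in> G \<Longrightarrow> (\<And>i. i \<in> I \<Longrightarrow> f i \<in> L) \<Longrightarrow> \<sigma> (sum f I) = (\<Sum>i\<in>I. \<sigma> (f i))"
  by (induction I rule: infinite_finite_induct) (auto simp: sum_in)

lemma G_prod [simp]: "\<sigma> \<in> G \<Longrightarrow> (\<And>i. i \<in> I \<Longrightarrow> f i \<in> L) \<Longrightarrow> \<sigma> (prod f I) = (\<Prod>i\<in>I. \<sigma> (f i))"
  by (induction I rule: infinite_finite_induct) (auto simp: prod_in)

lemma G_poly_int: "\<sigma> \<in> G \<Longrightarrow> x \<in> L \<Longrightarrow> \<sigma> (poly (map_poly of_int p) x) = poly (map_poly of_int p) (\<sigma> x) \<and>
    poly (map_poly of_int p) x \<in> L"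
  by (induction p) (auto simp: of_int_hom.map_poly_pCons_hom)

lemma G_OL [simp]: "\<sigma> \<in> G \<Longrightarrow> x \<in> OL \<Longrightarrow> \<sigma> x \<in> OL"
proof -
  assume *: "\<sigma> \<in> G" "x \<in> OL"
  then obtain p where p: "poly (map_poly of_int p) x = 0" "lead_coeff p = (1::int)"
    unfolding OL_iff algebraic_int_altdef_ipoly by auto
  have "poly (map_poly of_int p) (\<sigma> x) = 0"
    using G_poly_int[of \<sigma> x p] * p by (auto simp: OL_iff)
  thus ?thesis using * p unfolding OL_iff algebraic_int_altdef_ipoly by auto
qed

lemma G_compose [simp]:
  assumes "\<sigma> \<in> G" "\<tau> \<in> G"
  shows "compose L \<sigma> \<tau> \<in> G"
  unfolding galois_group_iff
proof (intro conjI ballI)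
  show "bij_betw (compose L \<sigma> \<tau>) L L"
    by (rule bij_betw_compose[OF G_bij[OF assms(2)] G_bij[OF assms(1)]])
  show "compose L \<sigma> \<tau> \<in> extensional L" by simp
  show "compose L \<sigma> \<tau> x = x" if "x \<in> E" for x
    using assms that E_subset by (simp add: compose_eq subsetD)
qed (use assms in \<open>simp_all add: compose_eq\<close>)

lemma G_inv: "\<sigma> \<in> G \<Longrightarrow> \<exists>\<tau>\<in>G. \<forall>x\<in>L. \<tau> (\<sigma> x) = x \<and> \<sigma> (\<tau> x) = x"
proof -
  assume s: "\<sigma> \<in> G"
  define \<tau> where "\<tau> = restrict (inv_into L \<sigma>) L"
  have bij: "bij_betw \<sigma> L L" by (rule G_bij[OF s])
  have 1: "\<tau> (\<sigma> x) = x \<and> \<sigma> (\<tau> x) = x \<and> \<tau> x \<in> L" if "x \<in> L" for x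
    using that s bij_betw_inv_into_left[OF bij that] bij_betw_inv_into_right[OF bij that]
      bij_betw_apply[OF bij_betw_inv_into[OF bij] that] by (simp add: \<tau>_def)
  have eqI: "\<tau> x = y" if "y \<in> L" "\<sigma> y = x" for x y using that 1 by auto
  have "\<tau> \<in> G"
    unfolding galois_group_iff
  proof (intro conjI ballI)
    show "bij_betw \<tau> L L" unfolding \<tau>_def using bij_betw_inv_into[OF bij] by simp
    show "\<tau> \<in> extensional L" by (simp add: \<tau>_def)
    show "\<tau> x = x" if "x \<in> E" for x
      by (rule eqI) (use s that E_subset in auto)
  qed (rule eqI; use s 1 in simp)+
  with 1 show ?thesis by blast
qed

definition inv_G :: "(complex \<Rightarrow> complex) \<Rightarrow> complex \<Rightarrow> complex" where
  "inv_G \<sigma> = (SOME \<tau>. \<tau> \<in> G \<and> (\<forall>x\<in>L. \<tau> (\<sigma> x) = x \<and> \<sigma> (\<tau> x) = x))"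

lemma inv_G [simp]: "\<sigma> \<in> G \<Longrightarrow> inv_G \<sigma> \<in> G"
  and inv_G_left [simp]: "\<sigma> \<in> G \<Longrightarrow> x \<in> L \<Longrightarrow> inv_G \<sigma> (\<sigma> x) = x"
  and inv_G_right [simp]: "\<sigma> \<in> G \<Longrightarrow> x \<in> L \<Longrightarrow> \<sigma> (inv_G \<sigma> x) = x"
  using someI_ex[of "\<lambda>\<tau>. \<tau> \<in> G \<and> (\<forall>x\<in>L. \<tau> (\<sigma> x) = x \<and> \<sigma> (\<tau> x) = x)"] G_inv[of \<sigma>]
  unfolding inv_G_def by auto

lemma bij_compose_left: "\<sigma> \<in> G \<Longrightarrow> bij_betw (compose L \<sigma>) G G"
proof (rule bij_betwI[where g = "compose L (inv_G \<sigma>)"])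
  fix \<tau> assume "\<sigma> \<in> G" "\<tau> \<in> G"
  thus "compose L (inv_G \<sigma>) (compose L \<sigma> \<tau>) = \<tau>" "compose L \<sigma> (compose L (inv_G \<sigma>) \<tau>) = \<tau>"
    by (auto intro!: G_ext simp: compose_eq)
qed auto

lemma prod_orbit_eq: "\<tau> \<in> G \<Longrightarrow> x \<in> L \<Longrightarrow> (\<Prod>\<sigma>\<in>G. f (\<tau> (\<sigma> x))) = (\<Prod>\<sigma>\<in>G. f (\<sigma> x))"
  using prod.reindex_bij_betw[OF bij_compose_left, of \<tau> "\<lambda>\<sigma>. f (\<sigma> x)"] by (simp add: compose_eq)

lemma norm_in_E: "x \<in> L \<Longrightarrow> (\<Prod>\<sigma>\<in>G. \<sigma> x) \<in> E"
  by (rule fixed_imp_in_E) (auto simp: prod_orbit_eq[of _ _ "\<lambda>x. x"])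

lemma map_poly_mult_G:
  assumes "\<tau> \<in> G" "\<And>i. coeff p i \<in> L" "\<And>i. coeff q i \<in> L"
  shows "map_poly \<tau> (p * q) = map_poly \<tau> p * map_poly \<tau> q"
  by (rule poly_eqI) (use assms in \<open>simp add: coeff_map_poly coeff_mult mult_in\<close>)

text \<open>The characteristic polynomial of \<open>y\<close> over \<open>E\<close>. It replaces the
  minimal polynomial: its coefficients lie in \<open>E\<close>, and all its roots are conjugates of
  \<open>y\<close> inside \<open>L\<close>.\<close>

definition orbit_poly :: "complex \<Rightarrow> complex poly" where
  "orbit_poly y = (\<Prod>\<sigma>\<in>G. [:- \<sigma> y, 1:])"

lemma coeff_orbit_poly_E:
  assumes y: "y \<in> L"
  shows "coeff (orbit_poly y) i \<in> E"
proof -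
  have *: "coeff (\<Prod>\<sigma>\<in>I. [:- \<sigma> y, 1:]) i \<in> L" if "I \<subseteq> G" for I i
    using finite_subset[OF that finite_G] that
  proof (induction I arbitrary: i rule: finite_induct)
    case (insert \<sigma> I)
    thus ?case using y by (auto simp: coeff_pCons split: nat.splits)
  qed (auto simp: coeff_pCons split: nat.splits)
  have "map_poly \<tau> (\<Prod>\<sigma>\<in>I. [:- \<sigma> y, 1:]) = (\<Prod>\<sigma>\<in>I. [:- \<tau> (\<sigma> y), 1:])"
    if "\<tau> \<in> G" "I \<subseteq> G" for \<tau> I
    using finite_subset[OF that(2) finite_G] that(2)
  proof (induction I rule: finite_induct)
    case (insert \<sigma> I)
    have "map_poly \<tau> ([:- \<sigma> y, 1:] * (\<Prod>\<sigma>\<in>I. [:- \<sigma> y, 1:])) =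
        map_poly \<tau> [:- \<sigma> y, 1:] * map_poly \<tau> (\<Prod>\<sigma>\<in>I. [:- \<sigma> y, 1:])"
      using insert y that *[of I] by (intro map_poly_mult_G) (auto simp: coeff_pCons split: nat.splits)
    thus ?case using insert y that by (simp add: map_poly_pCons)
  qed (use that in \<open>auto simp: map_poly_pCons\<close>)
  hence "map_poly \<tau> (orbit_poly y) = orbit_poly y" if "\<tau> \<in> G" for \<tau>
    using that y prod_orbit_eq[of \<tau> y "\<lambda>z. [:- z, 1:]"] by (auto simp: orbit_poly_def)
  hence "\<tau> (coeff (orbit_poly y) i) = coeff (orbit_poly y) i" if "\<tau> \<in> G" for \<tau>
    using that G_0 by (metis coeff_map_poly)
  thus ?thesis using *[of G] by (auto simp: orbit_poly_def intro!: fixed_imp_in_E)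
qed

lemma coeff_orbit_poly:
  assumes y: "y \<in> OL"
  shows "coeff (orbit_poly y) i \<in> OL \<inter> E"
proof -
  have "coeff (\<Prod>\<sigma>\<in>I. [:- \<sigma> y, 1:]) i \<in> OL" if "I \<subseteq> G" for I i
    using finite_subset[OF that finite_G] that
  proof (induction I arbitrary: i rule: finite_induct)
    case (insert \<sigma> I)
    thus ?case using y by (auto simp: coeff_pCons split: nat.splits)
  qed (auto simp: coeff_pCons split: nat.splits)
  thus ?thesis using coeff_orbit_poly_E[of y i] y by (auto simp: orbit_poly_def)
qed

lemma poly_orbit_poly: "poly (orbit_poly y) z = (\<Prod>\<sigma>\<in>G. z - \<sigma> y)"
  by (simp add: orbit_poly_def poly_prod)

lemma poly_orbit_poly_self: "y \<in> L \<Longrightarrow> poly (orbit_poly y) y = 0"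
  unfolding poly_orbit_poly using G_id by (intro prod_zero bexI[of _ "\<lambda>x\<in>L. x"]) auto

lemma orbit_poly_nonzero: "orbit_poly y \<noteq> 0"
  by (simp add: orbit_poly_def)

lemma subfield_E: "complex_subfield E"
  using galois by (intro complex_subfield.intro) (auto simp: finite_galois_ext_def field_ext_def)

end

text \<open>Submodules of the complex numbers over the localization of \<open>A\<close> at
  \<open>Q\<close>, without forming that ring: the last clause says that elements of
  \<open>A - Q\<close> may be divided out.\<close>

definition local_ideal :: "complex set \<Rightarrow> complex set \<Rightarrow> complex set \<Rightarrow> bool" where
  "local_ideal A Q Z \<longleftrightarrow> 0 \<in> Z \<and> (\<forall>x\<in>Z. \<forall>y\<in>Z. x + y \<in> Z) \<and> (\<forall>x\<in>Z. \<forall>a\<in>A. a * x \<in> Z) \<and>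
     (\<forall>x. \<forall>s\<in>A - Q. s * x \<in> Z \<longrightarrow> x \<in> Z)"

section \<open>Decomposition groups and modules over the localization at a prime\<close>

locale galois_prime = finite_galois E L + prime_of_subfield L Q for E L Q
begin

definition DG :: "(complex \<Rightarrow> complex) set" where
  "DG = {\<sigma> \<in> G. \<forall>x\<in>Q. \<sigma> x \<in> Q}"

lemma DG_G [simp]: "\<sigma> \<in> DG \<Longrightarrow> \<sigma> \<in> G"
  by (auto simp: DG_def)

lemma DG_I: "\<sigma> \<in> G \<Longrightarrow> (\<And>x. x \<in> Q \<Longrightarrow> \<sigma> x \<in> Q) \<Longrightarrow> \<sigma> \<in> DG"
  and DG_Q: "\<sigma> \<in> DG \<Longrightarrow> x \<in> Q \<Longrightarrow> \<sigma> x \<in> Q"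
  unfolding DG_def by blast+

text \<open>By maximality: if \<open>x\<close> is not in \<open>Q\<close>, then \<open>x * b\<close>
  is congruent to 1 for some \<open>b\<close>, and applying \<open>\<sigma>\<close> shows that
  \<open>\<sigma> x\<close> is invertible modulo \<open>Q\<close> as well. So the inclusion demanded
  in \<open>DG\<close> is an equality.\<close>

lemma DG_iff: "\<sigma> \<in> DG \<Longrightarrow> x \<in> OL \<Longrightarrow> \<sigma> x \<in> Q \<longleftrightarrow> x \<in> Q"
proof
  assume *: "\<sigma> \<in> DG" "x \<in> OL" "\<sigma> x \<in> Q"
  show "x \<in> Q"
  proof (rule ccontr)
    assume "x \<notin> Q"
    then obtain b where b: "b \<in> OL" "x * b - 1 \<in> Q" using Q_maximal * by blast
    hence "\<sigma> (x * b - 1) \<in> Q" using * unfolding DG_def by blast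
    hence "\<sigma> x * \<sigma> b - 1 \<in> Q" using * b by simp
    moreover have "\<sigma> x * \<sigma> b \<in> Q" using * b by (intro Q_mult') simp_all
    ultimately show False using Q_diff_iff[of "\<sigma> x * \<sigma> b" 1] by simp
  qed
qed (rule DG_Q)

text \<open>
  Multiplying by \<open>s\<close> makes the conjugates under automorphisms outside the decomposition group \<open>DG\<close>
  negligible.
\<close>

lemma exists_concentrated: "\<exists>s\<in>OL - Q. \<forall>\<sigma>\<in>G - DG. \<sigma> s \<in> Q"
proof -
  have "\<exists>a\<in>OL - Q. \<sigma> a \<in> Q" if "\<sigma> \<in> G - DG" for \<sigma>
  proof -
    \<comment> \<open>The complement of \<open>DG\<close> is closed under inverses, so
      \<open>inv_G \<sigma>\<close> moves some \<open>x\<close> of \<open>Q\<close> out of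
      \<open>Q\<close>; then \<open>a = inv_G \<sigma> x\<close> is the desired element.\<close>
    have "inv_G \<sigma> \<notin> DG"
    proof
      assume "inv_G \<sigma> \<in> DG"
      hence "\<sigma> x \<in> Q" if "x \<in> Q" for x
        using DG_iff[of "inv_G \<sigma>" "\<sigma> x"] that \<open>\<sigma> \<in> G - DG\<close> Q_OL[of x] by simp
      thus False using that DG_I[of \<sigma>] by blast
    qed
    moreover have "inv_G \<sigma> \<in> G" using that by simp
    ultimately have "\<exists>x\<in>Q. inv_G \<sigma> x \<notin> Q"
      by (simp add: DG_def del: DG_G)
    then obtain x where "x \<in> Q" "inv_G \<sigma> x \<notin> Q" ..
    thus ?thesis using that Q_OL[of x] by (intro bexI[of _ "inv_G \<sigma> x"]) simp_all
  qed
  then obtain a where a: "\<And>\<sigma>. \<sigma> \<in> G - DG \<Longrightarrow> a \<sigma> \<in> OL - Q \<and> \<sigma> (a \<sigma>) \<in> Q" by metis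
  define s where "s = prod a (G - DG)"
  have "s \<in> OL - Q" using a Q_prod_iff[of "G - DG" a] by (auto simp: s_def)
  moreover have "\<sigma> s \<in> Q" if "\<sigma> \<in> G - DG" for \<sigma>
  proof -
    have "\<sigma> s = (\<Prod>\<tau>\<in>G - DG. \<sigma> (a \<tau>))" unfolding s_def using that a by (intro G_prod) auto
    also have "\<dots> \<in> Q" using that a by (subst Q_prod_iff) auto
    finally show ?thesis .
  qed
  ultimately show ?thesis by blast
qed

lemma local_idealD:
  assumes "local_ideal OL Q Z"
  shows "0 \<in> Z" "x \<in> Z \<Longrightarrow> y \<in> Z \<Longrightarrow> x + y \<in> Z" "x \<in> Z \<Longrightarrow> a \<in> OL \<Longrightarrow> a * x \<in> Z"
    "s \<in> OL - Q \<Longrightarrow> s * z \<in> Z \<Longrightarrow> z \<in> Z"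
  using assms unfolding local_ideal_def by blast+

lemma local_ideal_diff: "local_ideal OL Q Z \<Longrightarrow> x \<in> Z \<Longrightarrow> y \<in> Z \<Longrightarrow> x - y \<in> Z"
  using local_idealD(2)[of Z x "- 1 * y"] local_idealD(3)[of Z y "- 1"] by auto

lemma local_ideal_sum: "local_ideal OL Q Z \<Longrightarrow> (\<And>i. i \<in> I \<Longrightarrow> f i \<in> Z) \<Longrightarrow> sum f I \<in> Z"
  by (induction I rule: infinite_finite_induct) (auto intro: local_idealD)

text \<open>
  Dedekind's elimination: replacing \<open>c\<close> by \<open>c x\<close> and subtracting \<open>\<rho> x\<close> times the original relation
  removes \<open>\<rho>\<close> and multiplies the coefficient of \<open>\<iota>\<close> by a local unit.
\<close>

lemma independent_of_characters:
  fixes v :: "(complex \<Rightarrow> complex) \<Rightarrow> complex"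
  assumes Z: "local_ideal OL Q Z" and R: "1 \<in> R" "\<And>x y. x \<in> R \<Longrightarrow> y \<in> R \<Longrightarrow> x * y \<in> R"
    and T: "finite T" "\<And>\<rho> x. \<rho> \<in> insert \<iota> T \<Longrightarrow> x \<in> R \<Longrightarrow> \<rho> x \<in> OL"
      "\<And>\<rho> x y. \<rho> \<in> insert \<iota> T \<Longrightarrow> x \<in> R \<Longrightarrow> y \<in> R \<Longrightarrow> \<rho> (x * y) = \<rho> x * \<rho> y"
      "\<And>\<rho>. \<rho> \<in> T \<Longrightarrow> \<exists>x\<in>R. \<iota> x - \<rho> x \<notin> Q"
    and \<iota>: "\<iota> 1 = 1" "\<iota> \<notin> T"
    and sum: "\<And>c. c \<in> R \<Longrightarrow> (\<Sum>\<rho>\<in>insert \<iota> T. \<rho> c * v \<rho>) \<in> Z"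
  shows "v \<iota> \<in> Z"
  using T \<iota>(2) sum
proof (induction T arbitrary: v rule: finite_induct)
  case empty
  from empty.prems(5)[of 1] show ?case using R \<iota> by simp
next
  case (insert \<rho> T)
  obtain x where x: "x \<in> R" "\<iota> x - \<rho> x \<notin> Q" using insert.prems(3)[of \<rho>] by auto
  have OL: "\<iota> x \<in> OL" "\<rho> x \<in> OL" using insert.prems(1) x by auto
  have "(\<iota> x - \<rho> x) * v \<iota> \<in> Z"
  proof (rule insert.IH)
    fix c assume c: "c \<in> R"
    have "(\<Sum>\<kappa>\<in>insert \<iota> (insert \<rho> T). \<kappa> (c * x) * v \<kappa>) -
        \<rho> x * (\<Sum>\<kappa>\<in>insert \<iota> (insert \<rho> T). \<kappa> c * v \<kappa>) \<in> Z"
      using c x R insert.prems(5) OL Z by (intro local_ideal_diff) (auto intro: local_idealD)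
    also have "(\<Sum>\<kappa>\<in>insert \<iota> (insert \<rho> T). \<kappa> (c * x) * v \<kappa>) -
        \<rho> x * (\<Sum>\<kappa>\<in>insert \<iota> (insert \<rho> T). \<kappa> c * v \<kappa>) =
        (\<Sum>\<kappa>\<in>insert \<iota> (insert \<rho> T). \<kappa> c * ((\<kappa> x - \<rho> x) * v \<kappa>))"
      unfolding sum_distrib_left sum_subtractf[symmetric]
      by (rule sum.cong) (use insert.prems(2) c x in \<open>auto simp: algebra_simps\<close>)
    also have "insert \<iota> (insert \<rho> T) = insert \<rho> (insert \<iota> T)" by auto
    also have "(\<Sum>\<kappa>\<in>\<dots>. \<kappa> c * ((\<kappa> x - \<rho> x) * v \<kappa>)) =
       (\<Sum>\<kappa>\<in>insert \<iota> T. \<kappa> c * ((\<kappa> x - \<rho> x) * v \<kappa>))"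
      using insert.hyps insert.prems(4) by (subst sum.insert) auto
    finally show "(\<Sum>\<kappa>\<in>insert \<iota> T. \<kappa> c * ((\<kappa> x - \<rho> x) * v \<kappa>)) \<in> Z" .
  qed (use insert.prems in auto)
  thus ?case by (rule local_idealD(4)[OF Z, rotated]) (use OL x in simp)
qed

end

section \<open>Unramified descent\<close>

context prime_of_subfield
begin

text \<open>Nakayama's lemma over the localization at \<open>Q\<close>, by elimination: in the
  relation for \<open>u\<close> the coefficient \<open>s - q u\<close> stays outside
  \<open>Q\<close>, so \<open>u\<close> can be removed from the remaining relations.\<close>

lemma nakayama:
  assumes "finite Y" "\<And>y. y \<in> Y \<Longrightarrow> \<exists>s\<in>OL - Q. \<exists>q. (\<forall>z\<in>Y. q z \<in> Q) \<and> s * y = (\<Sum>z\<in>Y. q z * z)"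
    and "y \<in> Y"
  shows "y = 0"
  using assms
proof (induction Y arbitrary: y rule: finite_induct)
  case (insert u Y)
  obtain s q where sq: "s \<in> OL - Q" "\<And>z. z \<in> insert u Y \<Longrightarrow> q z \<in> Q"
    "s * u = (\<Sum>z\<in>insert u Y. q z * z)"
    using insert.prems(1)[of u] by blast
  define s' where "s' = s - q u"
  have qu: "q u \<in> Q" using sq(2) by simp
  have s': "s' \<in> OL - Q"
    using sq(1) qu Q_OL[OF qu] Q_add[of "s - q u" "q u"] by (auto simp: s'_def)
  have s'u: "s' * u = (\<Sum>z\<in>Y. q z * z)"
    using sq(3) insert.hyps by (simp add: s'_def algebra_simps)
  have Y0: "y = 0" if "y \<in> Y" for y
  proof (rule insert.IH[OF _ that])
    fix y assume "y \<in> Y"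
    then obtain s1 q1 where sq1: "s1 \<in> OL - Q" "\<And>z. z \<in> insert u Y \<Longrightarrow> q1 z \<in> Q"
      "s1 * y = (\<Sum>z\<in>insert u Y. q1 z * z)"
      using insert.prems(1)[of y] by blast
    have "(s' * s1) * y = q1 u * (s' * u) + s' * (\<Sum>z\<in>Y. q1 z * z)"
      using sq1(3) insert.hyps by (simp add: algebra_simps)
    also have "\<dots> = (\<Sum>z\<in>Y. (q1 u * q z + s' * q1 z) * z)"
      unfolding s'u by (simp add: sum_distrib_left sum.distrib algebra_simps)
    finally have "(s' * s1) * y = (\<Sum>z\<in>Y. (q1 u * q z + s' * q1 z) * z)" .
    moreover have "q1 u * q z + s' * q1 z \<in> Q" if "z \<in> Y" for z
    proof -
      have "q1 u \<in> OL" "q z \<in> Q" "q1 z \<in> Q" using that sq(2) sq1(2)[of u] sq1(2)[of z] by auto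
      thus ?thesis using s' by (intro Q_add Q_mult) auto
    qed
    moreover have "s' * s1 \<in> OL - Q" using s' sq1(1) notin_mult[of s' s1] by simp
    ultimately show "\<exists>s\<in>OL - Q. \<exists>q. (\<forall>z\<in>Y. q z \<in> Q) \<and> s * y = (\<Sum>z\<in>Y. q z * z)"
      by (intro bexI[of _ "s' * s1"] exI[of _ "\<lambda>z. q1 u * q z + s' * q1 z"]) auto
  qed
  have "(\<Sum>z\<in>Y. q z * z) = 0" using Y0 by (intro sum.neutral) simp
  moreover have "s' \<noteq> 0" using s' by auto
  ultimately have "u = 0" using s'u by simp
  thus ?case using insert.prems(2) Y0 by auto
qed auto

end

context galois_prime
begin

lemma id_DG [simp]: "(\<lambda>x\<in>L. x) \<in> DG"
  by (rule DG_I) (auto simp: OL_imp_in)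

lemma res_char_in_E: "of_nat res_char \<in> E"
  by (rule complex_subfield.of_nat_in[OF subfield_E])

text \<open>
  The trace of \<open>c s y\<close> over the embeddings of \<open>R\<close> lies in \<open>Q \<inter> E \<subseteq> Z\<close>. Its terms outside the
  decomposition group are locally multiples of the residue characteristic for suitable \<open>s\<close>, hence also in
  \<open>Z\<close>. Independence of characters then isolates the term of the identity.
\<close>

theorem unramified_descent:
  assumes R: "R \<subseteq> OL" "1 \<in> R" "\<And>x y. x \<in> R \<Longrightarrow> y \<in> R \<Longrightarrow> x * y \<in> R"
    and norm: "\<And>x. x \<in> OL \<Longrightarrow> x \<notin> Q \<Longrightarrow> \<exists>x'\<in>OL. x * x' \<in> R \<and> x * x' \<notin> Q"
    and sep: "\<And>\<sigma>. \<sigma> \<in> DG \<Longrightarrow> \<exists>x\<in>R. \<sigma> x \<noteq> x \<Longrightarrow> \<exists>x\<in>R. \<sigma> x - x \<notin> Q"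
    and Z: "local_ideal OL Q Z" "Q \<inter> E \<subseteq> Z"
    and y: "y \<in> R" "y \<in> Q"
  shows "y \<in> Z"
proof -
  have RL: "x \<in> L" "x \<in> OL" if "x \<in> R" for x using that R(1) by (auto simp: OL_imp_in)
  have pZ: "of_nat res_char \<in> Z" using Z(2) res_char_in_Q res_char_in_E by auto
  obtain s0 where s0: "s0 \<in> OL - Q" "\<And>\<sigma>. \<sigma> \<in> G - DG \<Longrightarrow> \<sigma> s0 \<in> Q"
    using exists_concentrated by blast
  have "\<exists>n w t. w \<in> OL - Q \<and> t \<in> OL \<and> w * \<sigma> s0 ^ n = of_nat res_char * t" if "\<sigma> \<in> G - DG" for \<sigma>
    using Q_power_multiple[OF s0(2)[OF that]] by blast
  then obtain n w t where nwt: "\<And>\<sigma>. \<sigma> \<in> G - DG \<Longrightarrow> w \<sigma> \<in> OL - Q \<and> t \<sigma> \<in> OL \<and>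
      w \<sigma> * \<sigma> s0 ^ n \<sigma> = of_nat res_char * t \<sigma>"
    by metis
  \<comment> \<open>A single exponent that is at least every \<open>n \<sigma>\<close>, so that one
    power of \<open>s0\<close> serves all automorphisms outside \<open>DG\<close>.\<close>
  define N where "N = (\<Sum>\<sigma>\<in>G - DG. n \<sigma>)"
  define s1 where "s1 = s0 ^ N"
  have s1: "s1 \<in> OL" "s1 \<notin> Q"
    using s0(1) Q_power_iff[of s0 N] by (auto simp: s1_def intro: gr0I) (metis Q_1 gr0I power_0)
  \<comment> \<open>The multiplier has to lie in \<open>R\<close>, since the characters are those of
    \<open>R\<close>; the hypothesis \<open>norm\<close> moves it there without entering
    \<open>Q\<close>.\<close>
  obtain s1' where s1': "s1' \<in> OL" "s1 * s1' \<in> R" "s1 * s1' \<notin> Q" using norm[OF s1] by blast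
  define s where "s = s1 * s1'"
  have s: "s \<in> R" "s \<notin> Q" "s \<in> OL" using s1' s1 by (auto simp: s_def)
  have off_multiple: "\<exists>u\<in>OL. w \<sigma> * \<sigma> (s * c) = u * of_nat res_char" if "\<sigma> \<in> G - DG" "c \<in> OL" for \<sigma> c
  proof -
    have "n \<sigma> \<le> N" unfolding N_def by (rule member_le_sum) (use that in auto)
    hence N: "\<sigma> s0 ^ N = \<sigma> s0 ^ n \<sigma> * \<sigma> s0 ^ (N - n \<sigma>)" by (simp flip: power_add)
    have "\<sigma> (s * c) = \<sigma> s0 ^ N * (\<sigma> s1' * \<sigma> c)"
      using that s0(1) s1' by (simp add: s_def s1_def)
    hence "w \<sigma> * \<sigma> (s * c) = (w \<sigma> * \<sigma> s0 ^ n \<sigma>) * \<sigma> s0 ^ (N - n \<sigma>) * (\<sigma> s1' * \<sigma> c)"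
      unfolding N by (simp only: mult_ac)
    also have "\<dots> = (t \<sigma> * \<sigma> s0 ^ (N - n \<sigma>) * (\<sigma> s1' * \<sigma> c)) * of_nat res_char"
      using nwt[OF that(1)] by (simp add: mult_ac)
    finally have "w \<sigma> * \<sigma> (s * c) = (t \<sigma> * \<sigma> s0 ^ (N - n \<sigma>) * (\<sigma> s1' * \<sigma> c)) * of_nat res_char" .
    moreover have "t \<sigma> * \<sigma> s0 ^ (N - n \<sigma>) * (\<sigma> s1' * \<sigma> c) \<in> OL"
      using nwt[OF that(1)] that s0(1) s1' by simp
    ultimately show ?thesis by blast
  qed
  have off_Z: "\<sigma> (s * c) \<in> Z" if that': "\<sigma> \<in> G - DG" "c \<in> OL" for \<sigma> c
  proof -
    obtain u where u: "u \<in> OL" "w \<sigma> * \<sigma> (s * c) = u * of_nat res_char"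
      using off_multiple[OF that'] by blast
    have "w \<sigma> * \<sigma> (s * c) \<in> Z" unfolding u(2) by (rule local_idealD(3)[OF Z(1) pZ u(1)])
    moreover have "w \<sigma> \<in> OL - Q" using nwt[OF that'(1)] by blast
    ultimately show ?thesis by (rule local_idealD(4)[OF Z(1), rotated])
  qed
  have off_Q: "\<sigma> (s * c) \<in> Q" if that': "\<sigma> \<in> G - DG" "c \<in> OL" for \<sigma> c
  proof -
    obtain u where u: "u \<in> OL" "w \<sigma> * \<sigma> (s * c) = u * of_nat res_char"
      using off_multiple[OF that'] by blast
    have "w \<sigma> * \<sigma> (s * c) \<in> Q" unfolding u(2) by (rule Q_mult[OF res_char_in_Q u(1)])
    moreover have "\<sigma> (s * c) \<in> OL" by (rule G_OL) (use that' s in auto)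
    moreover have "w \<sigma> \<in> OL" "w \<sigma> \<notin> Q" using nwt[OF that'(1)] by blast+
    ultimately show ?thesis using Q_prime[of "w \<sigma>" "\<sigma> (s * c)"] by blast
  qed
  \<comment> \<open>Automorphisms that agree on \<open>R\<close> give the same character of
    \<open>R\<close>. Passing to restrictions removes these repetitions, as independence requires
    distinct characters.\<close>
  define S where "S = (\<lambda>\<sigma>. restrict \<sigma> R) ` G"
  define SD where "SD = (\<lambda>\<sigma>. restrict \<sigma> R) ` DG"
  define \<iota> where "\<iota> = (\<lambda>x\<in>R. x :: complex)"
  have DG_sub: "DG \<subseteq> G" using DG_G by (rule subsetI)
  have fin: "finite S" "finite SD" using finite_subset[OF DG_sub finite_G] by (auto simp: S_def SD_def)
  have SD_S: "SD \<subseteq> S" using DG_sub by (auto simp: S_def SD_def)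
  have "\<iota> = restrict (\<lambda>x\<in>L. x) R" using RL by (auto simp: \<iota>_def fun_eq_iff)
  hence \<iota>_SD: "\<iota> \<in> SD" unfolding SD_def using id_DG by blast
  have trace: "(\<Sum>\<rho>\<in>S. \<rho> (c * (s * y))) \<in> Z" if c: "c \<in> R" for c
  proof -
    define z where "z = c * (s * y)"
    have zR: "z \<in> R" using c s y R(3) by (simp add: z_def)
    have zQ: "z \<in> Q" unfolding z_def using y s RL[OF c] by (intro Q_mult) auto
    have z_eq: "z = s * (c * y)" by (simp add: z_def)
    have S_z: "\<rho> z \<in> Q" if "\<rho> \<in> S" for \<rho>
    proof -
      obtain \<sigma> where \<sigma>: "\<sigma> \<in> G" "\<rho> = restrict \<sigma> R" using \<open>\<rho> \<in> S\<close> by (auto simp: S_def)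
      show ?thesis
      proof (cases "\<sigma> \<in> DG")
        case True
        thus ?thesis using \<sigma> zR DG_Q[OF True zQ] by simp
      next
        case False
        thus ?thesis using \<sigma> zR off_Q[of \<sigma> "c * y"] RL[OF c] RL[OF y(1)] unfolding z_eq by simp
      qed
    qed
    have "(\<Sum>\<rho>\<in>S. \<rho> z) \<in> E"
    proof (rule fixed_imp_in_E)
      show "(\<Sum>\<rho>\<in>S. \<rho> z) \<in> L" using S_z by (intro sum_in) (auto simp: OL_imp_in)
      fix g assume g: "g \<in> G"
      \<comment> \<open>The action of the Galois group on the characters of \<open>R\<close> by
        composition. It permutes them, so the trace is fixed and lies in \<open>E\<close>.\<close>
      define h where "h = (\<lambda>(g :: complex \<Rightarrow> complex) (\<rho> :: complex \<Rightarrow> complex). restrict (\<lambda>x. g (\<rho> x)) R)"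
      have hS: "h g \<rho> \<in> S" if that': "g \<in> G" "\<rho> \<in> S" for g \<rho>
      proof -
        obtain \<sigma> where \<sigma>: "\<sigma> \<in> G" "\<rho> = restrict \<sigma> R" using that' by (auto simp: S_def)
        hence "h g \<rho> = restrict (compose L g \<sigma>) R"
          using RL by (auto simp: h_def fun_eq_iff compose_eq)
        thus ?thesis using \<sigma>(1) that(1) unfolding S_def by (intro image_eqI[of _ _ "compose L g \<sigma>"]) auto
      qed
      have S_props: "\<rho> \<in> extensional R" "x \<in> R \<Longrightarrow> \<rho> x \<in> L" if "\<rho> \<in> S" for \<rho> x
        using that RL by (auto simp: S_def)
      have "bij_betw (h g) S S"
      proof (rule bij_betwI[where g = "h (inv_G g)"])
        fix \<rho> assume \<rho>: "\<rho> \<in> S"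
        show "h (inv_G g) (h g \<rho>) = \<rho>" "h g (h (inv_G g) \<rho>) = \<rho>"
          using S_props[OF \<rho>] g by (auto intro!: extensionalityI[of _ R] simp: h_def)
      qed (use hS g in auto)
      hence "(\<Sum>\<rho>\<in>S. (h g \<rho>) z) = (\<Sum>\<rho>\<in>S. \<rho> z)" by (rule sum.reindex_bij_betw)
      moreover have "g (\<Sum>\<rho>\<in>S. \<rho> z) = (\<Sum>\<rho>\<in>S. (h g \<rho>) z)"
        using g S_props zR by (subst G_sum) (auto simp: h_def)
      ultimately show "g (\<Sum>\<rho>\<in>S. \<rho> z) = (\<Sum>\<rho>\<in>S. \<rho> z)" by simp
    qed
    moreover have "(\<Sum>\<rho>\<in>S. \<rho> z) \<in> Q" using S_z by (rule Q_sum)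
    ultimately show ?thesis using Z(2) unfolding z_def by blast
  qed
  have SD_trace: "(\<Sum>\<rho>\<in>SD. \<rho> c * \<rho> (s * y)) \<in> Z" if c: "c \<in> R" for c
  proof -
    have "(\<Sum>\<rho>\<in>S. \<rho> (c * (s * y))) = (\<Sum>\<rho>\<in>S - SD. \<rho> (c * (s * y))) + (\<Sum>\<rho>\<in>SD. \<rho> (c * (s * y)))"
      by (rule sum.subset_diff[OF SD_S fin(1)])
    moreover have "(\<Sum>\<rho>\<in>S - SD. \<rho> (c * (s * y))) \<in> Z"
    proof (rule local_ideal_sum[OF Z(1)])
      fix \<rho> assume "\<rho> \<in> S - SD"
      then obtain \<sigma> where \<sigma>: "\<sigma> \<in> G - DG" "\<rho> = restrict \<sigma> R" by (auto simp: S_def SD_def)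
      have "\<sigma> (s * (c * y)) \<in> Z" using off_Z[OF \<sigma>(1)] c y RL by simp
      moreover have "c * (s * y) \<in> R" using c s y R(3) by simp
      ultimately show "\<rho> (c * (s * y)) \<in> Z" using \<sigma>(2) by (simp add: mult_ac)
    qed
    ultimately have "(\<Sum>\<rho>\<in>SD. \<rho> (c * (s * y))) \<in> Z"
      using local_ideal_diff[OF Z(1) trace[OF c]] by fastforce
    also have "(\<Sum>\<rho>\<in>SD. \<rho> (c * (s * y))) = (\<Sum>\<rho>\<in>SD. \<rho> c * \<rho> (s * y))"
      by (rule sum.cong) (use c s y R(3) RL in \<open>auto simp: SD_def\<close>)
    finally show ?thesis .
  qed
  have "\<iota> (s * y) \<in> Z"
  proof (rule independent_of_characters[OF Z(1) R(2,3), where \<iota> = \<iota> and T = "SD - {\<iota>}" and v = "\<lambda>\<rho>. \<rho> (s * y)"])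
    have ins: "insert \<iota> (SD - {\<iota>}) = SD" using \<iota>_SD by auto
    fix \<rho> x y' assume \<rho>: "\<rho> \<in> insert \<iota> (SD - {\<iota>})" and x: "x \<in> R"
    then obtain \<sigma> where \<sigma>: "\<sigma> \<in> DG" "\<rho> = restrict \<sigma> R" unfolding ins by (auto simp: SD_def)
    show "\<rho> x \<in> OL" using \<sigma> x RL by simp
    show "\<rho> (x * y') = \<rho> x * \<rho> y'" if "y' \<in> R" using \<sigma> x that RL R(3) by simp
  next
    fix \<rho> assume \<rho>: "\<rho> \<in> SD - {\<iota>}"
    then obtain \<sigma> where \<sigma>: "\<sigma> \<in> DG" "\<rho> = restrict \<sigma> R" by (auto simp: SD_def)
    have "\<exists>x\<in>R. \<sigma> x \<noteq> x"
    proof (rule ccontr)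
      assume "\<not> (\<exists>x\<in>R. \<sigma> x \<noteq> x)"
      hence "\<rho> = \<iota>" unfolding \<sigma>(2) \<iota>_def by (auto simp: fun_eq_iff)
      thus False using \<rho> by simp
    qed
    from sep[OF \<sigma>(1) this] obtain x where "x \<in> R" "\<sigma> x - x \<notin> Q" by blast
    thus "\<exists>x\<in>R. \<iota> x - \<rho> x \<notin> Q"
      using \<sigma>(2) Q_diff_commute[of x "\<sigma> x"] by (intro bexI[of _ x]) (auto simp: \<iota>_def)
  next
    fix c assume "c \<in> R"
    thus "(\<Sum>\<rho>\<in>insert \<iota> (SD - {\<iota>}). \<rho> c * \<rho> (s * y)) \<in> Z"
      using SD_trace[of c] \<iota>_SD by (simp add: insert_absorb)
  qed (use fin R(2) in \<open>auto simp: \<iota>_def\<close>)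
  hence "s * y \<in> Z" using s y R(3) by (simp add: \<iota>_def)
  thus ?thesis by (rule local_idealD(4)[OF Z(1), rotated]) (use s in simp)
qed

end

section \<open>Frobenius elements over 2\<close>

context prime_of_subfield
begin

definition cg :: "complex \<Rightarrow> complex \<Rightarrow> bool" where
  "cg x y \<longleftrightarrow> x \<in> OL \<and> y \<in> OL \<and> x - y \<in> Q"

lemma cgD: "cg x y \<Longrightarrow> x \<in> OL" "cg x y \<Longrightarrow> y \<in> OL" "cg x y \<Longrightarrow> x - y \<in> Q"
  by (auto simp: cg_def)

lemma cg_refl: "x \<in> OL \<Longrightarrow> cg x x"
  by (simp add: cg_def)

lemma cg_sym: "cg x y \<Longrightarrow> cg y x"
  using Q_diff_commute by (auto simp: cg_def)

lemma cg_trans [trans]: "cg x y \<Longrightarrow> cg y z \<Longrightarrow> cg x z"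
  using Q_diff_trans by (auto simp: cg_def)

lemma cg_mult: "cg x y \<Longrightarrow> cg x' y' \<Longrightarrow> cg (x * x') (y * y')"
  unfolding cg_def using Q_diff_mult by (blast intro: OL_mult)

lemma cg_power: "cg x y \<Longrightarrow> cg (x ^ n) (y ^ n)"
  unfolding cg_def using Q_diff_power by (blast intro: OL_power)

lemma cg_Q: "cg x y \<Longrightarrow> x \<in> Q \<longleftrightarrow> y \<in> Q"
  unfolding cg_def using Q_diff_iff by blast

text \<open>In characteristic 2 the difference of the squares is the square of the
  difference.\<close>

lemma cg_square:
  assumes "cg (x\<^sup>2) (y\<^sup>2)" "x \<in> OL" "y \<in> OL" "res_char = 2"
  shows "cg x y"
proof -
  have 2: "2 \<in> Q" using res_char_in_Q assms(4) by simp
  have "(x - y)\<^sup>2 = (x\<^sup>2 - y\<^sup>2) - (y * (x - y)) * 2" by (simp add: power2_eq_square algebra_simps)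
  also have "\<dots> \<in> Q" by (rule Q_diff[OF cgD(3)[OF assms(1)] Q_mult[OF 2]]) (use assms in simp)
  finally show ?thesis using Q_power_iff[of "x - y" 2] assms by (simp add: cg_def)
qed

lemma exists_inverse_cg: "a \<in> OL - Q \<Longrightarrow> \<exists>b\<in>OL - Q. cg (a * b) 1"
  using Q_maximal[of a] Q_diff_iff[of "a * _" 1] by (auto simp: cg_def intro!: bexI)

end

context finite_galois
begin

text \<open>The orbit polynomial makes \<open>x\<close> algebraic, so a nonzero integer multiple of
  \<open>x\<close> is integral; it is moved as well.\<close>

lemma exists_nonfixed_integer:
  assumes "E = \<rat>" "\<sigma> \<in> G" "x \<in> L" "\<sigma> x \<noteq> x"
  shows "\<exists>y\<in>OL. \<sigma> y \<noteq> y"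
proof -
  have "algebraic x"
    unfolding algebraic_altdef
    using coeff_orbit_poly_E[OF assms(3)] assms(1) orbit_poly_nonzero poly_orbit_poly_self[OF assms(3)] by blast
  then obtain a :: int where a: "a \<noteq> 0" "algebraic_int (of_int a * x)"
    using algebraic_imp_int_multiple_algebraic_int by blast
  have "\<sigma> (of_int a * x) \<noteq> of_int a * x" using assms a by simp
  moreover have "of_int a * x \<in> OL" using a assms by (simp add: OL_iff)
  ultimately show ?thesis by blast
qed

end

locale rational_galois_prime = galois_prime \<rat> L Q for L Q

context rational_galois_prime
begin

lemma OL_Rats: "x \<in> OL \<Longrightarrow> x \<in> \<rat> \<Longrightarrow> x \<in> \<int>"
  using rational_algebraic_int_is_int by (auto simp: OL_iff)

text \<open>Frobenius modulo 2 for integer polynomials: cross terms are even, and \<open>c\<close>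
  is congruent to \<open>c^2\<close> for every integer \<open>c\<close>.\<close>

lemma poly_square_diff:
  assumes "y \<in> OL"
  shows "\<exists>t\<in>OL. poly (map_poly of_int g) (y\<^sup>2) - (poly (map_poly of_int g) y)\<^sup>2 = 2 * t"
proof (induction g)
  case (pCons c g)
  then obtain t where t: "t \<in> OL" "poly (map_poly of_int g) (y\<^sup>2) - (poly (map_poly of_int g) y)\<^sup>2 = 2 * t"
    by blast
  have "even (c - c\<^sup>2)" by simp
  then obtain k where k: "c - c\<^sup>2 = 2 * k" by blast
  have k': "of_int c - (of_int c)\<^sup>2 = 2 * (of_int k :: complex)"
    using arg_cong[OF k, of of_int] by simp
  let ?g = "poly (map_poly of_int g) y"
  have "poly (map_poly of_int (pCons c g)) (y\<^sup>2) - (poly (map_poly of_int (pCons c g)) y)\<^sup>2 =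
      (of_int c - (of_int c)\<^sup>2) + y\<^sup>2 * (poly (map_poly of_int g) (y\<^sup>2) - ?g\<^sup>2) - 2 * (of_int c * y * ?g)"
    by (simp add: of_int_hom.map_poly_pCons_hom power2_eq_square algebra_simps)
  also have "\<dots> = 2 * (of_int k + y\<^sup>2 * t - of_int c * y * ?g)"
    unfolding k' t(2) by (simp add: algebra_simps)
  finally show ?case
    using t(1) assms OL_poly[of y g] by (intro bexI[of _ "of_int k + y\<^sup>2 * t - of_int c * y * ?g"]) simp_all
qed auto

text \<open>
  The orbit polynomial \<open>f\<close> of \<open>y\<close> is integral, so \<open>f(y\<^sup>2) \<equiv> f(y)\<^sup>2 = 0\<close> modulo 2, and \<open>f(y\<^sup>2)\<close> is the
  product of the \<open>y\<^sup>2 - \<sigma> y\<close>.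
\<close>

lemma exists_frobenius:
  assumes y: "y \<in> OL" and p: "res_char = 2"
  shows "\<exists>\<sigma>\<in>G. cg (y\<^sup>2) (\<sigma> y)"
proof -
  define g where "g = map_poly (\<lambda>z. \<lfloor>Re z\<rfloor>) (orbit_poly y)"
  have "coeff (orbit_poly y) i \<in> \<int>" for i
    using coeff_orbit_poly[OF y, of i] OL_Rats by blast
  hence "of_int \<lfloor>Re (coeff (orbit_poly y) i)\<rfloor> = coeff (orbit_poly y) i" for i
    by (rule Ints_cases[of "coeff (orbit_poly y) i"]) simp
  hence g: "map_poly of_int g = orbit_poly y"
    by (intro poly_eqI) (simp add: g_def coeff_map_poly)
  obtain t where t: "t \<in> OL" "poly (orbit_poly y) (y\<^sup>2) - (poly (orbit_poly y) y)\<^sup>2 = 2 * t"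
    using poly_square_diff[OF y, of g] unfolding g by blast
  have "poly (orbit_poly y) (y\<^sup>2) = t * 2" using t(2) y by (simp add: poly_orbit_poly_self)
  also have "\<dots> \<in> Q" using res_char_in_Q t(1) p by (intro Q_mult) simp_all
  finally have "(\<Prod>\<sigma>\<in>G. y\<^sup>2 - \<sigma> y) \<in> Q" by (simp add: poly_orbit_poly)
  then obtain \<sigma> where "\<sigma> \<in> G" "y\<^sup>2 - \<sigma> y \<in> Q"
    using y by (subst (asm) Q_prod_iff) auto
  thus ?thesis using y by (auto simp: cg_def)
qed

lemma DG_cg: "\<phi> \<in> DG \<Longrightarrow> cg x y \<Longrightarrow> cg (\<phi> x) (\<phi> y)"
  using DG_Q[of \<phi> "x - y"] by (simp add: cg_def)

text \<open>For \<open>y\<close> outside \<open>Q\<close>, a \<open>\<sigma>\<close> with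
  \<open>\<sigma> y\<close> congruent to \<open>y^2\<close> cannot send \<open>y\<close> into
  \<open>Q\<close>, which rules out everything outside \<open>DG\<close>. The automorphism depends
  on \<open>y\<close>; a Frobenius element uniform in \<open>y\<close> is not constructed.\<close>

lemma exists_frobenius_DG:
  assumes y: "y \<in> OL" "\<And>\<sigma>. \<sigma> \<in> G - DG \<Longrightarrow> \<sigma> y \<in> Q" and p: "res_char = 2"
  shows "\<exists>\<sigma>\<in>DG. cg (y\<^sup>2) (\<sigma> y)"
proof (cases "y \<in> Q")
  case True
  hence "cg (y\<^sup>2) ((\<lambda>x\<in>L. x) y)" using y(1) Q_diff[of "y\<^sup>2" y] Q_power_iff[of y 2] by (simp add: cg_def)
  thus ?thesis using id_DG by blast
next
  case False
  obtain \<sigma> where \<sigma>: "\<sigma> \<in> G" "cg (y\<^sup>2) (\<sigma> y)" using exists_frobenius[OF y(1) p] by blast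
  have "\<sigma> y \<notin> Q" using cg_Q[OF \<sigma>(2)] False Q_power_iff[of y 2] y(1) by simp
  thus ?thesis using \<sigma> y(2) by blast
qed

text \<open>Iterating Frobenius gives \<open>u^(2^n)\<close> congruent to
  \<open>\<sigma>^n u\<close>, and the orbit of \<open>u\<close> is finite, so \<open>u\<close> is
  congruent to one of its own iterated squares. The root is a power of \<open>u\<close> and
  therefore stays in every subfield that contains \<open>u\<close>.\<close>

lemma exists_square_root_mod:
  assumes u: "u \<in> OL" "\<And>\<sigma>. \<sigma> \<in> G - DG \<Longrightarrow> \<sigma> u \<in> Q" and p: "res_char = 2"
  shows "\<exists>n. cg ((u ^ n)\<^sup>2) u"
proof -
  obtain \<sigma> where \<sigma>: "\<sigma> \<in> DG" "cg (u\<^sup>2) (\<sigma> u)" using exists_frobenius_DG[of u] u p by blast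
  have inj: "x = y" if "(\<sigma> ^^ n) x = (\<sigma> ^^ n) y" "x \<in> L" "y \<in> L" for n x y
    using that
  proof (induction n arbitrary: x y)
    case (Suc n)
    have "\<sigma> x = \<sigma> y" by (rule Suc.IH) (use Suc.prems \<sigma>(1) in \<open>simp_all add: funpow_swap1\<close>)
    thus ?case using \<sigma>(1) Suc.prems by simp
  qed auto
  have orbit: "\<exists>g\<in>G. (\<sigma> ^^ n) u = g u" for n
  proof (induction n)
    case 0
    show ?case using u by (intro bexI[of _ "\<lambda>x\<in>L. x"]) simp_all
  next
    case (Suc n)
    then obtain g where "g \<in> G" "(\<sigma> ^^ n) u = g u" by blast
    thus ?case using \<sigma>(1) u by (intro bexI[of _ "compose L \<sigma> g"]) (simp_all add: compose_eq)
  qed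
  have iter: "cg (u ^ (2 ^ n)) ((\<sigma> ^^ n) u)" for n
  proof (induction n)
    case (Suc n)
    have "cg ((u\<^sup>2) ^ (2 ^ n)) (\<sigma> u ^ (2 ^ n))" by (rule cg_power[OF \<sigma>(2)])
    also have "\<sigma> u ^ (2 ^ n) = \<sigma> (u ^ (2 ^ n))" using \<sigma>(1) u by simp
    also have "cg \<dots> (\<sigma> ((\<sigma> ^^ n) u))" by (rule DG_cg[OF \<sigma>(1) Suc.IH])
    finally show ?case by (simp flip: power_mult)
  qed (use u in \<open>simp add: cg_refl\<close>)
  have "finite ((\<lambda>g. g u) ` G)" by simp
  moreover have "range (\<lambda>n. (\<sigma> ^^ n) u) \<subseteq> (\<lambda>g. g u) ` G" using orbit by auto
  ultimately have "finite (range (\<lambda>n. (\<sigma> ^^ n) u))" by (rule rev_finite_subset)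
  hence "\<not> inj (\<lambda>n. (\<sigma> ^^ n) u)" using finite_imageD by auto
  then obtain i j where "i \<noteq> j" "(\<sigma> ^^ i) u = (\<sigma> ^^ j) u" by (auto simp: inj_def)
  then obtain i j where ij: "i < j" "(\<sigma> ^^ i) u = (\<sigma> ^^ j) u" by (metis nat_neq_iff)
  obtain k where k: "j = i + Suc k" using less_imp_Suc_add[OF ij(1)] by auto
  obtain g where g: "g \<in> G" "(\<sigma> ^^ Suc k) u = g u" using orbit by blast
  \<comment> \<open>Injectivity of \<open>\<sigma>\<close> turns the repetition into a return to the
    starting point \<open>u\<close>.\<close>
  have "u = (\<sigma> ^^ Suc k) u"
  proof (rule inj[of i])
    show "(\<sigma> ^^ i) u = (\<sigma> ^^ i) ((\<sigma> ^^ Suc k) u)"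
      using ij(2) unfolding k funpow_add by simp
  qed (use u g in simp_all)
  hence "cg (u ^ (2 ^ Suc k)) u" using iter[of "Suc k"] by simp
  hence "cg ((u ^ (2 ^ k))\<^sup>2) u" by (simp add: mult.commute flip: power_mult)
  thus ?thesis by blast
qed

end

section \<open>Inertia groups of order two\<close>

locale inertia_of_order_two = rational_galois_prime +
  fixes \<tau> :: "complex \<Rightarrow> complex"
  assumes \<tau>_G [simp]: "\<tau> \<in> G"
    and \<tau>_nontrivial: "\<exists>x\<in>L. \<tau> x \<noteq> x"
    and \<tau>_inertia: "x \<in> OL \<Longrightarrow> \<tau> x - x \<in> Q"
    and inertia_cases: "\<sigma> \<in> G \<Longrightarrow> (\<And>x. x \<in> OL \<Longrightarrow> \<sigma> x - x \<in> Q) \<Longrightarrow>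
      (\<forall>x\<in>L. \<sigma> x = x) \<or> (\<forall>x\<in>L. \<sigma> x = \<tau> x)"
begin

lemma \<tau>_cg: "x \<in> OL \<Longrightarrow> cg (\<tau> x) x"
  using \<tau>_inertia by (simp add: cg_def)

lemma \<tau>_DG [simp]: "\<tau> \<in> DG"
proof (rule DG_I)
  fix x assume "x \<in> Q"
  thus "\<tau> x \<in> Q" using cg_Q[OF \<tau>_cg[of x]] Q_OL by blast
qed simp

lemma \<tau>_\<tau> [simp]: "x \<in> L \<Longrightarrow> \<tau> (\<tau> x) = x"
proof -
  assume x: "x \<in> L"
  have "compose L \<tau> \<tau> y - y \<in> Q" if "y \<in> OL" for y
    using cg_trans[OF \<tau>_cg \<tau>_cg, of y] that by (simp add: cg_def compose_eq)
  then consider "\<forall>x\<in>L. compose L \<tau> \<tau> x = x" | "\<forall>x\<in>L. compose L \<tau> \<tau> x = \<tau> x"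
    using inertia_cases[of "compose L \<tau> \<tau>"] by auto
  thus ?thesis
  proof cases
    case 2
    hence "\<tau> (\<tau> y) = \<tau> y" if "y \<in> L" for y using that by (simp add: compose_eq)
    hence "\<tau> y = y" if "y \<in> L" for y using that by simp
    thus ?thesis using \<tau>_nontrivial by blast
  qed (use x in \<open>simp add: compose_eq\<close>)
qed

text \<open>The inertia group is normalized by the decomposition group. The conjugate of
  \<open>\<tau>\<close> by \<open>\<phi>\<close> is a nontrivial element of a group with two
  elements, hence \<open>\<tau>\<close> itself.\<close>

lemma DG_commute:
  assumes \<phi>: "\<phi> \<in> DG" and x: "x \<in> L"
  shows "\<phi> (\<tau> x) = \<tau> (\<phi> x)"
proof -
  define \<psi> where "\<psi> = compose L \<phi> (compose L \<tau> (inv_G \<phi>))"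
  have \<psi>: "\<psi> y = \<phi> (\<tau> (inv_G \<phi> y))" if "y \<in> L" for y
    using that \<phi> by (simp add: \<psi>_def compose_eq)
  have "\<psi> y - y \<in> Q" if y: "y \<in> OL" for y
  proof -
    have "\<phi> (\<tau> (inv_G \<phi> y) - inv_G \<phi> y) \<in> Q"
      by (rule DG_Q[OF \<phi> \<tau>_inertia]) (use \<phi> y in simp)
    thus ?thesis using \<psi>[of y] \<phi> y by simp
  qed
  moreover have "\<psi> \<in> G" using \<phi> by (simp add: \<psi>_def)
  ultimately consider "\<forall>x\<in>L. \<psi> x = x" | "\<forall>x\<in>L. \<psi> x = \<tau> x"
    using inertia_cases by blast
  thus ?thesis
  proof cases
    case 1
    have "\<tau> y = y" if y: "y \<in> L" for y
    proof -
      have "\<phi> (\<tau> y) = \<phi> y" using 1 \<psi>[of "\<phi> y"] \<phi> y by simp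
      thus ?thesis using \<phi> y by simp
    qed
    thus ?thesis using \<tau>_nontrivial by blast
  next
    case 2
    thus ?thesis using \<psi>[of "\<phi> x"] \<phi> x by simp
  qed
qed

section \<open>Local arithmetic in the fixed field of an inertia group\<close>

definition fixed_integers :: "complex set" where
  "fixed_integers = {x \<in> OL. \<tau> x = x}"

lemma fixed_integers_iff: "x \<in> fixed_integers \<longleftrightarrow> x \<in> OL \<and> \<tau> x = x"
  by (simp add: fixed_integers_def)

lemma fixed_integers_closed:
  "x \<in> fixed_integers \<Longrightarrow> y \<in> fixed_integers \<Longrightarrow> x * y \<in> fixed_integers"
  "x \<in> fixed_integers \<Longrightarrow> y \<in> fixed_integers \<Longrightarrow> x + y \<in> fixed_integers"
  "x \<in> fixed_integers \<Longrightarrow> y \<in> fixed_integers \<Longrightarrow> x - y \<in> fixed_integers"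
  "x \<in> fixed_integers \<Longrightarrow> x ^ n \<in> fixed_integers"
  "x \<in> OL \<Longrightarrow> x * \<tau> x \<in> fixed_integers"
  by (simp_all add: fixed_integers_iff mult.commute)

lemma norm_notin_Q: "x \<in> OL \<Longrightarrow> x \<notin> Q \<Longrightarrow> x * \<tau> x \<notin> Q"
  using notin_mult[of x "\<tau> x"] DG_iff[of \<tau> x] by simp

lemma two_in_Q_iff: "2 \<in> Q \<longleftrightarrow> res_char = 2"
  using of_nat_in_Q_iff[of 2] prime_res_char by (auto simp: primes_dvd_imp_eq)

text \<open>An automorphism that moves a fixed integer is neither 1 nor \<open>\<tau>\<close>, so it
  moves some \<open>x\<close> modulo \<open>Q\<close>. To return to the fixed field, use the norm
  \<open>x * \<tau> x\<close>, congruent to \<open>x^2\<close>, in characteristic 2, where squaring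
  is injective; otherwise use the trace \<open>x + \<tau> x\<close>, congruent to
  \<open>2 * x\<close>.\<close>

lemma separates_fixed_integers:
  assumes \<sigma>: "\<sigma> \<in> DG" and nontrivial: "\<exists>x\<in>fixed_integers. \<sigma> x \<noteq> x"
  shows "\<exists>x\<in>fixed_integers. \<sigma> x - x \<notin> Q"
proof -
  have "\<exists>x\<in>OL. \<sigma> x - x \<notin> Q"
  proof (rule ccontr)
    assume "\<not> (\<exists>x\<in>OL. \<sigma> x - x \<notin> Q)"
    hence "(\<forall>x\<in>L. \<sigma> x = x) \<or> (\<forall>x\<in>L. \<sigma> x = \<tau> x)"
      using inertia_cases[of \<sigma>] \<sigma> by simp
    thus False using nontrivial by (auto simp: fixed_integers_iff)
  qed
  then obtain x where x: "x \<in> OL" "\<sigma> x - x \<notin> Q" by blast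
  have \<sigma>\<tau>: "cg (\<sigma> (\<tau> x)) (\<sigma> x)" by (rule DG_cg[OF \<sigma> \<tau>_cg[OF x(1)]])
  show ?thesis
  proof (cases "res_char = 2")
    case True
    have "\<sigma> (x * \<tau> x) - x * \<tau> x \<notin> Q"
    proof
      assume "\<sigma> (x * \<tau> x) - x * \<tau> x \<in> Q"
      hence "cg (\<sigma> x * \<sigma> (\<tau> x)) (x * \<tau> x)" using x \<sigma> by (simp add: cg_def)
      moreover have "cg (\<sigma> x * \<sigma> x) (\<sigma> x * \<sigma> (\<tau> x))"
        by (rule cg_mult[OF cg_refl cg_sym[OF \<sigma>\<tau>]]) (use x \<sigma> in simp)
      moreover have "cg (x * \<tau> x) (x * x)"
        by (rule cg_mult[OF cg_refl \<tau>_cg]) (use x in simp_all)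
      ultimately have "cg (\<sigma> x * \<sigma> x) (x * x)" using cg_trans by blast
      hence "cg ((\<sigma> x)\<^sup>2) (x\<^sup>2)" by (simp only: power2_eq_square)
      hence "cg (\<sigma> x) x" by (rule cg_square) (use x \<sigma> True in simp_all)
      thus False using x by (simp add: cg_def)
    qed
    thus ?thesis using fixed_integers_closed(5)[OF x(1)] by blast
  next
    case False
    have "\<sigma> (x + \<tau> x) - (x + \<tau> x) \<notin> Q"
    proof
      assume "\<sigma> (x + \<tau> x) - (x + \<tau> x) \<in> Q"
      hence "\<sigma> x + \<sigma> (\<tau> x) - (x + \<tau> x) \<in> Q" using x \<sigma> by simp
      from Q_add[OF Q_diff[OF this cgD(3)[OF \<sigma>\<tau>]] \<tau>_inertia[OF x(1)]]
      have "2 * (\<sigma> x - x) \<in> Q" by (simp add: algebra_simps)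
      thus False using Q_prime[of 2 "\<sigma> x - x"] x \<sigma> False two_in_Q_iff by simp
    qed
    moreover have "x + \<tau> x \<in> fixed_integers" using x by (simp add: fixed_integers_iff add.commute)
    ultimately show ?thesis by blast
  qed
qed

text \<open>The ideal generated by the residue characteristic in the localization at
  \<open>Q\<close>.\<close>

definition residue_multiples :: "complex set" where
  "residue_multiples = {x. \<exists>s\<in>OL - Q. \<exists>t\<in>OL. s * x = of_nat res_char * t}"

lemma residue_multiples_iff:
  "x \<in> residue_multiples \<longleftrightarrow> (\<exists>s\<in>OL - Q. \<exists>t\<in>OL. s * x = of_nat res_char * t)"
  by (simp add: residue_multiples_def)

lemma local_ideal_residue_multiples: "local_ideal OL Q residue_multiples"
  unfolding local_ideal_def
proof (intro conjI ballI allI impI)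
  show "0 \<in> residue_multiples"
    unfolding residue_multiples_iff by (intro bexI[of _ 1] bexI[of _ 0]) auto
next
  fix x y assume "x \<in> residue_multiples" "y \<in> residue_multiples"
  then obtain s t s' t' where *: "s \<in> OL - Q" "t \<in> OL" "s * x = of_nat res_char * t"
    "s' \<in> OL - Q" "t' \<in> OL" "s' * y = of_nat res_char * t'"
    unfolding residue_multiples_iff by blast
  have "(s * s') * (x + y) = s' * (s * x) + s * (s' * y)" by (simp add: algebra_simps)
  also have "\<dots> = of_nat res_char * (s' * t + s * t')" unfolding * by (simp add: algebra_simps)
  finally have "(s * s') * (x + y) = of_nat res_char * (s' * t + s * t')" .
  moreover have "s * s' \<in> OL - Q" using * notin_mult[of s s'] by simp
  moreover have "s' * t + s * t' \<in> OL" using * by simp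
  ultimately show "x + y \<in> residue_multiples" unfolding residue_multiples_iff by blast
next
  fix x a assume "x \<in> residue_multiples" and a: "a \<in> OL"
  then obtain s t where *: "s \<in> OL - Q" "t \<in> OL" "s * x = of_nat res_char * t"
    unfolding residue_multiples_iff by blast
  have "s * (a * x) = a * (s * x)" by (simp add: algebra_simps)
  hence "s * (a * x) = of_nat res_char * (a * t)" unfolding * by (simp add: algebra_simps)
  moreover have "a * t \<in> OL" using * a by simp
  ultimately show "a * x \<in> residue_multiples" unfolding residue_multiples_iff using *(1) by blast
next
  fix x s assume s: "s \<in> OL - Q" "s * x \<in> residue_multiples"
  then obtain s' t where *: "s' \<in> OL - Q" "t \<in> OL" "s' * (s * x) = of_nat res_char * t"
    unfolding residue_multiples_iff by blast
  have "s' * s \<in> OL - Q" using * s notin_mult[of s' s] by simp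
  moreover have "(s' * s) * x = of_nat res_char * t" using * by (simp add: mult.assoc)
  ultimately show "x \<in> residue_multiples" unfolding residue_multiples_iff using *(2) by blast
qed

text \<open>The fixed field has trivial inertia at \<open>Q\<close> by
  \<open>separates_fixed_integers\<close>, so descent applies with the ideal generated by the
  residue characteristic. The result says that this prime number is a uniformizer of the fixed
  field.\<close>

theorem fixed_integers_unramified:
  assumes y: "y \<in> fixed_integers" "y \<in> Q"
  shows "\<exists>s\<in>fixed_integers - Q. \<exists>t\<in>fixed_integers. s * y = of_nat res_char * t"
proof -
  have "y \<in> residue_multiples"
  proof (rule unramified_descent[OF _ _ _ _ _ local_ideal_residue_multiples _ y])
    show "fixed_integers \<subseteq> OL" "1 \<in> fixed_integers"
      by (auto simp: fixed_integers_iff)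
    show "\<exists>x'\<in>OL. x * x' \<in> fixed_integers \<and> x * x' \<notin> Q" if "x \<in> OL" "x \<notin> Q" for x
      using that fixed_integers_closed(5)[of x] norm_notin_Q[of x] by (intro bexI[of _ "\<tau> x"]) simp_all
    show "Q \<inter> \<rat> \<subseteq> residue_multiples"
    proof
      fix x assume x: "x \<in> Q \<inter> \<rat>"
      then obtain n where n: "x = of_int n" using OL_Rats[of x] Q_OL[of x] by (auto elim: Ints_cases)
      then obtain k where "n = int res_char * k" using x of_int_in_Q_iff[of n] by auto
      thus "x \<in> residue_multiples" unfolding residue_multiples_iff n
        by (intro bexI[of _ 1] bexI[of _ "of_int k"]) simp_all
    qed
    show "x * y \<in> fixed_integers" if "x \<in> fixed_integers" "y \<in> fixed_integers" for x y
      using that by (rule fixed_integers_closed)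
    show "\<exists>x\<in>fixed_integers. \<sigma> x - x \<notin> Q"
      if "\<sigma> \<in> DG" "\<exists>x\<in>fixed_integers. \<sigma> x \<noteq> x" for \<sigma>
      using that by (rule separates_fixed_integers)
  qed
  then obtain s t where st: "s \<in> OL - Q" "t \<in> OL" "s * y = of_nat res_char * t"
    unfolding residue_multiples_iff by blast
  \<comment> \<open>Multiplying by \<open>\<tau> s\<close> replaces the denominator by a norm and
    thereby moves numerator and denominator into the fixed field.\<close>
  have "(s * \<tau> s) * y = \<tau> s * (s * y)" by (simp add: mult_ac)
  hence eq: "(s * \<tau> s) * y = of_nat res_char * (\<tau> s * t)"
    unfolding st by (simp add: mult_ac)
  have "\<tau> s * t = (s * \<tau> s) * y / of_nat res_char"
    unfolding eq using prime_res_char by (auto dest: prime_gt_0_nat)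
  hence "\<tau> (\<tau> s * t) = \<tau> s * t"
    using st y fixed_integers_closed(5)[of s] by (simp add: fixed_integers_iff)
  hence "\<tau> s * t \<in> fixed_integers" using st by (simp add: fixed_integers_iff)
  moreover have "s * \<tau> s \<in> fixed_integers - Q"
    using st fixed_integers_closed(5)[of s] norm_notin_Q[of s] by simp
  ultimately show ?thesis using eq by blast
qed

text \<open>Every nonzero element is a local unit times a power of the uniformizer; the factors are
  split off one at a time.\<close>

lemma fixed_integers_factor:
  assumes "y \<in> fixed_integers" "y \<noteq> 0"
  shows "\<exists>n. \<exists>s\<in>fixed_integers - Q. \<exists>t\<in>fixed_integers - Q. s * y = of_nat res_char ^ n * t"
proof -
  have p0: "(of_nat res_char :: complex) \<noteq> 0" using prime_res_char by (auto dest: prime_gt_0_nat)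
  \<comment> \<open>The relation \<open>y * y' = p^k * u\<close> with a local unit \<open>u\<close>
    bounds the number of splittings; it starts from a nonzero integer multiple of
    \<open>y\<close>.\<close>
  have *: "\<exists>n. \<exists>s\<in>fixed_integers - Q. \<exists>t\<in>fixed_integers - Q. s * y = of_nat res_char ^ n * t"
    if "y \<in> fixed_integers" "y' \<in> OL" "u \<in> OL - Q" "y * y' = of_nat res_char ^ k * u" for k y y' u
    using that
  proof (induction k arbitrary: y u)
    case 0
    hence "y \<notin> Q" using Q_mult'[of y y'] by auto
    thus ?case using 0
      by (intro exI[of _ 0] bexI[of _ 1] bexI[of _ y]) (simp_all add: fixed_integers_iff)
  next
    case (Suc k)
    show ?case
    proof (cases "y \<in> Q")
      case False
      thus ?thesis using Suc.prems
        by (intro exI[of _ 0] bexI[of _ 1] bexI[of _ y]) (simp_all add: fixed_integers_iff)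
    next
      case True
      obtain s t where st: "s \<in> fixed_integers - Q" "t \<in> fixed_integers" "s * y = of_nat res_char * t"
        using fixed_integers_unramified[OF Suc.prems(1) True] by blast
      have "of_nat res_char * (t * y') = s * (y * y')" using st(3) by (simp add: mult_ac)
      also have "\<dots> = of_nat res_char * (of_nat res_char ^ k * (s * u))"
        unfolding Suc.prems(4) by (simp add: mult_ac)
      finally have "t * y' = of_nat res_char ^ k * (s * u)" using p0 by simp
      moreover have "s * u \<in> OL - Q"
        using st Suc.prems(3) notin_mult[of s u] by (simp add: fixed_integers_iff)
      ultimately obtain n s' t' where *: "s' \<in> fixed_integers - Q" "t' \<in> fixed_integers - Q"
        "s' * t = of_nat res_char ^ n * t'"
        using Suc.IH[OF st(2) Suc.prems(2)] by blast
      have "(s' * s) * y = s' * (s * y)" by (simp only: mult.assoc)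
      also have "\<dots> = of_nat res_char * (s' * t)" unfolding st(3) by (simp add: mult_ac)
      also have "\<dots> = of_nat res_char ^ Suc n * t'" unfolding *(3) by (simp add: mult_ac)
      finally have "(s' * s) * y = of_nat res_char ^ Suc n * t'" .
      moreover have "s' * s \<in> fixed_integers - Q"
        using * st fixed_integers_closed(1)[of s' s] notin_mult[of s' s] by (simp add: fixed_integers_iff)
      ultimately show ?thesis using *(2) by blast
    qed
  qed
  have yOL: "y \<in> OL" using assms by (simp add: fixed_integers_iff)
  then obtain c h where c: "c \<noteq> 0" "of_int c = y * poly (map_poly of_int h) y"
    using exists_nonzero_int_multiple[of y] assms by (auto simp: OL_iff)
  define k where "k = multiplicity (int res_char) c"
  have "\<not> is_unit (int res_char)" using prime_res_char by (auto dest: prime_gt_1_nat)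
  from multiplicity_decompose'[OF c(1) this]
  obtain m where m: "c = int res_char ^ k * m" "\<not> int res_char dvd m"
    unfolding k_def by (metis mult.commute)
  have "y * poly (map_poly of_int h) y = of_nat res_char ^ k * of_int m"
    using arg_cong[OF m(1), of "of_int :: int \<Rightarrow> complex"] c(2) by simp
  moreover have "of_int m \<in> OL - Q" using m(2) of_int_in_Q_iff by simp
  ultimately show ?thesis using *[OF assms(1) OL_poly[OF yOL]] by blast
qed

text \<open>An anti-invariant \<open>\<beta>\<close> has its square in the fixed field, where it is
  a local unit times a power of the uniformizer; only the parity \<open>j\<close> of the exponent
  survives rescaling.\<close>

lemma exists_kummer_generator:
  "\<exists>w\<in>L. \<exists>j\<le>1. \<tau> w = - w \<and> of_nat res_char ^ j * w\<^sup>2 \<in> fixed_integers - Q"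
proof -
  have p0: "(of_nat res_char :: complex) \<noteq> 0" using prime_res_char by (auto dest: prime_gt_0_nat)
  obtain x where x: "x \<in> OL" "\<tau> x \<noteq> x"
    using exists_nonfixed_integer[OF refl \<tau>_G] \<tau>_nontrivial by blast
  define \<beta> where "\<beta> = x - \<tau> x"
  have \<beta>: "\<beta> \<in> OL" "\<tau> \<beta> = - \<beta>" "\<beta> \<noteq> 0" using x by (simp_all add: \<beta>_def)
  have "\<beta>\<^sup>2 \<in> fixed_integers" using \<beta> by (simp add: fixed_integers_iff)
  then obtain n s t where st: "s \<in> fixed_integers - Q" "t \<in> fixed_integers - Q"
    "s * \<beta>\<^sup>2 = of_nat res_char ^ n * t"
    using fixed_integers_factor[of "\<beta>\<^sup>2"] \<beta>(3) by auto
  define j l where "j = n mod 2" and "l = n div 2"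
  have n: "n = 2 * l + j" by (simp add: j_def l_def)
  \<comment> \<open>The exponent \<open>l + j\<close> is half of \<open>n\<close>, rounded up. This
    leaves \<open>w^2 = s * t / p^j\<close>, and the factor \<open>s\<close> turns the quotient
    \<open>t / s\<close> into the product \<open>s * t\<close>.\<close>
  define w where "w = s * \<beta> / of_nat res_char ^ (l + j)"
  have w: "w \<in> L" "\<tau> w = - w" using st \<beta> by (simp_all add: w_def fixed_integers_iff)
  have "2 * (l + j) = j + n" by (simp add: n)
  hence pow: "(of_nat res_char ^ (l + j))\<^sup>2 = of_nat res_char ^ j * (of_nat res_char ^ n :: complex)"
    by (metis mult.commute power_add power_mult)
  have "w\<^sup>2 = s * (s * \<beta>\<^sup>2) / (of_nat res_char ^ (l + j))\<^sup>2"
    by (simp add: w_def power2_eq_square)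
  hence "of_nat res_char ^ j * w\<^sup>2 = s * t"
    unfolding st(3) pow using p0 by simp
  also have "\<dots> \<in> fixed_integers - Q"
    using st fixed_integers_closed(1)[of s t] notin_mult[of s t] by (simp add: fixed_integers_iff)
  finally show ?thesis using w by (intro bexI[of _ w] exI[of _ j]) (auto simp: j_def)
qed

lemma DG_fixed_integers: "\<phi> \<in> DG \<Longrightarrow> x \<in> fixed_integers \<Longrightarrow> \<phi> x \<in> fixed_integers"
  using DG_commute[of \<phi> x] by (simp add: fixed_integers_iff)

text \<open>Write a unit \<open>u\<close> in the square class as \<open>r^2 * (1 + 2 * x)\<close>
  locally. Invariance of the class under the decomposition group forces the residue of
  \<open>x\<close> to be 0 or 1; then \<open>1 + 2 * x\<close>, respectively its negative, is
  congruent to 1 modulo 4, since 2 is a uniformizer of the fixed field. The factor \<open>b\<close>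
  of the conclusion is a local denominator.\<close>

lemma exists_kummer_generator_two:
  assumes p: "res_char = 2"
  shows "\<exists>w\<in>L. \<exists>j\<le>1. \<exists>\<epsilon>\<in>{1, -1 :: int}. \<tau> w = - w \<and>
    (\<exists>b\<in>OL - Q. \<exists>c\<in>OL. b * (of_int \<epsilon> * 2 ^ j * w\<^sup>2 - 1) = 4 * c)"
proof -
  have 2: "2 \<in> Q" using p two_in_Q_iff by simp
  have unr: "\<exists>s\<in>fixed_integers - Q. \<exists>t\<in>fixed_integers. s * y = 2 * t"
    if "y \<in> fixed_integers" "y \<in> Q" for y
    using fixed_integers_unramified[OF that] p by simp
  obtain w0 j where w0: "w0 \<in> L" "\<tau> w0 = - w0" "j \<le> 1" "2 ^ j * w0\<^sup>2 \<in> fixed_integers - Q"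
    using exists_kummer_generator p by auto
  obtain s0 where s0: "s0 \<in> OL - Q" "\<And>\<sigma>. \<sigma> \<in> G - DG \<Longrightarrow> \<sigma> s0 \<in> Q"
    using exists_concentrated by blast
  \<comment> \<open>The norm \<open>s0 * \<tau> s0\<close> is fixed by \<open>\<tau>\<close> and
    outside \<open>Q\<close>. So \<open>W\<close> stays anti-invariant, \<open>u\<close> changes by
    a square of the fixed field, and the conjugates of \<open>u\<close> outside \<open>DG\<close>
    fall into \<open>Q\<close>, as the search for a square root modulo \<open>Q\<close>
    demands.\<close>
  define W where "W = w0 * (s0 * \<tau> s0)"
  define u where "u = 2 ^ j * W\<^sup>2"
  define v where "v = 2 ^ j * w0\<^sup>2"
  have v: "v \<in> fixed_integers" "v \<notin> Q" "v \<in> OL"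
    using w0(4) unfolding v_def[symmetric] by (simp_all add: fixed_integers_iff)
  have norm_s0: "s0 * \<tau> s0 \<in> fixed_integers" "s0 * \<tau> s0 \<notin> Q"
    using s0(1) fixed_integers_closed(5)[of s0] norm_notin_Q[of s0] by auto
  have W: "W \<in> L" "\<tau> W = - W"
    using w0 s0 by (simp_all add: W_def mult_ac)
  have u_eq: "u = v * (s0 * \<tau> s0)\<^sup>2"
    by (simp add: v_def u_def W_def power_mult_distrib mult_ac)
  have u: "u \<in> fixed_integers" "u \<notin> Q" "u \<in> OL"
  proof -
    show "u \<in> fixed_integers"
      unfolding u_eq by (rule fixed_integers_closed(1)[OF _ fixed_integers_closed(4)[OF norm_s0(1)]])
        (rule v)
    thus "u \<in> OL" by (simp add: fixed_integers_iff)
    have "(s0 * \<tau> s0)\<^sup>2 \<notin> Q" using Q_power_iff[of "s0 * \<tau> s0" 2] norm_s0 by (simp add: fixed_integers_iff)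
    thus "u \<notin> Q" unfolding u_eq
      using v s0(1) by (intro notin_mult) simp_all
  qed
  have u_conc: "\<sigma> u \<in> Q" if \<sigma>: "\<sigma> \<in> G - DG" for \<sigma>
  proof -
    have "\<sigma> u = (\<sigma> v * \<sigma> s0 * (\<sigma> (\<tau> s0))\<^sup>2) * \<sigma> s0"
      unfolding u_eq using \<sigma> s0(1) v by (simp add: power_mult_distrib power2_eq_square mult_ac)
    also have "\<dots> \<in> Q"
      by (rule Q_mult[OF s0(2)[OF \<sigma>]]) (use \<sigma> s0(1) v in simp)
    finally show ?thesis .
  qed
  \<comment> \<open>The root \<open>r\<close> is a power of \<open>u\<close>, so it is fixed by
    \<open>\<tau>\<close>, and \<open>u - r^2\<close> is locally divisible by 2 within the fixed
    integers.\<close>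
  obtain n where n: "cg ((u ^ n)\<^sup>2) u" using exists_square_root_mod[of u] u u_conc p by blast
  define r where "r = u ^ n"
  have r: "r \<in> fixed_integers" "r \<in> OL" "r \<notin> Q" and r2: "cg (r\<^sup>2) u"
    using u fixed_integers_closed(4)[of u n] n cg_Q[OF n] Q_power_iff[of "u ^ n" 2]
    by (simp_all add: r_def)
  have r0: "r \<noteq> 0" using r(3) by auto
  have "u - r\<^sup>2 \<in> fixed_integers"
    by (rule fixed_integers_closed(3)[OF u(1) fixed_integers_closed(4)[OF r(1)]])
  moreover have "u - r\<^sup>2 \<in> Q" using cgD(3)[OF r2] Q_diff_commute by blast
  ultimately obtain s2 t2 where st2: "s2 \<in> fixed_integers - Q" "t2 \<in> fixed_integers" "s2 * (u - r\<^sup>2) = 2 * t2"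
    using unr by blast
  define d where "d = s2 * r\<^sup>2"
  have t2: "t2 \<in> OL" "s2 \<in> OL" "s2 \<notin> Q" using st2 by (simp_all add: fixed_integers_iff)
  have d_fixed: "d \<in> fixed_integers"
    unfolding d_def by (rule fixed_integers_closed(1)[OF _ fixed_integers_closed(4)[OF r(1)]]) (use st2 in simp)
  have "r\<^sup>2 \<notin> Q" using r Q_power_iff[of r 2] by simp
  hence "d \<notin> Q" unfolding d_def using t2 r by (intro notin_mult) simp_all
  with d_fixed have d: "d \<in> fixed_integers" "d \<notin> Q" "d \<in> OL"
    by (simp_all add: fixed_integers_iff)
  have E0: "s2 * u = d + 2 * t2" using st2(3) by (simp add: d_def algebra_simps)
  \<comment> \<open>With \<open>W\<^sup>2 2\<^sup>j = u\<close> and \<open>u / r\<^sup>2 = 1 + 2 t2 / d\<close>, commutation with \<open>\<tau>\<close> makes \<open>\<phi> u / u\<close> a square of the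
    fixed field, which is congruent to 1 modulo 2; hence its root is congruent to 1 modulo 2 and \<open>\<phi> u / u\<close> is
    congruent to \<open>\<phi> (r\<^sup>2) / r\<^sup>2\<close> modulo 4, i.e. the residue of \<open>t2 / d\<close> is fixed by \<open>\<phi>\<close>.\<close>
  have key: "cg (d * \<phi> t2) (\<phi> d * t2)" if \<phi>: "\<phi> \<in> DG" for \<phi>
  proof -
    define h where "h = 2 ^ j * (\<phi> W * W)"
    have h2: "h\<^sup>2 = \<phi> u * u"
      using \<phi> W by (simp add: h_def u_def power_mult_distrib mult_ac power2_eq_square)
    have "h \<in> L" using \<phi> W by (simp add: h_def)
    moreover have "algebraic_int (h\<^sup>2)"
      unfolding h2 using u(3) G_OL[OF DG_G[OF \<phi>] u(3)] by (auto simp: OL_iff)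
    ultimately have h_OL: "h \<in> OL" using algebraic_int_square_root by (simp add: OL_iff)
    have "\<tau> (\<phi> W) = - \<phi> W" using DG_commute[OF \<phi> W(1)] W \<phi> by simp
    hence h: "h \<in> fixed_integers" using h_OL \<phi> W by (simp add: fixed_integers_iff h_def)
    define r' where "r' = \<phi> r"
    have r': "r' \<in> fixed_integers" "r' \<in> OL"
      using DG_fixed_integers[OF \<phi> r(1)] by (simp_all add: r'_def fixed_integers_iff)
    \<comment> \<open>\<open>h * r / (r' * u)\<close> squares to the quotient of
      \<open>\<phi> u / r'^2\<close> by \<open>u / r^2\<close>, both congruent to 1 modulo
      \<open>Q\<close>. Injectivity of squaring puts \<open>k\<close> into \<open>Q\<close>, and as
      \<open>k\<close> is fixed by \<open>\<tau>\<close>, it is locally divisible by 2.\<close>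
    define k where "k = h * r - r' * u"
    have k: "k \<in> fixed_integers"
      unfolding k_def by (intro fixed_integers_closed h r r' u)
    have "cg (\<phi> (r\<^sup>2)) (\<phi> u)" by (rule DG_cg[OF \<phi> r2])
    hence "cg (\<phi> u) (r'\<^sup>2)" using cg_sym \<phi> r by (simp add: r'_def)
    moreover have "cg (u * r\<^sup>2) (u * u)" by (rule cg_mult[OF cg_refl[OF u(3)] r2])
    ultimately have "cg (\<phi> u * (u * r\<^sup>2)) (r'\<^sup>2 * (u * u))" by (rule cg_mult)
    moreover have "(h * r)\<^sup>2 = \<phi> u * (u * r\<^sup>2)" by (simp only: power_mult_distrib h2 mult.assoc)
    moreover have "(r' * u)\<^sup>2 = r'\<^sup>2 * (u * u)"
      by (simp only: power_mult_distrib power2_eq_square[of u])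
    ultimately have "cg ((h * r)\<^sup>2) ((r' * u)\<^sup>2)" by simp
    hence "cg (h * r) (r' * u)"
      by (rule cg_square) (use h_OL r r' u p in simp_all)
    hence "k \<in> Q" unfolding k_def by (rule cgD)
    then obtain s3 t3 where st3: "s3 \<in> fixed_integers - Q" "t3 \<in> fixed_integers" "s3 * k = 2 * t3"
      using unr[OF k] by blast
    have st3': "s3 \<in> OL" "t3 \<in> OL" using st3 by (simp_all add: fixed_integers_iff)
    have \<phi>d: "\<phi> d = \<phi> s2 * r'\<^sup>2" using \<phi> t2 r by (simp add: d_def r'_def)
    have \<phi>E0: "\<phi> s2 * \<phi> u = \<phi> d + 2 * \<phi> t2"
      using arg_cong[OF E0, of \<phi>] \<phi> t2 u d by simp
    have hr: "h * r = r' * u + k" by (simp add: k_def)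
    have "\<phi> u * u * r\<^sup>2 = (r' * u + k)\<^sup>2"
      unfolding hr[symmetric] by (simp add: power_mult_distrib h2)
    hence "u * (\<phi> u * r\<^sup>2 - r'\<^sup>2 * u) = 2 * (r' * u * k) + k\<^sup>2"
      by (simp add: power2_eq_square algebra_simps)
    hence "s3\<^sup>2 * (u * (\<phi> u * r\<^sup>2 - r'\<^sup>2 * u)) = 2 * (r' * u * s3) * (s3 * k) + (s3 * k)\<^sup>2"
      by (simp add: power2_eq_square algebra_simps)
    also have "\<dots> = 4 * (r' * u * s3 * t3 + t3\<^sup>2)"
      unfolding st3(3) by (simp add: power2_eq_square algebra_simps)
    finally have e1: "s3\<^sup>2 * (u * (\<phi> u * r\<^sup>2 - r'\<^sup>2 * u)) = 4 * (r' * u * s3 * t3 + t3\<^sup>2)" .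
    have "s2 * \<phi> s2 * (\<phi> u * r\<^sup>2 - r'\<^sup>2 * u) = d * (\<phi> s2 * \<phi> u) - \<phi> d * (s2 * u)"
      unfolding \<phi>d by (simp add: d_def algebra_simps)
    also have "\<dots> = 2 * (d * \<phi> t2 - \<phi> d * t2)"
      unfolding \<phi>E0 E0 by (simp add: algebra_simps)
    finally have e2: "s2 * \<phi> s2 * (\<phi> u * r\<^sup>2 - r'\<^sup>2 * u) = 2 * (d * \<phi> t2 - \<phi> d * t2)" .
    \<comment> \<open>One factor 2 of the 4 in \<open>e1\<close> cancels against \<open>e2\<close>;
      the other one remains and gives membership in \<open>Q\<close>.\<close>
    have "2 * (s3\<^sup>2 * u * (d * \<phi> t2 - \<phi> d * t2)) = s3\<^sup>2 * u * (s2 * \<phi> s2 * (\<phi> u * r\<^sup>2 - r'\<^sup>2 * u))"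
      unfolding e2 by simp
    also have "\<dots> = s2 * \<phi> s2 * (s3\<^sup>2 * (u * (\<phi> u * r\<^sup>2 - r'\<^sup>2 * u)))" by (simp only: mult_ac)
    also have "\<dots> = 2 * ((s2 * \<phi> s2 * (r' * u * s3 * t3 + t3\<^sup>2)) * 2)" unfolding e1 by simp
    finally have "s3\<^sup>2 * u * (d * \<phi> t2 - \<phi> d * t2) = (s2 * \<phi> s2 * (r' * u * s3 * t3 + t3\<^sup>2)) * 2"
      by (metis mult_left_cancel zero_neq_numeral)
    also have "\<dots> \<in> Q" by (rule Q_mult[OF 2]) (use \<phi> t2 r' u st3' in simp)
    finally have in_Q: "s3\<^sup>2 * u * (d * \<phi> t2 - \<phi> d * t2) \<in> Q" .
    have OL: "d * \<phi> t2 \<in> OL" "\<phi> d * t2 \<in> OL" using \<phi> d t2 by simp_all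
    have "s3\<^sup>2 * u \<notin> Q"
      using st3 st3' u Q_power_iff[of s3 2] by (intro notin_mult) simp_all
    hence "d * \<phi> t2 - \<phi> d * t2 \<in> Q"
      using Q_prime[OF _ _ in_Q] OL st3' u by simp
    thus ?thesis using OL by (simp add: cg_def)
  qed
  obtain d1 where d1: "d1 \<in> OL - Q" "cg (d * d1) 1" using exists_inverse_cg[of d] d by blast
  \<comment> \<open>An integer whose residue is that of \<open>t2 / d\<close>; \<open>d1\<close>
    inverts \<open>d\<close> modulo \<open>Q\<close>.\<close>
  define b where "b = t2 * d1"
  have b: "b \<in> OL" using t2 d1 by (simp add: b_def)
  have b_fixed: "cg (\<phi> b) b" if \<phi>: "\<phi> \<in> DG" for \<phi>
  proof -
    have 1: "cg (\<phi> d * \<phi> d1) 1" using DG_cg[OF \<phi> d1(2)] \<phi> d d1 by simp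
    have "cg ((d * d1) * \<phi> b) (1 * \<phi> b)"
      by (rule cg_mult[OF d1(2) cg_refl]) (use \<phi> b in simp)
    hence "cg (\<phi> b) ((d * d1) * \<phi> b)" using cg_sym by simp
    also have "(d * d1) * \<phi> b = (d * \<phi> t2) * (d1 * \<phi> d1)"
      using \<phi> t2 d1 by (simp add: b_def mult_ac)
    also have "cg \<dots> ((\<phi> d * t2) * (d1 * \<phi> d1))"
      by (rule cg_mult[OF key[OF \<phi>] cg_refl]) (use \<phi> d1 in simp)
    also have "(\<phi> d * t2) * (d1 * \<phi> d1) = (\<phi> d * \<phi> d1) * b" by (simp add: b_def mult_ac)
    also have "cg \<dots> (1 * b)" by (rule cg_mult[OF 1 cg_refl[OF b]])
    finally show ?thesis by simp
  qed
  obtain c0 where c0: "c0 \<in> OL - Q" "cg (s0 * c0) 1" using exists_inverse_cg[OF s0(1)] by blast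
  \<comment> \<open>The factor \<open>s0 * c0\<close> is congruent to 1, so the residue of
    \<open>b\<close> is kept, while the conjugates outside \<open>DG\<close> become elements of
    \<open>Q\<close>. This allows a Frobenius element for \<open>y\<close> to be found in
    \<open>DG\<close>.\<close>
  define y where "y = b * (s0 * c0)"
  have y: "y \<in> OL" using b s0 c0 by (simp add: y_def)
  have yb: "cg y b" using cg_mult[OF cg_refl[OF b] c0(2)] by (simp add: y_def)
  have "\<sigma> y \<in> Q" if \<sigma>: "\<sigma> \<in> G - DG" for \<sigma>
  proof -
    have "\<sigma> y = (\<sigma> b * \<sigma> c0) * \<sigma> s0" using \<sigma> b s0 c0 by (simp add: y_def mult_ac)
    also have "\<dots> \<in> Q" by (rule Q_mult[OF s0(2)[OF \<sigma>]]) (use \<sigma> b c0 in simp)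
    finally show ?thesis .
  qed
  then obtain \<sigma> where \<sigma>: "\<sigma> \<in> DG" "cg (y\<^sup>2) (\<sigma> y)"
    using exists_frobenius_DG[of y] y p by blast
  note \<sigma>(2)
  also have "cg (\<sigma> y) (\<sigma> b)" by (rule DG_cg[OF \<sigma>(1) yb])
  also have "cg (\<sigma> b) b" by (rule b_fixed[OF \<sigma>(1)])
  also have "cg b y" by (rule cg_sym[OF yb])
  \<comment> \<open>Frobenius squares the residue of \<open>y\<close>, yet it fixes the residue of
    \<open>b\<close>, which is the same; so the residue is 0 or 1.\<close>
  finally have "y * (y - 1) \<in> Q" by (simp add: cg_def power2_eq_square algebra_simps)
  hence y_cases: "y \<in> Q \<or> y - 1 \<in> Q" using Q_prime[of y "y - 1"] y by simp
  define w where "w = W / r"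
  have w: "w \<in> L" "\<tau> w = - w" using W r by (simp_all add: w_def fixed_integers_iff)
  have "d * (2 ^ j * w\<^sup>2) = s2 * u" using r0 by (simp add: w_def d_def u_def power_divide)
  hence E: "d * (2 ^ j * w\<^sup>2) = d + 2 * t2" using E0 by simp
  from y_cases show ?thesis
  proof
    assume "y \<in> Q"
    hence "t2 * d1 \<in> Q" using cg_Q[OF yb] by (simp add: b_def)
    hence "t2 \<in> Q" using Q_prime[of t2 d1] d1 t2 by blast
    then obtain s4 t4 where st4: "s4 \<in> fixed_integers - Q" "t4 \<in> fixed_integers" "s4 * t2 = 2 * t4"
      using unr[OF st2(2)] by blast
    have "(s4 * d) * (of_int 1 * 2 ^ j * w\<^sup>2 - 1) = s4 * (d * (2 ^ j * w\<^sup>2)) - s4 * d"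
      by (simp add: algebra_simps)
    also have "\<dots> = 2 * (s4 * t2)" unfolding E by (simp add: algebra_simps)
    also have "\<dots> = 4 * t4" unfolding st4(3) by simp
    finally have "(s4 * d) * (of_int 1 * 2 ^ j * w\<^sup>2 - 1) = 4 * t4" .
    moreover have "s4 * d \<in> OL - Q" "t4 \<in> OL"
      using st4 d notin_mult[of s4 d] by (simp_all add: fixed_integers_iff)
    ultimately show ?thesis using w w0(3) by blast
  next
    assume "y - 1 \<in> Q"
    hence "cg y 1" using y by (simp add: cg_def)
    hence "cg b 1" using cg_trans[OF cg_sym[OF yb]] by blast
    hence "cg (d * b) (d * 1)" by (rule cg_mult[OF cg_refl[OF d(3)]])
    moreover have "cg ((d * d1) * t2) (1 * t2)" by (rule cg_mult[OF d1(2) cg_refl[OF t2(1)]])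
    hence "cg t2 (d * b)" using cg_sym by (simp add: b_def mult_ac)
    ultimately have "cg t2 (d * 1)" using cg_trans by blast
    hence "t2 - d \<in> Q" by (simp add: cg_def)
    moreover have "t2 - d \<in> fixed_integers" by (rule fixed_integers_closed(3)[OF st2(2) d(1)])
    ultimately obtain s4 t4 where st4: "s4 \<in> fixed_integers - Q" "t4 \<in> fixed_integers" "s4 * (t2 - d) = 2 * t4"
      using unr[of "t2 - d"] by blast
    \<comment> \<open>With \<open>x = t2 / d\<close>, this is
      \<open>- (1 + 2 * x) - 1 = - 2 * (x - 1) - 4\<close>, where \<open>x - 1\<close> is locally
      divisible by 2.\<close>
    have "(s4 * d) * (of_int (-1) * 2 ^ j * w\<^sup>2 - 1) = - (s4 * (d * (2 ^ j * w\<^sup>2))) - s4 * d"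
      by (simp add: algebra_simps)
    also have "\<dots> = - (2 * (s4 * (t2 - d))) - 4 * (s4 * d)" unfolding E by (simp add: algebra_simps)
    also have "\<dots> = 4 * (- t4 - s4 * d)" unfolding st4(3) by (simp add: algebra_simps)
    finally have "(s4 * d) * (of_int (-1) * 2 ^ j * w\<^sup>2 - 1) = 4 * (- t4 - s4 * d)" .
    moreover have "s4 * d \<in> OL - Q" "- t4 - s4 * d \<in> OL"
      using st4 d notin_mult[of s4 d] by (simp_all add: fixed_integers_iff)
    ultimately show ?thesis using w w0(3) by blast
  qed
qed

text \<open>Conjugating \<open>\<sigma>\<close> by \<open>\<rho>\<close> gives a nontrivial element
  of the inertia group at \<open>Q\<close>, hence \<open>\<tau>\<close>. So \<open>\<rho>\<close>
  transports anti-invariant elements to anti-invariant elements.\<close>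

lemma conjugate_inertia:
  assumes \<rho>: "\<rho> \<in> G" "\<And>x. x \<in> OL \<Longrightarrow> x \<in> Q \<longleftrightarrow> \<rho> x \<in> Q'"
    and \<sigma>: "\<sigma> \<in> G" "\<exists>x\<in>L. \<sigma> x \<noteq> x" "\<And>x. x \<in> OL \<Longrightarrow> \<sigma> x - x \<in> Q'"
    and w: "w \<in> L" "\<tau> w = - w"
  shows "\<sigma> (\<rho> w) = - \<rho> w"
proof -
  define \<psi> where "\<psi> = compose L (inv_G \<rho>) (compose L \<sigma> \<rho>)"
  have \<psi>: "\<psi> y = inv_G \<rho> (\<sigma> (\<rho> y))" if "y \<in> L" for y
    using that \<rho> \<sigma> by (simp add: \<psi>_def compose_eq)
  have \<rho>\<psi>: "\<rho> (\<psi> y) = \<sigma> (\<rho> y)" if "y \<in> L" for y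
    using that \<rho> \<sigma> \<psi> by simp
  have \<psi>_G: "\<psi> \<in> G" using \<rho> \<sigma> by (simp add: \<psi>_def)
  have "\<psi> y - y \<in> Q" if y: "y \<in> OL" for y
  proof -
    have "\<rho> (\<psi> y - y) = \<sigma> (\<rho> y) - \<rho> y" using y \<psi>_G \<rho> \<rho>\<psi> by simp
    also have "\<dots> \<in> Q'" by (rule \<sigma>(3)) (use \<rho> y in simp)
    finally show ?thesis using \<rho>(2)[of "\<psi> y - y"] y \<psi>_G by simp
  qed
  then consider "\<forall>x\<in>L. \<psi> x = x" | "\<forall>x\<in>L. \<psi> x = \<tau> x"
    using inertia_cases[OF \<psi>_G] by blast
  thus ?thesis
  proof cases
    case 1
    have "\<sigma> y = y" if "y \<in> L" for y
      using \<rho>\<psi>[of "inv_G \<rho> y"] 1 that \<rho> by simp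
    thus ?thesis using \<sigma>(2) by blast
  next
    case 2
    thus ?thesis using \<rho>\<psi>[OF w(1)] w \<rho> by simp
  qed
qed

end

section \<open>Transitivity of the Galois group on the primes above a prime number\<close>

context rational_galois_prime
begin

text \<open>If no conjugate of \<open>Q\<close> lay in \<open>Q'\<close>, the product of elements
  \<open>b \<rho>\<close>, each congruent to 1 modulo \<open>Q'\<close> and sent into
  \<open>Q\<close> by \<open>\<rho>\<close>, would give \<open>z = 1 - prod\<close> in
  \<open>Q'\<close> with all conjugates outside \<open>Q\<close>. But the norm of \<open>z\<close>
  is an integer in \<open>Q'\<close>, hence divisible by the common residue characteristic and so in
  \<open>Q\<close>.\<close>

theorem exists_conjugating_automorphism:
  assumes Q': "Q' \<in> finite_primes L" "of_nat res_char \<in> Q'"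
  shows "\<exists>\<rho>\<in>G. \<forall>x\<in>OL. x \<in> Q \<longleftrightarrow> \<rho> x \<in> Q'"
proof -
  interpret Q': rational_galois_prime L Q'
    by unfold_locales (rule Q')
  have "\<exists>\<rho>\<in>G. \<forall>x\<in>Q. \<rho> x \<in> Q'"
  proof (rule ccontr)
    assume no: "\<not> (\<exists>\<rho>\<in>G. \<forall>x\<in>Q. \<rho> x \<in> Q')"
    have "\<exists>b\<in>OL. Q'.cg b 1 \<and> \<rho> b \<in> Q" if \<rho>: "\<rho> \<in> G" for \<rho>
    proof -
      obtain a where a: "a \<in> Q" "inv_G \<rho> a \<notin> Q'" using no inv_G[OF \<rho>] by blast
      have "inv_G \<rho> a \<in> OL" using a \<rho> Q_OL by simp
      then obtain c where c: "c \<in> OL" "inv_G \<rho> a * c - 1 \<in> Q'" using Q'.Q_maximal[of "inv_G \<rho> a"] a by blast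
      have "\<rho> (inv_G \<rho> a * c) = \<rho> c * a" using \<rho> a(1) c Q_OL[OF a(1)] by (simp add: mult.commute)
      also have "\<dots> \<in> Q" using a \<rho> c by (intro Q_mult) simp_all
      finally show ?thesis
        using c \<open>inv_G \<rho> a \<in> OL\<close> by (intro bexI[of _ "inv_G \<rho> a * c"]) (simp_all add: Q'.cg_def)
    qed
    then obtain b where b: "\<And>\<rho>. \<rho> \<in> G \<Longrightarrow> b \<rho> \<in> OL \<and> Q'.cg (b \<rho>) 1 \<and> \<rho> (b \<rho>) \<in> Q" by metis
    have "Q'.cg (\<Prod>\<rho>\<in>I. b \<rho>) 1" if "I \<subseteq> G" for I
      using finite_subset[OF that finite_G] that
    proof (induction I rule: finite_induct)
      case (insert \<rho> I)
      hence "Q'.cg (b \<rho> * (\<Prod>\<rho>\<in>I. b \<rho>)) (1 * 1)" using b by (intro Q'.cg_mult) auto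
      thus ?case using insert by simp
    qed (simp add: Q'.cg_refl)
    hence prod_cg: "Q'.cg (\<Prod>\<rho>\<in>G. b \<rho>) 1" by blast
    define z where "z = 1 - (\<Prod>\<rho>\<in>G. b \<rho>)"
    have prod_OL: "(\<Prod>\<rho>\<in>G. b \<rho>) \<in> OL" using b by (intro OL_prod) blast
    have z: "z \<in> OL" "z \<in> Q'"
      using prod_OL Q'.cgD(3)[OF prod_cg] Q'.Q_diff_commute[of 1 "\<Prod>\<rho>\<in>G. b \<rho>"] by (simp_all add: z_def)
    have z_Q: "\<rho> z \<notin> Q" if \<rho>: "\<rho> \<in> G" for \<rho>
    proof -
      have "\<rho> (\<Prod>\<kappa>\<in>G. b \<kappa>) = (\<Prod>\<kappa>\<in>G. \<rho> (b \<kappa>))" using \<rho> b by (intro G_prod) auto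
      also have "\<dots> \<in> Q" using \<rho> b by (subst Q_prod_iff) auto
      finally have "1 - \<rho> z \<in> Q" using \<rho> prod_OL by (simp add: z_def)
      thus ?thesis using Q_diff_iff[of 1 "\<rho> z"] by simp
    qed
    have "(\<Prod>\<rho>\<in>G. \<rho> z) \<in> \<rat>" by (rule norm_in_E) (use z in simp)
    moreover have prod_OL': "(\<Prod>\<rho>\<in>G. \<rho> z) \<in> OL" using z by (intro OL_prod) simp
    ultimately obtain n where n: "(\<Prod>\<rho>\<in>G. \<rho> z) = of_int n" using OL_Rats by (auto elim: Ints_cases)
    have "\<exists>\<rho>\<in>G. \<rho> z \<in> Q'" using z by (intro bexI[of _ "\<lambda>x\<in>L. x"]) simp_all
    hence "of_int n \<in> Q'" unfolding n[symmetric] using z by (subst Q'.Q_prod_iff) auto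
    hence "of_int n \<in> Q"
      unfolding of_int_in_Q_iff Q'.of_int_in_Q_iff
      using Q'.res_char_eq[OF prime_res_char Q'(2)] by simp
    hence "\<exists>\<rho>\<in>G. \<rho> z \<in> Q" unfolding n[symmetric] using z by (subst (asm) Q_prod_iff) auto
    thus False using z_Q by blast
  qed
  then obtain \<rho> where \<rho>: "\<rho> \<in> G" "\<And>x. x \<in> Q \<Longrightarrow> \<rho> x \<in> Q'" by blast
  have "x \<in> Q" if x: "x \<in> OL" "\<rho> x \<in> Q'" for x
  proof (rule ccontr)
    assume "x \<notin> Q"
    then obtain c where c: "c \<in> OL" "x * c - 1 \<in> Q" using Q_maximal x by blast
    have "\<rho> x * \<rho> c - 1 \<in> Q'" using \<rho>(2)[OF c(2)] \<rho>(1) x c by simp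
    moreover have "\<rho> x * \<rho> c \<in> Q'" by (rule Q'.Q_mult'[OF x(2)]) (use \<rho>(1) c in simp)
    ultimately show False using Q'.Q_diff_iff[of "\<rho> x * \<rho> c" 1] by simp
  qed
  thus ?thesis using \<rho> by blast
qed

end

context finite_galois
begin

text \<open>In place of the discriminant: if \<open>\<sigma>\<close> is in the inertia group at
  \<open>Q\<close>, then \<open>Q\<close> contains \<open>\<sigma> \<theta> - \<theta>\<close> for a
  fixed integer \<open>\<theta>\<close> moved by \<open>\<sigma>\<close>, and with it a nonzero
  integer depending on \<open>\<sigma>\<close> only. \<open>N\<close> is the product of these
  integers.\<close>

lemma finitely_many_ramified:
  assumes E: "E = \<rat>"
  shows "\<exists>N::int. N \<noteq> 0 \<and> (\<forall>Q\<in>finite_primes L. \<forall>\<sigma>\<in>G. \<forall>p. (\<exists>x\<in>L. \<sigma> x \<noteq> x) \<longrightarrow>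
    (\<forall>x\<in>OL. \<sigma> x - x \<in> Q) \<longrightarrow> prime p \<longrightarrow> of_nat p \<in> Q \<longrightarrow> int p dvd N)"
proof -
  define H where "H = {\<sigma> \<in> G. \<exists>x\<in>L. \<sigma> x \<noteq> x}"
  have "\<exists>c \<theta> h. \<theta> \<in> OL \<and> c \<noteq> 0 \<and> of_int c = (\<sigma> \<theta> - \<theta>) * poly (map_poly of_int h) (\<sigma> \<theta> - \<theta>)" if \<sigma>: "\<sigma> \<in> H" for \<sigma>
  proof -
    obtain \<theta> where \<theta>: "\<theta> \<in> OL" "\<sigma> \<theta> \<noteq> \<theta>"
      using exists_nonfixed_integer[OF E, of \<sigma>] \<sigma> by (auto simp: H_def)
    have "\<sigma> \<theta> - \<theta> \<in> OL" using \<theta> \<sigma> by (simp add: H_def)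
    thus ?thesis using exists_nonzero_int_multiple[of "\<sigma> \<theta> - \<theta>"] \<theta> by (auto simp: OL_iff)
  qed
  then obtain c \<theta> h where c: "\<And>\<sigma>. \<sigma> \<in> H \<Longrightarrow> \<theta> \<sigma> \<in> OL \<and> c \<sigma> \<noteq> (0::int) \<and>
      of_int (c \<sigma>) = (\<sigma> (\<theta> \<sigma>) - \<theta> \<sigma>) * poly (map_poly of_int (h \<sigma>)) (\<sigma> (\<theta> \<sigma>) - \<theta> \<sigma>)"
    by metis
  have H_sub: "H \<subseteq> G" by (auto simp: H_def)
  have fin: "finite H" by (rule finite_subset[OF H_sub finite_G])
  show ?thesis
  proof (intro exI[of _ "\<Prod>\<sigma>\<in>H. c \<sigma>"] conjI ballI allI impI)
    show "(\<Prod>\<sigma>\<in>H. c \<sigma>) \<noteq> 0" using c fin by simp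
    fix Q \<sigma> p assume *: "Q \<in> finite_primes L" "\<sigma> \<in> G" "\<exists>x\<in>L. \<sigma> x \<noteq> x" "\<forall>x\<in>OL. \<sigma> x - x \<in> Q"
      "prime p" "of_nat p \<in> Q"
    interpret prime_of_subfield L Q by unfold_locales (rule *)
    have \<sigma>: "\<sigma> \<in> H" using * by (simp add: H_def)
    have "\<sigma> (\<theta> \<sigma>) - \<theta> \<sigma> \<in> Q" using * c[OF \<sigma>] by blast
    hence "of_int (c \<sigma>) \<in> Q"
      using c[OF \<sigma>] Q_mult'[OF _ OL_poly] by (metis Q_OL)
    hence "int res_char dvd c \<sigma>" by (simp add: of_int_in_Q_iff)
    moreover have "p = res_char" by (rule res_char_eq) (use * in auto)
    moreover have "c \<sigma> dvd (\<Prod>\<sigma>\<in>H. c \<sigma>)" by (rule dvd_prodI[OF fin \<sigma>])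
    ultimately show "int p dvd (\<Prod>\<sigma>\<in>H. c \<sigma>)" by (metis dvd_trans)
  qed
qed

end

section \<open>Ramification indices and trivial inertia\<close>

context galois_prime
begin

lemma ideal_Q: "ideal Q (ring_of_integers L)"
  unfolding ideal_ring_of_integers_iff by auto

text \<open>The \<open>T\<close>-span of \<open>Y\<close>, localized at \<open>Q\<close>. Both
  \<open>T = OL\<close> and \<open>T = Q\<close> occur below: the module generated by
  \<open>Y\<close> and its product with \<open>Q\<close>.\<close>

lemma local_ideal_combinations:
  assumes T: "T \<subseteq> OL" "0 \<in> T" "\<And>x y. x \<in> T \<Longrightarrow> y \<in> T \<Longrightarrow> x + y \<in> T" "\<And>x a. x \<in> T \<Longrightarrow> a \<in> OL \<Longrightarrow> a * x \<in> T"
  shows "local_ideal OL Q {x. \<exists>s\<in>OL - Q. \<exists>q. (\<forall>z\<in>Y. q z \<in> T) \<and> s * x = (\<Sum>z\<in>Y. q z * z)}" (is "local_ideal _ _ ?Z")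
proof -
  have ZI: "x \<in> ?Z" if "s \<in> OL - Q" "\<And>z. z \<in> Y \<Longrightarrow> q z \<in> T" "s * x = (\<Sum>z\<in>Y. q z * z)" for x s q
    using that by blast
  show ?thesis
    unfolding local_ideal_def
  proof (intro conjI ballI allI impI)
    show "0 \<in> ?Z" by (rule ZI[of 1 "\<lambda>_. 0"]) (use T in simp_all)
  next
    fix x y assume "x \<in> ?Z" "y \<in> ?Z"
    then obtain s q s' q' where *: "s \<in> OL - Q" "\<And>z. z \<in> Y \<Longrightarrow> q z \<in> T" "s * x = (\<Sum>z\<in>Y. q z * z)"
      "s' \<in> OL - Q" "\<And>z. z \<in> Y \<Longrightarrow> q' z \<in> T" "s' * y = (\<Sum>z\<in>Y. q' z * z)" by blast
    have "(s * s') * (x + y) = s' * (s * x) + s * (s' * y)" by (simp add: algebra_simps)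
    also have "\<dots> = (\<Sum>z\<in>Y. (s' * q z + s * q' z) * z)"
      unfolding *(3,6) by (simp add: sum_distrib_left sum.distrib algebra_simps)
    finally have "(s * s') * (x + y) = (\<Sum>z\<in>Y. (s' * q z + s * q' z) * z)" .
    thus "x + y \<in> ?Z"
      by (rule ZI[rotated 2]) (use * T notin_mult[of s s'] in simp_all)
  next
    fix x a assume "x \<in> ?Z" and a: "a \<in> OL"
    then obtain s q where *: "s \<in> OL - Q" "\<And>z. z \<in> Y \<Longrightarrow> q z \<in> T" "s * x = (\<Sum>z\<in>Y. q z * z)" by blast
    have "s * (a * x) = a * (s * x)" by (simp add: algebra_simps)
    also have "\<dots> = (\<Sum>z\<in>Y. (a * q z) * z)" unfolding *(3) by (simp add: sum_distrib_left algebra_simps)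
    finally show "a * x \<in> ?Z" by (rule ZI[OF *(1), rotated]) (use * T a in simp)
  next
    fix x s assume s: "s \<in> OL - Q" "s * x \<in> ?Z"
    then obtain s' q where *: "s' \<in> OL - Q" "\<And>z. z \<in> Y \<Longrightarrow> q z \<in> T" "s' * (s * x) = (\<Sum>z\<in>Y. q z * z)" by blast
    have "(s' * s) * x = (\<Sum>z\<in>Y. q z * z)" using *(3) by (simp add: mult.assoc)
    thus "x \<in> ?Z" by (rule ZI[rotated 2]) (use * s notin_mult[of s' s] in simp_all)
  qed
qed

text \<open>Descent with \<open>R = OL\<close> shows that \<open>Q\<close> is locally generated by
  \<open>Q \<inter> E\<close>. If \<open>Q \<inter> E\<close> were inside \<open>Q^2\<close>, this
  module would equal \<open>Q\<close> times itself and vanish by Nakayama's lemma, although it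
  contains the residue characteristic.\<close>

theorem not_subset_square_if_inertia_trivial:
  assumes trivial: "\<And>\<sigma>. \<sigma> \<in> G \<Longrightarrow> (\<And>x. x \<in> OL \<Longrightarrow> \<sigma> x - x \<in> Q) \<Longrightarrow> \<forall>x\<in>OL. \<sigma> x = x"
    and Y: "finite Y" "Y \<subseteq> Q \<inter> E"
      "\<And>z. z \<in> Q \<inter> E \<Longrightarrow> \<exists>y\<in>Y. \<exists>t\<in>OL. z - y = of_nat res_char * t"
  shows "\<not> Q \<inter> E \<subseteq> ideal_prod (ring_of_integers L) Q Q"
proof
  assume sub: "Q \<inter> E \<subseteq> ideal_prod (ring_of_integers L) Q Q"
  \<comment> \<open>Since \<open>Y\<close> represents \<open>Q \<inter> E\<close> only modulo the
    residue characteristic, that number is added as a generator; it is also the nonzero element that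
    gives the contradiction.\<close>
  define Y' where "Y' = insert (of_nat res_char) Y"
  have Y': "finite Y'" "Y' \<subseteq> Q \<inter> E" using Y res_char_in_Q res_char_in_E by (auto simp: Y'_def)
  define Z2 where "Z2 = {x. \<exists>s\<in>OL - Q. \<exists>q. (\<forall>z\<in>Y'. q z \<in> OL) \<and> s * x = (\<Sum>z\<in>Y'. q z * z)}"
  have Z2: "local_ideal OL Q Z2"
    unfolding Z2_def by (rule local_ideal_combinations) simp_all
  define Z3 where "Z3 = {x. \<exists>s\<in>OL - Q. \<exists>q. (\<forall>z\<in>Y'. q z \<in> Q) \<and> s * x = (\<Sum>z\<in>Y'. q z * z)}"
  have Z3: "local_ideal OL Q Z3"
    unfolding Z3_def by (rule local_ideal_combinations) auto
  have Y'_Z2: "y \<in> Z2" if y: "y \<in> Y'" for y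
  proof -
    have "1 * y = (\<Sum>z\<in>Y'. (if z = y then 1 else 0) * z)"
      using Y'(1) y by (simp add: if_distrib[of "\<lambda>x. x * _"] cong: if_cong)
    thus ?thesis unfolding Z2_def
      by (intro CollectI bexI[of _ 1] exI[of _ "\<lambda>z. if z = y then 1 else 0"]) auto
  qed
  have "Q \<inter> E \<subseteq> Z2"
  proof
    fix z assume "z \<in> Q \<inter> E"
    then obtain y t where yt: "y \<in> Y" "t \<in> OL" "z - y = of_nat res_char * t" using Y(3) by blast
    have "y \<in> Z2" "of_nat res_char \<in> Z2" using Y'_Z2 yt(1) by (auto simp: Y'_def)
    hence "y + t * of_nat res_char \<in> Z2" using local_idealD(2,3)[OF Z2] yt(2) by blast
    thus "z \<in> Z2" using yt(3) by (simp add: algebra_simps)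
  qed
  have Q_Z2: "y \<in> Z2" if y: "y \<in> Q" for y
  proof (rule unramified_descent[OF _ _ _ _ _ Z2 \<open>Q \<inter> E \<subseteq> Z2\<close> _ y])
    show "\<exists>x'\<in>OL. x * x' \<in> OL \<and> x * x' \<notin> Q" if "x \<in> OL" "x \<notin> Q" for x
      using that by (intro bexI[of _ 1]) simp_all
    show "\<exists>x\<in>OL. \<sigma> x - x \<notin> Q" if "\<sigma> \<in> DG" "\<exists>x\<in>OL. \<sigma> x \<noteq> x" for \<sigma>
      using trivial[OF DG_G[OF that(1)]] that(2) by blast
    show "y \<in> OL" using y by (rule Q_OL)
  qed simp_all
  have Q2_Z3: "x \<in> Z3" if "x \<in> ideal_prod (ring_of_integers L) Q Q" for x
    using that
  proof (induction x rule: ideal_prod.induct)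
    case (prod i j)
    from Q_Z2[OF prod(2)] obtain s q where *: "s \<in> OL - Q" "\<And>z. z \<in> Y' \<Longrightarrow> q z \<in> OL"
      "s * j = (\<Sum>z\<in>Y'. q z * z)" unfolding Z2_def by blast
    have "s * (i * j) = i * (s * j)" by (simp add: algebra_simps)
    also have "\<dots> = (\<Sum>z\<in>Y'. (i * q z) * z)" unfolding *(3) by (simp add: sum_distrib_left algebra_simps)
    finally have "s * (i * j) = (\<Sum>z\<in>Y'. (i * q z) * z)" .
    moreover have "i * q z \<in> Q" if "z \<in> Y'" for z by (rule Q_mult'[OF prod(1) *(2)[OF that]])
    ultimately have "i * j \<in> Z3" unfolding Z3_def using *(1)
      by (intro CollectI bexI[of _ s] exI[of _ "\<lambda>z. i * q z"]) simp_all
    thus ?case by simp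
  next
    case (sum s1 s2)
    thus ?case using local_idealD(2)[OF Z3, of s1 s2] by simp
  qed
  have "of_nat res_char = (0 :: complex)"
  proof (rule nakayama[OF Y'(1)])
    fix y assume "y \<in> Y'"
    hence "y \<in> Z3" using Q2_Z3 sub Y'(2) by blast
    thus "\<exists>s\<in>OL - Q. \<exists>q. (\<forall>z\<in>Y'. q z \<in> Q) \<and> s * y = (\<Sum>z\<in>Y'. q z * z)" by (simp add: Z3_def)
  qed (simp add: Y'_def)
  thus False using prime_res_char by (auto dest: prime_gt_0_nat)
qed

lemma ideal_prod_mono:
  "I \<subseteq> I' \<Longrightarrow> J \<subseteq> J' \<Longrightarrow> ideal_prod R I J \<subseteq> ideal_prod R I' J'"
proof
  fix x assume *: "I \<subseteq> I'" "J \<subseteq> J'" "x \<in> ideal_prod R I J"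
  from *(3) show "x \<in> ideal_prod R I' J'"
    by (induction rule: ideal_prod.induct) (use * in \<open>auto intro: ideal_prod.intros\<close>)
qed

text \<open>All powers from the second on lie in \<open>Q^2\<close>, so the set of exponents is
  bounded by 1 and its greatest element is meaningful.\<close>

lemma ramification_index_eq_1:
  assumes "\<not> Q \<inter> E \<subseteq> ideal_prod (ring_of_integers L) Q Q"
  shows "ramification_index L Q (Q \<inter> E) = 1"
proof -
  let ?O = "ring_of_integers L"
  let ?pow = "\<lambda>n::nat. Q [^]\<^bsub>ideals_set ?O\<^esub> n"
  interpret R: cring ?O by (rule cring_ring_of_integers)
  have pow_0: "?pow 0 = OL" and pow_Suc: "?pow (Suc n) = ideal_prod ?O (?pow n) Q" for n
    by (simp_all add: nat_pow_def ideals_set_def)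
  have ideal_OL: "ideal OL ?O" by (rule R.oneideal)
  have Suc_sub: "?pow (Suc n) \<subseteq> Q" for n
  proof (induction n)
    case 0
    show ?case unfolding pow_Suc pow_0 using R.ideal_prod_inter[OF ideal_OL ideal_Q] by blast
  next
    case (Suc n)
    have "?pow (Suc (Suc n)) \<subseteq> ideal_prod ?O Q Q"
      unfolding pow_Suc[of "Suc n"] by (rule ideal_prod_mono[OF Suc.IH]) simp
    thus ?case using R.ideal_prod_inter[OF ideal_Q ideal_Q] by blast
  qed
  have two: "?pow (Suc (Suc n)) \<subseteq> ideal_prod ?O Q Q" for n
    unfolding pow_Suc[of "Suc n"] by (rule ideal_prod_mono[OF Suc_sub]) simp
  have one: "Q \<subseteq> ?pow 1"
  proof
    fix x assume x: "x \<in> Q"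
    have "1 \<otimes>\<^bsub>?O\<^esub> x \<in> ideal_prod ?O OL Q" by (rule ideal_prod.prod) (use x in simp_all)
    thus "x \<in> ?pow 1" using pow_Suc[of 0] pow_0 by simp
  qed
  have sub_OL: "Q \<inter> E \<subseteq> OL" using Q_OL by blast
  have gen: "Q \<inter> E \<subseteq> Idl\<^bsub>?O\<^esub> (Q \<inter> E)" by (rule R.genideal_self[OF sub_OL])
  show ?thesis
    unfolding ramification_index_def
  proof (rule Greatest_equality)
    have "Idl\<^bsub>?O\<^esub> (Q \<inter> E) \<subseteq> Q" by (rule R.genideal_minimal[OF ideal_Q]) simp
    thus "Idl\<^bsub>?O\<^esub> (Q \<inter> E) \<subseteq> ?pow 1" using one by blast
  next
    fix n assume n: "Idl\<^bsub>?O\<^esub> (Q \<inter> E) \<subseteq> ?pow n"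
    show "n \<le> 1"
    proof (rule ccontr)
      assume "\<not> n \<le> 1"
      then obtain m where "n = Suc (Suc m)" by (metis One_nat_def not_less_eq_eq old.nat.exhaust le0)
      thus False using n gen two[of m] assms by blast
    qed
  qed
qed

end

section \<open>Quadratic extensions in coordinates\<close>

definition adjoin :: "complex \<Rightarrow> complex set \<Rightarrow> complex set" where
  "adjoin \<delta> F = {x + y * \<delta> | x y. x \<in> F \<and> y \<in> F}"

lemma adjoinI: "x \<in> F \<Longrightarrow> y \<in> F \<Longrightarrow> x + y * \<delta> \<in> adjoin \<delta> F"
  by (auto simp: adjoin_def)

lemma adjoinE:
  assumes "z \<in> adjoin \<delta> F"
  obtains x y where "x \<in> F" "y \<in> F" "z = x + y * \<delta>"
  using assms by (auto simp: adjoin_def)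

lemma adjoin_mono: "F \<subseteq> F' \<Longrightarrow> adjoin \<delta> F \<subseteq> adjoin \<delta> F'"
  by (auto simp: adjoin_def)

context complex_subfield
begin

lemma adjoin_eq_0_iff:
  assumes "\<delta> \<notin> L" "x \<in> L" "y \<in> L"
  shows "x + y * \<delta> = 0 \<longleftrightarrow> x = 0 \<and> y = 0"
proof
  assume eq: "x + y * \<delta> = 0"
  have "y = 0"
  proof (rule ccontr)
    assume "y \<noteq> 0"
    hence "\<delta> = - x / y" using eq by (simp add: field_simps eq_neg_iff_add_eq_0)
    thus False using assms by simp
  qed
  thus "x = 0 \<and> y = 0" using eq by simp
qed simp

lemma adjoin_unique:
  assumes "\<delta> \<notin> L" "x \<in> L" "y \<in> L" "x' \<in> L" "y' \<in> L" "x + y * \<delta> = x' + y' * \<delta>"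
  shows "x = x'" "y = y'"
  using adjoin_eq_0_iff[OF assms(1), of "x - x'" "y - y'"] assms by (simp_all add: algebra_simps)

lemma subset_adjoin: "L \<subseteq> adjoin \<delta> L"
  using adjoinI[of _ L 0] by fastforce

lemma subfield_adjoin:
  assumes "\<delta> \<notin> L" "\<delta>\<^sup>2 \<in> L"
  shows "subfield (adjoin \<delta> L) \<C>\<C>"
  unfolding subfield_CC_iff
proof (intro conjI ballI)
  show "1 \<in> adjoin \<delta> L" using subset_adjoin by auto
next
  fix z z' assume "z \<in> adjoin \<delta> L" "z' \<in> adjoin \<delta> L"
  then obtain x y x' y' where *: "x \<in> L" "y \<in> L" "z = x + y * \<delta>" "x' \<in> L" "y' \<in> L" "z' = x' + y' * \<delta>"
    by (elim adjoinE)
  have "z - z' = (x - x') + (y - y') * \<delta>" using * by (simp add: algebra_simps)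
  also have "\<dots> \<in> adjoin \<delta> L" by (rule adjoinI) (use * in simp_all)
  finally show "z - z' \<in> adjoin \<delta> L" .
  have "z * z' = (x * x' + y * y' * \<delta>\<^sup>2) + (x * y' + y * x') * \<delta>"
    using * by (simp add: algebra_simps power2_eq_square)
  also have "\<dots> \<in> adjoin \<delta> L" by (rule adjoinI) (use * assms in simp_all)
  finally show "z * z' \<in> adjoin \<delta> L" .
next
  fix z assume "z \<in> adjoin \<delta> L"
  then obtain x y where *: "x \<in> L" "y \<in> L" "z = x + y * \<delta>" by (elim adjoinE)
  show "inverse z \<in> adjoin \<delta> L"
  proof (cases "z = 0")
    case True
    thus ?thesis using subset_adjoin by auto
  next
    case False
    define N where "N = (x + y * \<delta>) * (x + (- y) * \<delta>)"
    have "x + (- y) * \<delta> \<noteq> 0" using False * adjoin_eq_0_iff[OF assms(1), of x "- y"] by auto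
    hence N0: "N \<noteq> 0" using False *(3) by (simp add: N_def)
    have "N = x\<^sup>2 - y\<^sup>2 * \<delta>\<^sup>2" by (simp add: N_def algebra_simps power2_eq_square)
    hence N: "N \<in> L" using * assms by simp
    have "z * (x / N + (- y / N) * \<delta>) = (x + y * \<delta>) * (x + (- y) * \<delta>) / N"
      unfolding *(3) using N0 by (simp add: field_simps)
    hence "inverse z = x / N + (- y / N) * \<delta>"
      using N0 by (intro inverse_unique) (simp add: N_def)
    also have "\<dots> \<in> adjoin \<delta> L" by (rule adjoinI) (use * N in simp_all)
    finally show ?thesis .
  qed
qed

lemma quadratic_ext_adjoin:
  assumes "\<delta> \<notin> L" "\<delta>\<^sup>2 \<in> L"
  shows "quadratic_ext L (adjoin \<delta> L)"
proof -
  have "ring.dimension \<C>\<C> (Suc 1) L (ring.line_extension \<C>\<C> L \<delta> L)"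
    by (rule ring.Suc_dim[OF ring_CC _ assms(1) ring.dimension_one[OF ring_CC subfield_L]]) simp
  moreover have "ring.line_extension \<C>\<C> L \<delta> L = adjoin \<delta> L"
    unfolding set_eq_iff ring.line_extension_mem_iff[OF ring_CC] adjoin_def
    by (simp add: add.commute[of "_ * \<delta>"]) blast
  ultimately show ?thesis
    using subfield_L subfield_adjoin[OF assms] subset_adjoin
    by (simp add: quadratic_ext_def field_ext_def numeral_2_eq_2)
qed

end

section \<open>Twisting by an imaginary quadratic field\<close>

text \<open>\<open>\<delta> \<notin> K\<close> makes 1 and \<open>\<delta>\<close> independent over
  \<open>K\<close>, so every automorphism of \<open>K\<close> extends to the compositum with
  \<open>\<delta>\<close> fixed. The sign of \<open>d\<close> makes complex conjugation the
  nontrivial automorphism of \<open>quad\<close>.\<close>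

locale quadratic_twist = finite_galois \<rat> K for K +
  fixes \<delta> :: complex and d :: int
  assumes \<delta>_square: "\<delta>\<^sup>2 = of_int d" and d_neg: "d < 0" and \<delta>_notin: "\<delta> \<notin> K"
begin

abbreviation "quad \<equiv> adjoin \<delta> \<rat>"
abbreviation "twist \<equiv> adjoin \<delta> K"

lemma \<delta>_not_Rats: "\<delta> \<notin> \<rat>"
  using \<delta>_notin E_subset by blast

lemma \<delta>_square_Rats: "\<delta>\<^sup>2 \<in> \<rat>"
  by (simp add: \<delta>_square)

lemma subfield_quad: "subfield quad \<C>\<C>"
  by (rule complex_subfield.subfield_adjoin[OF subfield_E \<delta>_not_Rats \<delta>_square_Rats])

lemma subfield_twist: "subfield twist \<C>\<C>"
  by (rule subfield_adjoin[OF \<delta>_notin]) (simp add: \<delta>_square)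

sublocale Quad: complex_subfield quad
  by (rule complex_subfield.intro[OF subfield_quad])

sublocale Twist: complex_subfield twist
  by (rule complex_subfield.intro[OF subfield_twist])

lemma quad_subset: "quad \<subseteq> twist"
  by (rule adjoin_mono[OF E_subset])

lemma \<delta>_quad [simp]: "\<delta> \<in> quad"
  using adjoinI[of 0 \<rat> 1 \<delta>] by simp

lemma \<delta>_twist [simp]: "\<delta> \<in> twist"
  using quad_subset \<delta>_quad by blast

lemma K_twist: "x \<in> K \<Longrightarrow> x \<in> twist"
  using subset_adjoin by blast

lemma Rats_quad: "x \<in> \<rat> \<Longrightarrow> x \<in> quad"
  using complex_subfield.subset_adjoin[OF subfield_E] by blast

lemma quadratic_ext_quad: "quadratic_ext \<rat> quad"
  by (rule complex_subfield.quadratic_ext_adjoin[OF subfield_E \<delta>_not_Rats \<delta>_square_Rats])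

lemma compositum_eq: "compositum K quad = twist"
  unfolding compositum_def
proof
  show "generate_field \<C>\<C> (K \<union> quad) \<subseteq> twist"
    by (rule field.generate_field_min_subfield1[OF field_CC _ subfield_twist])
       (use K_twist quad_subset in auto)
  show "twist \<subseteq> generate_field \<C>\<C> (K \<union> quad)"
  proof
    fix z assume "z \<in> twist"
    then obtain x y where *: "x \<in> K" "y \<in> K" "z = x + y * \<delta>" by (elim adjoinE)
    have "x \<in> generate_field \<C>\<C> (K \<union> quad)" "y \<in> generate_field \<C>\<C> (K \<union> quad)"
      "\<delta> \<in> generate_field \<C>\<C> (K \<union> quad)"
      using * by (auto intro!: generate_field.incl)
    hence "x \<oplus>\<^bsub>\<C>\<C>\<^esub> (y \<otimes>\<^bsub>\<C>\<C>\<^esub> \<delta>) \<in> generate_field \<C>\<C> (K \<union> quad)"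
      by (intro generate_field.eng_add generate_field.eng_mult)
    thus "z \<in> generate_field \<C>\<C> (K \<union> quad)" using *(3) by simp
  qed
qed

definition coords :: "complex \<Rightarrow> complex \<times> complex" where
  "coords z = (SOME p. fst p \<in> K \<and> snd p \<in> K \<and> z = fst p + snd p * \<delta>)"

lemma coords_eq:
  assumes "x \<in> K" "y \<in> K"
  shows "coords (x + y * \<delta>) = (x, y)"
  unfolding coords_def
proof (rule some_equality)
  fix p assume p: "fst p \<in> K \<and> snd p \<in> K \<and> x + y * \<delta> = fst p + snd p * \<delta>"
  hence "x = fst p" "y = snd p"
    using adjoin_unique[OF \<delta>_notin assms, of "fst p" "snd p"] by blast+
  thus "p = (x, y)" by simp
qed (use assms in simp)

definition lift_aut :: "(complex \<Rightarrow> complex) \<Rightarrow> complex \<Rightarrow> complex" where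
  "lift_aut \<tau> = (\<lambda>z\<in>twist. \<tau> (fst (coords z)) + \<tau> (snd (coords z)) * \<delta>)"

lemma lift_aut_eq: "x \<in> K \<Longrightarrow> y \<in> K \<Longrightarrow> lift_aut \<tau> (x + y * \<delta>) = \<tau> x + \<tau> y * \<delta>"
  by (simp add: lift_aut_def coords_eq adjoinI)

lemma lift_aut_K: "\<tau> \<in> G \<Longrightarrow> x \<in> K \<Longrightarrow> lift_aut \<tau> x = \<tau> x"
  using lift_aut_eq[of x 0 \<tau>] by simp

lemma lift_aut_in: "\<tau> \<in> G \<Longrightarrow> lift_aut \<tau> \<in> carrier (galois_group twist quad)"
proof -
  assume \<tau>: "\<tau> \<in> G"
  have inverse: "lift_aut \<sigma>' (lift_aut \<sigma> z) = z"
    if "\<sigma> \<in> G" "\<And>x. x \<in> K \<Longrightarrow> \<sigma>' (\<sigma> x) = x" "z \<in> twist" for \<sigma> \<sigma>' z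
    using that(3)
  proof (rule adjoinE)
    fix x y assume "x \<in> K" "y \<in> K" "z = x + y * \<delta>"
    thus ?thesis using that(1,2) by (simp add: lift_aut_eq)
  qed
  have closed: "lift_aut \<sigma> z \<in> twist" if "\<sigma> \<in> G" "z \<in> twist" for \<sigma> z
    using that(2)
  proof (rule adjoinE)
    fix x y assume "x \<in> K" "y \<in> K" "z = x + y * \<delta>"
    thus ?thesis using that(1) by (simp add: lift_aut_eq adjoinI)
  qed
  show ?thesis
    unfolding galois_group_iff
  proof (intro conjI ballI)
    show "lift_aut \<tau> \<in> extensional twist" by (simp add: lift_aut_def)
    show "bij_betw (lift_aut \<tau>) twist twist"
      by (rule bij_betwI[where g = "lift_aut (inv_G \<tau>)"]) (use \<tau> inverse closed in auto)
    show "lift_aut \<tau> 1 = 1" using lift_aut_K[OF \<tau>, of 1] \<tau> by simp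
    show "lift_aut \<tau> z = z" if z: "z \<in> quad" for z
      using z
    proof (rule adjoinE)
      fix x y assume *: "x \<in> \<rat>" "y \<in> \<rat>" "z = x + y * \<delta>"
      hence "x \<in> K" "y \<in> K" using E_subset by auto
      thus ?thesis using * \<tau> by (simp add: lift_aut_eq)
    qed
  next
    fix z z' assume "z \<in> twist" "z' \<in> twist"
    then obtain x y x' y' where *: "x \<in> K" "y \<in> K" "z = x + y * \<delta>" "x' \<in> K" "y' \<in> K" "z' = x' + y' * \<delta>"
      by (elim adjoinE)
    have sum: "z + z' = (x + x') + (y + y') * \<delta>" using * by (simp add: algebra_simps)
    have "lift_aut \<tau> (z + z') = \<tau> (x + x') + \<tau> (y + y') * \<delta>"
      unfolding sum by (rule lift_aut_eq) (use * in simp_all)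
    also have "\<dots> = (\<tau> x + \<tau> y * \<delta>) + (\<tau> x' + \<tau> y' * \<delta>)"
      using * \<tau> by (simp add: algebra_simps)
    finally show "lift_aut \<tau> (z + z') = lift_aut \<tau> z + lift_aut \<tau> z'"
      using * by (simp add: lift_aut_eq)
    have prod: "z * z' = (x * x' + y * y' * of_int d) + (x * y' + y * x') * \<delta>"
      unfolding \<delta>_square[symmetric] using * by (simp add: algebra_simps power2_eq_square)
    have "lift_aut \<tau> (z * z') = \<tau> (x * x' + y * y' * of_int d) + \<tau> (x * y' + y * x') * \<delta>"
      unfolding prod by (rule lift_aut_eq) (use * in simp_all)
    also have "\<dots> = (\<tau> x * \<tau> x' + \<tau> y * \<tau> y' * \<delta>\<^sup>2) + (\<tau> x * \<tau> y' + \<tau> y * \<tau> x') * \<delta>"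
      using * \<tau> by (simp add: \<delta>_square)
    also have "\<dots> = (\<tau> x + \<tau> y * \<delta>) * (\<tau> x' + \<tau> y' * \<delta>)"
      by (simp add: algebra_simps power2_eq_square)
    finally show "lift_aut \<tau> (z * z') = lift_aut \<tau> z * lift_aut \<tau> z'"
      using * by (simp add: lift_aut_eq)
  qed
qed

text \<open>Normality of \<open>K\<close>: \<open>\<sigma>\<close> fixes the rational coefficients
  of the orbit polynomial of \<open>x\<close>, so \<open>\<sigma> x\<close> is one of its roots,
  which all lie in \<open>K\<close>. As \<open>\<sigma>\<close> also fixes \<open>\<delta>\<close>,
  its restriction determines it.\<close>

lemma restrict_aut_in:
  assumes \<sigma>: "\<sigma> \<in> carrier (galois_group twist quad)"
  shows "restrict \<sigma> K \<in> G" "lift_aut (restrict \<sigma> K) = \<sigma>"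
proof -
  have \<sigma>_ext: "\<sigma> \<in> extensional twist" and \<sigma>_bij: "bij_betw \<sigma> twist twist"
    and \<sigma>_add: "\<And>x y. x \<in> twist \<Longrightarrow> y \<in> twist \<Longrightarrow> \<sigma> (x + y) = \<sigma> x + \<sigma> y"
    and \<sigma>_mult: "\<And>x y. x \<in> twist \<Longrightarrow> y \<in> twist \<Longrightarrow> \<sigma> (x * y) = \<sigma> x * \<sigma> y"
    and \<sigma>_1: "\<sigma> 1 = 1" and \<sigma>_quad: "\<And>x. x \<in> quad \<Longrightarrow> \<sigma> x = x"
    using \<sigma> unfolding galois_group_iff by blast+
  have \<sigma>_poly: "\<sigma> (poly p x) = poly p (\<sigma> x) \<and> poly p x \<in> twist" if "\<And>i. coeff p i \<in> \<rat>" "x \<in> twist" for p x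
    using that(1)
  proof (induction p)
    case 0
    show ?case using \<sigma>_quad[of 0] by simp
  next
    case (pCons a p)
    have "coeff p i \<in> \<rat>" for i using pCons.prems[of "Suc i"] by simp
    moreover have a: "a \<in> \<rat>" using pCons.prems[of 0] by simp
    hence "a \<in> twist" "\<sigma> a = a" using Rats_quad \<sigma>_quad quad_subset by auto
    ultimately show ?case using pCons.IH that(2) \<sigma>_add \<sigma>_mult by simp
  qed
  have \<sigma>_K: "\<sigma> x \<in> K" if x: "x \<in> K" for x
  proof -
    have "poly (orbit_poly x) (\<sigma> x) = \<sigma> (poly (orbit_poly x) x)"
      using \<sigma>_poly[of "orbit_poly x" x] coeff_orbit_poly_E[OF x] K_twist[OF x] by simp
    also have "\<dots> = 0" using poly_orbit_poly_self[OF x] \<sigma>_quad[of 0] by simp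
    finally have "\<exists>\<tau>\<in>G. \<sigma> x - \<tau> x = 0" unfolding poly_orbit_poly by simp
    thus ?thesis using x by auto
  qed
  have \<sigma>_eq: "\<sigma> (x + y * \<delta>) = \<sigma> x + \<sigma> y * \<delta>" if "x \<in> K" "y \<in> K" for x y
    using that K_twist \<sigma>_add \<sigma>_mult \<sigma>_quad[of \<delta>] by simp
  have inj: "inj_on \<sigma> twist" and surj: "\<sigma> ` twist = twist"
    using \<sigma>_bij by (auto simp: bij_betw_def)
  have "bij_betw (restrict \<sigma> K) K K"
    unfolding bij_betw_def
  proof
    show "inj_on (restrict \<sigma> K) K"
      using inj K_twist by (auto simp: inj_on_def)
    show "restrict \<sigma> K ` K = K"
    proof
      show "restrict \<sigma> K ` K \<subseteq> K" using \<sigma>_K by auto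
      show "K \<subseteq> restrict \<sigma> K ` K"
      proof
        fix w assume w: "w \<in> K"
        then obtain z where z: "z \<in> twist" "w = \<sigma> z" using surj K_twist by blast
        from z(1) obtain x y where *: "x \<in> K" "y \<in> K" "z = x + y * \<delta>" by (elim adjoinE)
        have "w = \<sigma> x" by (rule adjoin_unique(1)[OF \<delta>_notin w zero_in, of _ "\<sigma> y"])
          (use * z \<sigma>_K \<sigma>_eq in simp_all)
        thus "w \<in> restrict \<sigma> K ` K" using * by auto
      qed
    qed
  qed
  thus "restrict \<sigma> K \<in> G"
    unfolding galois_group_iff using \<sigma>_add \<sigma>_mult \<sigma>_1 \<sigma>_quad Rats_quad K_twist E_subset by auto
  show "lift_aut (restrict \<sigma> K) = \<sigma>"
  proof (rule extensionalityI[OF _ \<sigma>_ext])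
    show "lift_aut (restrict \<sigma> K) \<in> extensional twist" by (simp add: lift_aut_def)
    fix z assume "z \<in> twist"
    then obtain x y where *: "x \<in> K" "y \<in> K" "z = x + y * \<delta>" by (elim adjoinE)
    thus "lift_aut (restrict \<sigma> K) z = \<sigma> z" using \<sigma>_eq by (simp add: lift_aut_eq)
  qed
qed

lemma restrict_lift_aut:
  assumes "\<tau> \<in> G"
  shows "restrict (lift_aut \<tau>) K = \<tau>"
proof (rule extensionalityI[of _ K])
  show "\<tau> \<in> extensional K" using assms by (rule G_extensional)
  show "restrict (lift_aut \<tau>) K x = \<tau> x" if "x \<in> K" for x
    using that lift_aut_K[OF assms that] by simp
qed simp

lemma galois_group_twist_iso: "galois_group twist quad \<cong> galois_group K \<rat>"
proof (rule is_isoI, rule isoI)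
  show "(\<lambda>\<sigma>. restrict \<sigma> K) \<in> hom (galois_group twist quad) (galois_group K \<rat>)"
  proof (rule homI)
    fix \<sigma> \<sigma>' assume *: "\<sigma> \<in> carrier (galois_group twist quad)" "\<sigma>' \<in> carrier (galois_group twist quad)"
    have "\<sigma>' x \<in> K" if "x \<in> K" for x
      using G_in[OF restrict_aut_in(1)[OF *(2)] that] that by simp
    hence "restrict (compose twist \<sigma> \<sigma>') K = compose K (restrict \<sigma> K) (restrict \<sigma>' K)"
      using K_twist by (auto simp: fun_eq_iff compose_def)
    thus "restrict (\<sigma> \<otimes>\<^bsub>galois_group twist quad\<^esub> \<sigma>') K =
        restrict \<sigma> K \<otimes>\<^bsub>galois_group K \<rat>\<^esub> restrict \<sigma>' K"
      using * restrict_aut_in(1) by (simp add: galois_group_mult)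
  qed (rule restrict_aut_in(1))
  show "bij_betw (\<lambda>\<sigma>. restrict \<sigma> K) (carrier (galois_group twist quad)) (carrier (galois_group K \<rat>))"
    by (rule bij_betwI[where g = lift_aut])
       (use restrict_aut_in lift_aut_in restrict_lift_aut in auto)
qed

text \<open>A generating list of \<open>K\<close> over the rationals also spans \<open>twist\<close>
  over \<open>quad\<close>, since multiplication by \<open>\<delta>\<close> is a scalar
  there.\<close>

lemma finite_dimension_twist: "ring.finite_dimension \<C>\<C> quad twist"
proof -
  have "ring.finite_dimension \<C>\<C> \<rat> K"
    using galois by (simp only: finite_galois_ext_def)
  then obtain n where n: "ring.dimension \<C>\<C> n \<rat> K"
    by (simp only: ring.finite_dimension_def[OF ring_CC]) (erule exE)
  obtain Us where Us: "ring.Span \<C>\<C> \<rat> Us = K"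
    using ring.exists_base[OF ring_CC complex_subfield.subfield_L[OF subfield_E] n] by (elim exE conjE)
  have carr: "set Us \<subseteq> carrier \<C>\<C>" by simp
  have Us_K: "set Us \<subseteq> K"
    using ring.Span_base_incl[OF ring_CC complex_subfield.subfield_L[OF subfield_E] carr] Us by simp
  have sub: "subgroup (ring.Span \<C>\<C> quad Us) (add_monoid \<C>\<C>)"
    by (rule ring.Span_is_add_subgroup[OF ring_CC subfield_quad carr])
  have "\<rat> <#>\<^bsub>\<C>\<C>\<^esub> set Us \<subseteq> quad <#>\<^bsub>\<C>\<C>\<^esub> set Us"
    unfolding set_mult_def using Rats_quad by blast
  also have "\<dots> \<subseteq> ring.Span \<C>\<C> quad Us"
    by (rule ring.Span_incl[OF ring_CC subfield_quad carr])
  finally have "ring.Span \<C>\<C> \<rat> Us \<subseteq> ring.Span \<C>\<C> quad Us"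
    by (rule ring.Span_min[OF ring_CC complex_subfield.subfield_L[OF subfield_E] carr sub])
  hence K_sub: "x \<in> ring.Span \<C>\<C> quad Us" if "x \<in> K" for x using Us that by blast
  have "twist \<subseteq> ring.Span \<C>\<C> quad Us"
  proof
    fix z assume "z \<in> twist"
    then obtain x y where *: "x \<in> K" "y \<in> K" "z = x + y * \<delta>" by (elim adjoinE)
    have "\<delta> \<otimes>\<^bsub>\<C>\<C>\<^esub> y \<in> ring.Span \<C>\<C> quad Us"
      by (rule ring.Span_smult_closed[OF ring_CC subfield_quad carr \<delta>_quad K_sub[OF *(2)]])
    hence "x \<oplus>\<^bsub>\<C>\<C>\<^esub> (\<delta> \<otimes>\<^bsub>\<C>\<C>\<^esub> y) \<in> ring.Span \<C>\<C> quad Us"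
      by (rule ring.Span_subgroup_props(3)[OF ring_CC subfield_quad carr K_sub[OF *(1)]])
    thus "z \<in> ring.Span \<C>\<C> quad Us" using *(3) by (simp add: mult.commute)
  qed
  moreover have "ring.Span \<C>\<C> quad Us \<subseteq> twist"
  proof (rule ring.Span_min[OF ring_CC subfield_quad carr])
    show "subgroup twist (add_monoid \<C>\<C>)"
      by (rule subring.axioms(1)[OF subfieldE(1)[OF subfield_twist]])
    show "quad <#>\<^bsub>\<C>\<C>\<^esub> set Us \<subseteq> twist"
      unfolding set_mult_def using Us_K K_twist quad_subset by auto
  qed
  ultimately have "twist = ring.Span \<C>\<C> quad Us" by blast
  thus ?thesis using ring.Span_finite_dimension[OF ring_CC subfield_quad carr] by simp
qed

lemma finite_galois_ext_twist: "finite_galois_ext quad twist"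
proof -
  have "z \<in> quad" if z: "z \<in> twist" "\<And>\<sigma>. \<sigma> \<in> carrier (galois_group twist quad) \<Longrightarrow> \<sigma> z = z" for z
  proof -
    from z(1) obtain x y where *: "x \<in> K" "y \<in> K" "z = x + y * \<delta>" by (elim adjoinE)
    have "\<tau> x = x \<and> \<tau> y = y" if \<tau>: "\<tau> \<in> G" for \<tau>
    proof -
      have eq: "\<tau> x + \<tau> y * \<delta> = x + y * \<delta>"
        using z(2)[OF lift_aut_in[OF \<tau>]] * by (simp add: lift_aut_eq)
      have in_K: "\<tau> x \<in> K" "\<tau> y \<in> K" using * \<tau> by simp_all
      show ?thesis using adjoin_unique[OF \<delta>_notin in_K *(1,2) eq] by blast
    qed
    hence "x \<in> \<rat>" "y \<in> \<rat>" using * by (auto intro!: fixed_imp_in_E)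
    thus ?thesis using *(3) by (simp add: adjoinI)
  qed
  moreover have "\<sigma> z = z" if "z \<in> quad" "\<sigma> \<in> carrier (galois_group twist quad)" for z \<sigma>
    using that unfolding galois_group_iff by blast
  ultimately have "{x \<in> twist. \<forall>\<sigma>\<in>carrier (galois_group twist quad). \<sigma> x = x} = quad"
    using quad_subset by blast
  thus ?thesis
    using subfield_quad subfield_twist quad_subset finite_dimension_twist
    by (simp add: finite_galois_ext_def field_ext_def)
qed

lemma finite_galois_twist: "finite_galois quad twist"
proof
  show "finite (carrier (galois_group twist quad))"
    unfolding iso_finite[OF galois_group_twist_iso] by (rule finite_G)
qed (rule finite_galois_ext_twist)

lemma d_ne_0: "(of_int d :: complex) \<noteq> 0"
  using d_neg by simp

lemma cnj_\<delta>: "cnj \<delta> = - \<delta>"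
proof -
  have "Re (\<delta>\<^sup>2) < 0" "Im (\<delta>\<^sup>2) = 0" unfolding \<delta>_square using d_neg by simp_all
  hence *: "(Re \<delta>)\<^sup>2 < (Im \<delta>)\<^sup>2" "Re \<delta> = 0 \<or> Im \<delta> = 0"
    by (simp_all add: Re_power2 Im_power2)
  have "Re \<delta> = 0"
  proof (rule ccontr)
    assume "Re \<delta> \<noteq> 0"
    hence "(Re \<delta>)\<^sup>2 < 0" using * by simp
    thus False by (simp add: not_less)
  qed
  thus ?thesis by (simp add: complex_eq_iff)
qed

lemma cnj_Rats: "x \<in> \<rat> \<Longrightarrow> cnj x = (x :: complex)"
  by (erule Rats_cases') simp

lemma algebraic_int_\<delta>: "algebraic_int \<delta>"
  by (rule algebraic_int_square_root) (simp add: \<delta>_square)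

text \<open>The traces of \<open>z\<close> and of \<open>z * \<delta>\<close> are rational algebraic
  integers, hence integers. They determine both coordinates up to the common denominator
  \<open>2 * d\<close>.\<close>

lemma quad_integer_form:
  assumes z: "z \<in> quad" "algebraic_int z"
  shows "\<exists>a b::int. 2 * of_int d * z = of_int a * of_int d + of_int b * \<delta>"
proof -
  from z(1) obtain x y where *: "x \<in> \<rat>" "y \<in> \<rat>" "z = x + y * \<delta>" by (elim adjoinE)
  have cnj_z: "cnj z = x - y * \<delta>" using * by (simp add: cnj_Rats cnj_\<delta>)
  have "z + cnj z \<in> \<int>"
  proof (rule rational_algebraic_int_is_int)
    show "algebraic_int (z + cnj z)" using z(2) by (intro algebraic_int_add algebraic_int_cnj)
    show "z + cnj z \<in> \<rat>" unfolding cnj_z using * by simp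
  qed
  then obtain a where a: "2 * x = of_int a" using *(3) cnj_z by (auto elim: Ints_cases)
  have "z - cnj z = 2 * y * \<delta>" unfolding cnj_z using *(3) by simp
  hence "(z - cnj z) * \<delta> = 2 * y * \<delta>\<^sup>2" by (simp add: power2_eq_square)
  hence eq: "(z - cnj z) * \<delta> = 2 * y * of_int d" unfolding \<delta>_square .
  have "(z - cnj z) * \<delta> \<in> \<int>"
  proof (rule rational_algebraic_int_is_int)
    show "algebraic_int ((z - cnj z) * \<delta>)"
      using z algebraic_int_\<delta> by (intro algebraic_int_mult algebraic_int_diff) auto
    show "(z - cnj z) * \<delta> \<in> \<rat>" unfolding eq using * by simp
  qed
  then obtain b where b: "2 * y * of_int d = of_int b" unfolding eq by (auto elim: Ints_cases)
  have "2 * of_int d * z = (2 * x) * of_int d + (2 * y * of_int d) * \<delta>"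
    using *(3) by (simp add: algebra_simps)
  thus ?thesis unfolding a b by blast
qed

text \<open>Finiteness of the ring of integers of \<open>quad\<close> modulo \<open>m\<close>, by
  sorting the integral coordinates into residue classes. It supplies the finite generating set for
  Nakayama's lemma.\<close>

lemma finite_representatives:
  assumes W: "W \<subseteq> {z \<in> quad. algebraic_int z}" and m: "m > 0"
  shows "\<exists>Y. finite Y \<and> Y \<subseteq> W \<and> (\<forall>z\<in>W. \<exists>y\<in>Y. \<exists>t. t \<in> quad \<and> algebraic_int t \<and> z - y = of_nat m * t)"
proof -
  have "\<forall>z\<in>W. \<exists>a b::int. 2 * of_int d * z = of_int a * of_int d + of_int b * \<delta>"
    using quad_integer_form W by blast
  then obtain a b :: "complex \<Rightarrow> int" where ab: "\<And>z. z \<in> W \<Longrightarrow>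
      2 * of_int d * z = of_int (a z) * of_int d + of_int (b z) * \<delta>" by metis
  \<comment> \<open>The factor \<open>2 * d\<close> compensates the denominator of the coordinates,
    \<open>m\<close> is the actual modulus, and the sign makes \<open>M\<close> positive.\<close>
  define M where "M = - 2 * d * int m"
  have M: "M > 0" using d_neg m by (simp add: M_def mult_pos_neg mult_neg_pos)
  define f where "f = (\<lambda>z. (a z mod M, b z mod M))"
  have "f ` W \<subseteq> {0..<M} \<times> {0..<M}" using M by (auto simp: f_def)
  hence fin: "finite (f ` W)" by (rule finite_subset) simp
  show ?thesis
  proof (intro exI[of _ "inv_into W f ` (f ` W)"] conjI ballI)
    show "finite (inv_into W f ` f ` W)" using fin by (rule finite_imageI)
    show "inv_into W f ` f ` W \<subseteq> W" by (auto intro: inv_into_into)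
    fix z assume z: "z \<in> W"
    define y where "y = inv_into W f (f z)"
    have y: "y \<in> W" "f y = f z" using z by (auto simp: y_def inv_into_into f_inv_into_f)
    have "M dvd a z - a y" "M dvd b z - b y"
      using y(2) by (auto simp: f_def mod_eq_dvd_iff[symmetric])
    then obtain k l where kl: "a z - a y = M * k" "b z - b y = M * l" by (auto elim!: dvdE)
    define t where "t = - (of_int k * of_int d + of_int l * \<delta>)"
    have "2 * of_int d * (z - y) = of_int (a z - a y) * of_int d + of_int (b z - b y) * \<delta>"
      using ab[OF z] ab[OF y(1)] by (simp add: algebra_simps)
    also have "\<dots> = 2 * of_int d * (of_nat m * t)"
      unfolding kl t_def M_def by (simp add: algebra_simps)
    finally have "z - y = of_nat m * t" using d_ne_0 by simp
    moreover have "t \<in> quad" unfolding t_def by simp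
    moreover have "algebraic_int t" unfolding t_def using algebraic_int_\<delta> by auto
    ultimately show "\<exists>y\<in>inv_into W f ` f ` W. \<exists>t. t \<in> quad \<and> algebraic_int t \<and> z - y = of_nat m * t"
      using z unfolding y_def by blast
  qed
qed

text \<open>A real embedding would send \<open>\<delta>\<close> to a real number with negative
  square.\<close>

lemma quad_not_real: "v \<in> infinite_primes quad \<Longrightarrow> \<not> real_prime quad v"
proof
  assume "v \<in> infinite_primes quad" "real_prime quad v"
  then obtain \<sigma> where \<sigma>: "\<sigma> \<in> embeddings quad" "\<sigma> ` quad \<subseteq> \<real>"
    by (auto simp: infinite_primes_def real_prime_def)
  have \<sigma>_add: "\<sigma> (x + y) = \<sigma> x + \<sigma> y" and \<sigma>_mult: "\<sigma> (x * y) = \<sigma> x * \<sigma> y" if "x \<in> quad" "y \<in> quad" for x y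
    using \<sigma>(1) that by (auto simp: embeddings_def Ring.ring_hom_def)
  have \<sigma>_1: "\<sigma> 1 = 1" using \<sigma>(1) by (auto simp: embeddings_def Ring.ring_hom_def)
  have \<sigma>_0: "\<sigma> 0 = 0" using \<sigma>_add[of 0 0] by simp
  have \<sigma>_nat: "\<sigma> (of_nat n) = of_nat n" for n
    by (induction n) (simp_all add: \<sigma>_0 \<sigma>_1 \<sigma>_add)
  define n where "n = nat (- d)"
  have n: "of_int d = - (of_nat n :: complex)" "n > 0" using d_neg by (auto simp: n_def)
  have "0 = \<sigma> (\<delta>\<^sup>2 + of_nat n)" using \<delta>_square n(1) \<sigma>_0 by simp
  also have "\<dots> = (\<sigma> \<delta>)\<^sup>2 + of_nat n"
    by (simp add: \<sigma>_add \<sigma>_mult \<sigma>_nat power2_eq_square)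
  finally have "(\<sigma> \<delta>)\<^sup>2 = - of_nat n" by (simp add: eq_neg_iff_add_eq_0)
  moreover have "\<sigma> \<delta> \<in> \<real>" using \<sigma>(2) \<delta>_quad by blast
  then obtain r where "\<sigma> \<delta> = of_real r" by (rule Reals_cases)
  ultimately have "complex_of_real (r\<^sup>2) = complex_of_real (- real n)" by simp
  hence "r\<^sup>2 = - real n" by (simp only: of_real_eq_iff)
  thus False using n(2) by (smt (verit) of_nat_0_less_iff zero_le_power2)
qed

lemma prime_below:
  assumes Q: "Q \<in> finite_primes twist"
  shows "Q \<inter> K \<in> finite_primes K"
proof -
  interpret T: prime_of_subfield twist Q
    by (intro prime_of_subfield.intro Twist.complex_subfield_axioms prime_of_subfield_axioms.intro Q)
  have OL: "x \<in> Twist.OL" if "x \<in> OL" for x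
    using that K_twist by (simp add: OL_iff Twist.OL_iff)
  have p: "of_nat T.res_char \<in> Q \<inter> K" "(of_nat T.res_char :: complex) \<noteq> 0"
    using T.res_char_in_Q T.prime_res_char by (auto dest: prime_gt_0_nat)
  show ?thesis
    unfolding finite_primes_iff
  proof (intro conjI ballI impI)
    show "Q \<inter> K \<subseteq> OL" using T.Q_OL by (auto simp: OL_iff Twist.OL_iff)
    show "Q \<inter> K \<noteq> {0}" using p by blast
    show "a * x \<in> Q \<inter> K" if "x \<in> Q \<inter> K" "a \<in> OL" for x a
      using that T.Q_mult[of x a] OL[of a] by auto
    show "x \<in> Q \<inter> K \<or> y \<in> Q \<inter> K" if "x \<in> OL" "y \<in> OL" "x * y \<in> Q \<inter> K" for x y
      using that T.Q_prime[of x y] OL by auto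
    show "x + y \<in> Q \<inter> K" if "x \<in> Q \<inter> K" "y \<in> Q \<inter> K" for x y
      using that T.Q_add[of x y] by auto
  qed auto
qed

text \<open>As \<open>\<sigma>\<close> fixes \<open>\<delta>\<close>, a nontrivial
  \<open>\<sigma>\<close> restricts to a nontrivial inertia element \<open>\<tau>\<close> of
  \<open>K\<close> at \<open>P\<close>, so it negates \<open>W = w * \<delta>\<close>, where
  \<open>W^2 = d * w^2\<close>. Away from 2, \<open>W\<close> is integral and
  \<open>\<sigma> W - W = - 2 * W\<close> is outside \<open>Q\<close>.\<close>

lemma inertia_twist_trivial:
  assumes kummer: "\<And>P \<tau>. P \<in> finite_primes K \<Longrightarrow> \<tau> \<in> G \<Longrightarrow> \<exists>x\<in>K. \<tau> x \<noteq> x \<Longrightarrow>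
      (\<And>x. x \<in> OL \<Longrightarrow> \<tau> x - x \<in> P) \<Longrightarrow> \<exists>w\<in>K. \<tau> w = - w \<and>
        (if 2 \<in> P then \<exists>b\<in>OL - P. \<tau> b = b \<and> (\<exists>c\<in>OL. b * (of_int d * w\<^sup>2 - 1) = 4 * c)
         else of_int d * w\<^sup>2 \<in> OL - P)"
    and Q: "Q \<in> finite_primes twist"
    and \<sigma>: "\<sigma> \<in> carrier (galois_group twist quad)" "\<And>x. x \<in> Twist.OL \<Longrightarrow> \<sigma> x - x \<in> Q"
    and x: "x \<in> twist"
  shows "\<sigma> x = x"
proof (rule ccontr)
  assume nontrivial: "\<sigma> x \<noteq> x"
  interpret T: galois_prime quad twist Q
    by (intro galois_prime.intro finite_galois_twist prime_of_subfield.intro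
        Twist.complex_subfield_axioms prime_of_subfield_axioms.intro Q)
  define \<tau> where "\<tau> = restrict \<sigma> K"
  define P where "P = Q \<inter> K"
  have \<tau>_G: "\<tau> \<in> G" and \<sigma>_eq: "lift_aut \<tau> = \<sigma>"
    using restrict_aut_in[OF \<sigma>(1)] by (simp_all add: \<tau>_def)
  have P: "P \<in> finite_primes K" unfolding P_def by (rule prime_below[OF Q])
  interpret P: prime_of_subfield K P
    by (intro prime_of_subfield.intro complex_subfield_axioms prime_of_subfield_axioms.intro P)
  have OL: "y \<in> Twist.OL" if "y \<in> OL" for y
    using that K_twist by (simp add: OL_iff Twist.OL_iff)
  have \<tau>_nontrivial: "\<exists>y\<in>K. \<tau> y \<noteq> y"
  proof (rule ccontr)
    assume no: "\<not> (\<exists>y\<in>K. \<tau> y \<noteq> y)"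
    from x obtain y z where *: "y \<in> K" "z \<in> K" "x = y + z * \<delta>" by (elim adjoinE)
    have "\<sigma> x = \<tau> y + \<tau> z * \<delta>" unfolding \<sigma>_eq[symmetric] *(3) by (rule lift_aut_eq) (use * in simp_all)
    thus False using no * nontrivial by simp
  qed
  have \<tau>_inertia: "\<tau> y - y \<in> P" if y: "y \<in> OL" for y
  proof -
    have "\<sigma> y - y \<in> Q" by (rule \<sigma>(2)) (rule OL[OF y])
    moreover have "\<sigma> y = \<tau> y" using y by (simp add: \<tau>_def OL_iff)
    moreover have "\<tau> y - y \<in> K" using \<tau>_G y by simp
    ultimately show ?thesis by (simp add: P_def)
  qed
  obtain w where w: "w \<in> K" "\<tau> w = - w"
    and w_cases: "if 2 \<in> P then \<exists>b\<in>OL - P. \<tau> b = b \<and> (\<exists>c\<in>OL. b * (of_int d * w\<^sup>2 - 1) = 4 * c)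
         else of_int d * w\<^sup>2 \<in> OL - P"
    using kummer[OF P \<tau>_G \<tau>_nontrivial \<tau>_inertia] by blast
  define W where "W = w * \<delta>"
  have W2: "W\<^sup>2 = of_int d * w\<^sup>2" by (simp add: W_def power_mult_distrib \<delta>_square)
  have W_twist: "W \<in> twist" using adjoinI[of 0 K w \<delta>] w by (simp add: W_def)
  have \<sigma>_W: "\<sigma> W = - W"
    using lift_aut_eq[of 0 w \<tau>] w \<tau>_G unfolding \<sigma>_eq W_def by simp
  have \<sigma>_K: "\<sigma> y = \<tau> y" if "y \<in> K" for y using that by (simp add: \<tau>_def)
  show False
  proof (cases "2 \<in> P")
    case False
    hence v: "W\<^sup>2 \<in> OL - P" using w_cases unfolding W2 by simp
    hence W_OL: "W \<in> Twist.OL"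
      using W_twist algebraic_int_square_root[of W] by (simp add: OL_iff Twist.OL_iff)
    have "W\<^sup>2 \<notin> Q" using v by (auto simp: P_def)
    hence "W \<notin> Q" using T.Q_power_iff[OF W_OL, of 2] by simp
    moreover have "2 \<notin> Q" using False by (simp add: P_def)
    moreover have "\<sigma> W - W \<in> Q" by (rule \<sigma>(2)) (rule W_OL)
    hence "- (2 * W) \<in> Q" unfolding \<sigma>_W by simp
    hence "2 * W \<in> Q" by (simp only: T.Q_minus_iff)
    ultimately show False using T.Q_prime[of 2 W] W_OL by simp
  next
    case True
    then obtain b c where bc: "b \<in> OL - P" "c \<in> OL" "b * (W\<^sup>2 - 1) = 4 * c" and \<tau>_b: "\<tau> b = b"
      using w_cases unfolding W2 by auto
    \<comment> \<open>\<open>b\<close> clears the local denominator of \<open>(1 + W) / 2\<close>: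
      from \<open>b * (W^2 - 1) = 4 * c\<close> follows \<open>t^2 = b * t + b * c\<close>. Because
      \<open>\<tau>\<close> fixes \<open>b\<close>, the difference \<open>\<sigma> t - t\<close> is
      \<open>- b * W\<close>.\<close>
    define t where "t = b * (1 + W) / 2"
    have "t\<^sup>2 = b * t + b * (b * (W\<^sup>2 - 1)) / 4"
      by (simp add: t_def power2_eq_square field_simps)
    also have "\<dots> = b * t + b * c" unfolding bc(3) by simp
    finally have "algebraic_int t"
      using bc by (intro algebraic_int_quadratic[of b "b * c" t]) (auto simp: OL_iff)
    moreover have b_twist: "b \<in> twist" using bc K_twist by (simp add: OL_iff)
    hence "t \<in> twist" using W_twist by (simp add: t_def)
    ultimately have "t \<in> Twist.OL" by (simp add: Twist.OL_iff)
    hence "\<sigma> t - t \<in> Q" by (rule \<sigma>(2))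
    moreover have "\<sigma> b = b" using \<tau>_b bc by (simp add: \<tau>_def OL_iff)
    hence "\<sigma> t = b * (1 - W) / 2"
      using \<sigma>(1) b_twist W_twist \<sigma>_W by (simp add: t_def)
    hence "\<sigma> t - t = - (b * W)" by (simp add: t_def algebra_simps add_divide_distrib diff_divide_distrib)
    ultimately have bW_Q: "b * W \<in> Q" by (simp only: T.Q_minus_iff)
    have "(b * W)\<^sup>2 = b * (b * (W\<^sup>2 - 1) + b)" by (simp add: power2_eq_square algebra_simps)
    hence bW2: "(b * W)\<^sup>2 = b * (4 * c + b)" unfolding bc(3) .
    have "2 * (2 * c) \<in> P" by (rule P.Q_mult'[OF True]) (use bc in simp)
    hence "4 * c + b \<notin> P" using P.Q_diff_iff[of "4 * c + b" b] bc by simp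
    hence "b * (4 * c + b) \<notin> P" using bc by (intro P.notin_mult) simp_all
    moreover have "b * (4 * c + b) \<in> K" using bc by simp
    ultimately have "(b * W)\<^sup>2 \<notin> Q" unfolding bW2 by (simp add: P_def)
    moreover have "(b * W)\<^sup>2 \<in> Q" unfolding power2_eq_square
      by (rule T.Q_mult[OF bW_Q T.Q_OL[OF bW_Q]])
    ultimately show False by blast
  qed
qed

theorem unramified_twist:
  assumes kummer: "\<And>P \<tau>. P \<in> finite_primes K \<Longrightarrow> \<tau> \<in> G \<Longrightarrow> \<exists>x\<in>K. \<tau> x \<noteq> x \<Longrightarrow>
      (\<And>x. x \<in> OL \<Longrightarrow> \<tau> x - x \<in> P) \<Longrightarrow> \<exists>w\<in>K. \<tau> w = - w \<and>
        (if 2 \<in> P then \<exists>b\<in>OL - P. \<tau> b = b \<and> (\<exists>c\<in>OL. b * (of_int d * w\<^sup>2 - 1) = 4 * c)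
         else of_int d * w\<^sup>2 \<in> OL - P)"
  shows "unramified_everywhere quad twist"
  unfolding unramified_everywhere_def
proof (intro conjI ballI)
  fix v assume "v \<in> infinite_primes quad"
  thus "unramified_at_infinite quad twist v"
    using quad_not_real by (simp add: unramified_at_infinite_def)
next
  fix P0 assume "P0 \<in> finite_primes quad"
  show "unramified_at_finite quad twist P0"
    unfolding unramified_at_finite_def
  proof (intro ballI impI)
    fix Q assume Q: "Q \<in> finite_primes twist" and P0: "Q \<inter> quad = P0"
    interpret T: galois_prime quad twist Q
      by (intro galois_prime.intro finite_galois_twist prime_of_subfield.intro
          Twist.complex_subfield_axioms prime_of_subfield_axioms.intro Q)
    have int: "Q \<inter> quad \<subseteq> {z \<in> quad. algebraic_int z}"
      using T.Q_OL by (auto simp: Twist.OL_iff)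
    from finite_representatives[OF int prime_gt_0_nat[OF T.prime_res_char]]
    obtain Y where Y: "finite Y" "Y \<subseteq> Q \<inter> quad"
      "\<forall>z\<in>Q \<inter> quad. \<exists>y\<in>Y. \<exists>t. t \<in> quad \<and> algebraic_int t \<and> z - y = of_nat T.res_char * t"
      by (elim exE conjE)
    have "\<not> Q \<inter> quad \<subseteq> ideal_prod (ring_of_integers twist) Q Q"
    proof (rule T.not_subset_square_if_inertia_trivial[OF _ Y(1,2)])
      fix z assume "z \<in> Q \<inter> quad"
      then obtain y t where yt: "y \<in> Y" "t \<in> quad" "algebraic_int t" "z - y = of_nat T.res_char * t"
        using Y(3) by blast
      have "t \<in> Twist.OL" using subsetD[OF quad_subset yt(2)] yt(3) by (simp add: Twist.OL_iff)
      with yt(1,4) show "\<exists>y\<in>Y. \<exists>t\<in>Twist.OL. z - y = of_nat T.res_char * t" by blast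
    next
      fix \<sigma>
      assume \<sigma>: "\<sigma> \<in> carrier (galois_group twist quad)" "\<And>x. x \<in> Twist.OL \<Longrightarrow> \<sigma> x - x \<in> Q"
      show "\<forall>x\<in>Twist.OL. \<sigma> x = x"
      proof
        fix x assume "x \<in> Twist.OL"
        hence x: "x \<in> twist" by (rule Twist.OL_imp_in)
        show "\<sigma> x = x"
          by (rule inertia_twist_trivial) (fact kummer, fact Q, fact \<sigma>(1), fact \<sigma>(2), fact x)
      qed
    qed
    thus "ramification_index twist Q P0 = 1"
      using T.ramification_index_eq_1 P0 by simp
  qed
qed

end

section \<open>Choice of the quadratic field\<close>

locale inertia_groups_order_two = finite_galois \<rat> K for K +
  assumes card_inertia_group: "\<And>P. P \<in> finite_primes K \<Longrightarrow>
    inertia_group K \<rat> P \<noteq> {\<one>\<^bsub>galois_group K \<rat>\<^esub>} \<Longrightarrow> card (inertia_group K \<rat> P) = 2"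
begin

definition ramified :: "complex set \<Rightarrow> (complex \<Rightarrow> complex) \<Rightarrow> bool" where
  "ramified P \<tau> \<longleftrightarrow> P \<in> finite_primes K \<and> \<tau> \<in> G \<and> (\<exists>x\<in>K. \<tau> x \<noteq> x) \<and> (\<forall>x\<in>OL. \<tau> x - x \<in> P)"

lemma ramified_imp_inertia_of_order_two:
  assumes "ramified P \<tau>"
  shows "inertia_of_order_two K P \<tau>"
proof -
  have \<tau>: "P \<in> finite_primes K" "\<tau> \<in> G" "\<exists>x\<in>K. \<tau> x \<noteq> x" "\<And>x. x \<in> OL \<Longrightarrow> \<tau> x - x \<in> P"
    using assms by (simp_all add: ramified_def)
  interpret P: rational_galois_prime K P
    by (intro rational_galois_prime.intro galois_prime.intro finite_galois_axioms prime_of_subfield.intro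
        complex_subfield_axioms prime_of_subfield_axioms.intro \<tau>(1))
  have mem: "\<sigma> \<in> inertia_group K \<rat> P \<longleftrightarrow> \<sigma> \<in> G \<and> (\<forall>x\<in>OL. \<sigma> x - x \<in> P)" for \<sigma>
    by (simp add: inertia_group_def)
  have id: "(\<lambda>x\<in>K. x) \<in> inertia_group K \<rat> P"
    unfolding mem by simp
  have \<tau>_mem: "\<tau> \<in> inertia_group K \<rat> P" unfolding mem using \<tau> by blast
  have ne: "\<tau> \<noteq> (\<lambda>x\<in>K. x)" using \<tau>(3) by auto
  hence "inertia_group K \<rat> P \<noteq> {\<one>\<^bsub>galois_group K \<rat>\<^esub>}"
    using \<tau>_mem unfolding galois_group_one by blast
  hence "card (inertia_group K \<rat> P) = 2" by (rule card_inertia_group[OF \<tau>(1)])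
  moreover have "{\<lambda>x\<in>K. x, \<tau>} \<subseteq> inertia_group K \<rat> P" "card {\<lambda>x\<in>K. x, \<tau>} = 2"
    using id \<tau>_mem ne by auto
  ultimately have I: "inertia_group K \<rat> P = {\<lambda>x\<in>K. x, \<tau>}"
    by (metis card_subset_eq card.infinite zero_neq_numeral)
  show ?thesis
  proof (intro inertia_of_order_two.intro P.rational_galois_prime_axioms inertia_of_order_two_axioms.intro)
    fix \<sigma> assume "\<sigma> \<in> G" "\<And>x. x \<in> OL \<Longrightarrow> \<sigma> x - x \<in> P"
    hence "\<sigma> \<in> inertia_group K \<rat> P" unfolding mem by blast
    hence "\<sigma> = (\<lambda>x\<in>K. x) \<or> \<sigma> = \<tau>" unfolding I by blast
    thus "(\<forall>x\<in>K. \<sigma> x = x) \<or> (\<forall>x\<in>K. \<sigma> x = \<tau> x)" by auto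
  qed (use \<tau> in auto)
qed

text \<open>Choose the class at one ramified prime above 2 and transport it by an automorphism
  \<open>\<rho>\<close>. Signs and powers of 2 are rational, so the same \<open>\<epsilon>\<close>
  and \<open>j\<close> serve every other prime above 2.\<close>

lemma exists_uniform_kummer_class_two:
  "\<exists>j\<le>1. \<exists>\<epsilon>\<in>{1, -1 :: int}. \<forall>P \<tau>. ramified P \<tau> \<longrightarrow> 2 \<in> P \<longrightarrow>
    (\<exists>w\<in>K. \<tau> w = - w \<and> (\<exists>b\<in>OL - P. \<tau> b = b \<and> (\<exists>c\<in>OL. b * (of_int \<epsilon> * 2 ^ j * w\<^sup>2 - 1) = 4 * c)))"
proof (cases "\<exists>P \<tau>. ramified P \<tau> \<and> 2 \<in> P")
  case False
  thus ?thesis by (intro exI[of _ 0] conjI bexI[of _ 1]) auto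
next
  case True
  then obtain P1 \<tau>1 where ram: "ramified P1 \<tau>1" and two: "2 \<in> P1" by blast
  interpret P1: inertia_of_order_two K P1 \<tau>1
    by (rule ramified_imp_inertia_of_order_two[OF ram])
  have res1: "P1.res_char = 2" using two P1.two_in_Q_iff by simp
  obtain w1 j \<epsilon> b1 c1 where w1: "w1 \<in> K" "j \<le> 1" "\<epsilon> \<in> {1, -1 :: int}" "\<tau>1 w1 = - w1"
    "b1 \<in> OL - P1" "c1 \<in> OL" "b1 * (of_int \<epsilon> * 2 ^ j * w1\<^sup>2 - 1) = 4 * c1"
    using P1.exists_kummer_generator_two[OF res1] by blast
  show ?thesis
  proof (rule exI[of _ j], rule conjI[OF w1(2)], rule bexI[OF _ w1(3)], intro allI impI)
    fix P \<tau> assume ram': "ramified P \<tau>" and two': "2 \<in> P"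
    interpret P: inertia_of_order_two K P \<tau>
      by (rule ramified_imp_inertia_of_order_two[OF ram'])
    have res: "P.res_char = 2" using two' P.two_in_Q_iff by simp
    have P: "P \<in> finite_primes K" "\<tau> \<in> G" "\<exists>x\<in>K. \<tau> x \<noteq> x" "\<And>x. x \<in> OL \<Longrightarrow> \<tau> x - x \<in> P"
      using ram' by (simp_all add: ramified_def)
    have "of_nat P1.res_char \<in> P" using two' res1 by simp
    then obtain \<rho> where \<rho>: "\<rho> \<in> G" "\<And>x. x \<in> OL \<Longrightarrow> x \<in> P1 \<longleftrightarrow> \<rho> x \<in> P"
      using P1.exists_conjugating_automorphism[OF P(1)] by blast
    have \<tau>w: "\<tau> (\<rho> w1) = - \<rho> w1"
      by (rule P1.conjugate_inertia[OF \<rho> P(2,3,4) w1(1,4)])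
    have b: "\<rho> b1 \<in> OL" "\<rho> b1 \<notin> P" using w1(5) \<rho> by auto
    have "\<rho> (b1 * (of_int \<epsilon> * 2 ^ j * w1\<^sup>2 - 1)) = \<rho> (4 * c1)" using w1(7) by simp
    hence eq: "\<rho> b1 * (of_int \<epsilon> * 2 ^ j * (\<rho> w1)\<^sup>2 - 1) = 4 * \<rho> c1"
      using \<rho>(1) w1(1,5,6) by simp
    \<comment> \<open>The denominator is replaced by its norm so that \<open>\<tau>\<close> fixes
      it, as the argument in the compositum requires.\<close>
    have "(\<rho> b1 * \<tau> (\<rho> b1)) * (of_int \<epsilon> * 2 ^ j * (\<rho> w1)\<^sup>2 - 1)
        = \<tau> (\<rho> b1) * (\<rho> b1 * (of_int \<epsilon> * 2 ^ j * (\<rho> w1)\<^sup>2 - 1))" by (simp only: mult_ac)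
    also have "\<dots> = 4 * (\<tau> (\<rho> b1) * \<rho> c1)" unfolding eq by simp
    finally have "(\<rho> b1 * \<tau> (\<rho> b1)) * (of_int \<epsilon> * 2 ^ j * (\<rho> w1)\<^sup>2 - 1) = 4 * (\<tau> (\<rho> b1) * \<rho> c1)" .
    moreover have "\<tau> (\<rho> b1) * \<rho> c1 \<in> OL" using b \<rho>(1) P(2) w1(6) by simp
    moreover have "\<rho> b1 * \<tau> (\<rho> b1) \<in> OL - P" "\<tau> (\<rho> b1 * \<tau> (\<rho> b1)) = \<rho> b1 * \<tau> (\<rho> b1)"
      using b P(2) P.norm_notin_Q[OF b] P.fixed_integers_closed(5)[OF b(1)]
      by (simp_all add: P.fixed_integers_iff)
    moreover have "\<rho> w1 \<in> K" using \<rho>(1) w1(1) by simp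
    ultimately show "\<exists>w\<in>K. \<tau> w = - w \<and> (\<exists>b\<in>OL - P. \<tau> b = b \<and>
        (\<exists>c\<in>OL. b * (of_int \<epsilon> * 2 ^ j * w\<^sup>2 - 1) = 4 * c))"
      using \<tau>w by blast
  qed
qed

section \<open>The radicand of the quadratic field\<close>

definition odd_ramified :: "nat set" where
  "odd_ramified = {p. prime p \<and> p \<noteq> 2 \<and> (\<exists>P \<tau>. ramified P \<tau> \<and> of_nat p \<in> P)}"

lemma finite_odd_ramified: "finite odd_ramified"
proof -
  from finitely_many_ramified[OF refl] obtain N :: int where N: "N \<noteq> 0"
    "\<forall>Q\<in>finite_primes K. \<forall>\<sigma>\<in>G. \<forall>p. (\<exists>x\<in>K. \<sigma> x \<noteq> x) \<longrightarrow>
      (\<forall>x\<in>OL. \<sigma> x - x \<in> Q) \<longrightarrow> prime p \<longrightarrow> of_nat p \<in> Q \<longrightarrow> int p dvd N"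
    by (elim exE conjE)
  have "p \<le> nat \<bar>N\<bar>" if "p \<in> odd_ramified" for p
  proof -
    obtain P \<tau> where P: "ramified P \<tau>" "of_nat p \<in> P" "prime p"
      using \<open>p \<in> odd_ramified\<close> by (auto simp: odd_ramified_def)
    have "int p dvd N" using N(2) P unfolding ramified_def by blast
    thus ?thesis using N(1) zdvd_imp_le[of "int p" "\<bar>N\<bar>"] by simp
  qed
  thus ?thesis by (meson finite_nat_set_iff_bounded_le)
qed

definition m0 :: nat where "m0 = \<Prod>odd_ramified"

lemma odd_m0: "odd m0"
proof -
  have "odd p" if "p \<in> odd_ramified" for p
    using that primes_dvd_imp_eq[OF two_is_prime_nat, of p] by (auto simp: odd_ramified_def)
  thus ?thesis using finite_odd_ramified by (auto simp: m0_def even_prod_iff)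
qed

lemma m0_pos: "m0 > 0"
  using odd_m0 by (auto intro: Nat.gr0I)

text \<open>
  The factor \<open>4 m0 - 1\<close> is congruent to 3 modulo 4 and prime to \<open>m0\<close>; it adjusts the class of the
  odd part of the discriminant modulo 4.
\<close>

definition twist_flag :: "int \<Rightarrow> nat \<Rightarrow> nat" where
  "twist_flag \<epsilon> q = (if 4 dvd int (m0 * q) + \<epsilon> then 1 else 4 * m0 - 1)"

text \<open>The factor \<open>m0\<close> contains each odd ramified prime once, \<open>2^j\<close>
  together with the odd part modulo 4 prescribes the class at 2, the auxiliary prime
  \<open>q\<close> is free to keep the square root out of \<open>K\<close>, and the sign makes the
  field imaginary.\<close>

definition twist_int :: "nat \<Rightarrow> int \<Rightarrow> nat \<Rightarrow> int" where
  "twist_int j \<epsilon> q = - (2 ^ j * int (m0 * twist_flag \<epsilon> q * q))"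

text \<open>The odd number \<open>m0 * q\<close> is \<open>\<epsilon>\<close> or
  \<open>- \<epsilon>\<close> modulo 4; in the first case the extra factor, congruent to -1,
  reverses the sign.\<close>

lemma twist_flag_cong:
  assumes "odd q" "\<epsilon> \<in> {1, -1}"
  shows "\<exists>l. - int (m0 * twist_flag \<epsilon> q * q) = \<epsilon> + 4 * l"
proof -
  have "4 dvd int (m0 * twist_flag \<epsilon> q * q) + \<epsilon>"
  proof (cases "4 dvd int (m0 * q) + \<epsilon>")
    case True
    thus ?thesis by (simp add: twist_flag_def)
  next
    case False
    have "odd (int (m0 * q))" using assms(1) odd_m0 by simp
    hence "4 dvd int (m0 * q) + 1 \<or> 4 dvd int (m0 * q) - 1" by presburger
    hence "4 dvd int (m0 * q) - \<epsilon>" using False assms(2) by auto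
    then obtain k where k: "int (m0 * q) = \<epsilon> + 4 * k" by (auto elim!: dvdE simp: algebra_simps)
    have "int (4 * m0 - 1) = 4 * int m0 - 1" using m0_pos by (simp add: of_nat_diff)
    hence "int (m0 * twist_flag \<epsilon> q * q) = int (m0 * q) * (4 * int m0 - 1)"
      using False by (simp add: twist_flag_def)
    hence "int (m0 * twist_flag \<epsilon> q * q) + \<epsilon> = 4 * (int m0 * int (m0 * q) - k)"
      unfolding k by (simp add: algebra_simps)
    thus ?thesis by simp
  qed
  then obtain l where "int (m0 * twist_flag \<epsilon> q * q) + \<epsilon> = 4 * l" by (auto elim: dvdE)
  thus ?thesis by (intro exI[of _ "- l"]) simp
qed

lemma twist_flag_pos: "twist_flag \<epsilon> q > 0"
  using m0_pos by (auto simp: twist_flag_def)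

lemma twist_flag_coprime: "p \<in> odd_ramified \<Longrightarrow> \<not> p dvd twist_flag \<epsilon> q"
proof
  assume p: "p \<in> odd_ramified" "p dvd twist_flag \<epsilon> q"
  have prime_p: "prime p" using p by (simp add: odd_ramified_def)
  have "p dvd m0" unfolding m0_def by (rule dvd_prodI[OF finite_odd_ramified p(1), of "\<lambda>x. x", simplified])
  show False
  proof (cases "4 dvd int (m0 * q) + \<epsilon>")
    case True
    thus False using p(2) prime_p by (simp add: twist_flag_def)
  next
    case False
    hence "p dvd 4 * m0 - 1" using p(2) by (simp add: twist_flag_def)
    moreover have "p dvd 4 * m0" using \<open>p dvd m0\<close> by simp
    moreover have "4 * m0 = (4 * m0 - 1) + 1" using m0_pos by simp
    ultimately have "p dvd 1" by (metis dvd_add_right_iff)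
    thus False using prime_p by simp
  qed
qed

lemma twist_int_neg: "q > 0 \<Longrightarrow> twist_int j \<epsilon> q < 0"
  using m0_pos twist_flag_pos by (simp add: twist_int_def)

text \<open>
  If all these square roots were in \<open>K\<close>, two of them with the same behaviour under the Galois group
  would have a rational product, making \<open>q q'\<close> a square.
\<close>

lemma exists_sqrt_notin:
  "\<exists>q \<delta>. prime q \<and> q \<noteq> 2 \<and> q \<notin> odd_ramified \<and> \<delta>\<^sup>2 = of_int (twist_int j \<epsilon> q) \<and> \<delta> \<notin> K"
proof (rule ccontr)
  assume no: "\<not> ?thesis"
  define A where "A = {q :: nat. prime q} - (insert 2 odd_ramified)"
  have infA: "infinite A"
    unfolding A_def using finite_odd_ramified primes_infinite by (intro Diff_infinite_finite) auto
  define \<delta> where "\<delta> = (\<lambda>q. csqrt (of_int (twist_int j \<epsilon> q)))"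
  have \<delta>2: "(\<delta> q)\<^sup>2 = of_int (twist_int j \<epsilon> q)" for q by (simp add: \<delta>_def)
  have \<delta>_K: "\<delta> q \<in> K" if "q \<in> A" for q using no that \<delta>2 by (auto simp: A_def)
  \<comment> \<open>The pigeonhole key: which automorphisms fix the root, and the flag. Equal flags
    give the two radicands the same factor besides \<open>q\<close> and \<open>q'\<close>.\<close>
  define f where "f = (\<lambda>q. ({\<sigma> \<in> G. \<sigma> (\<delta> q) = \<delta> q}, twist_flag \<epsilon> q))"
  have "f ` A \<subseteq> Pow G \<times> {1, 4 * m0 - 1}" by (auto simp: f_def twist_flag_def)
  moreover have "finite (Pow G \<times> {1, 4 * m0 - 1})" by simp
  ultimately have "finite (f ` A)" by (rule finite_subset)
  hence "\<not> inj_on f A" using infA finite_imageD by blast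
  then obtain q q' where q: "q \<in> A" "q' \<in> A" "q \<noteq> q'" "f q = f q'" by (auto simp: inj_on_def)
  have sign: "\<sigma> (\<delta> r) = \<delta> r \<or> \<sigma> (\<delta> r) = - \<delta> r" if "\<sigma> \<in> G" "r \<in> A" for \<sigma> r
  proof -
    have "(\<sigma> (\<delta> r))\<^sup>2 = \<sigma> ((\<delta> r)\<^sup>2)" using that \<delta>_K by simp
    also have "\<dots> = (\<delta> r)\<^sup>2" unfolding \<delta>2 using that by simp
    finally show ?thesis by (simp add: power2_eq_iff)
  qed
  have "\<delta> q * \<delta> q' \<in> \<rat>"
  proof (rule fixed_imp_in_E)
    show "\<delta> q * \<delta> q' \<in> K" using \<delta>_K q by simp
    fix \<sigma> assume \<sigma>: "\<sigma> \<in> G"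
    have "\<sigma> (\<delta> q) = \<delta> q \<longleftrightarrow> \<sigma> (\<delta> q') = \<delta> q'" using q(4) \<sigma> by (auto simp: f_def)
    hence "\<sigma> (\<delta> q) * \<sigma> (\<delta> q') = \<delta> q * \<delta> q'"
      using sign[OF \<sigma> q(1)] sign[OF \<sigma> q(2)] by auto
    thus "\<sigma> (\<delta> q * \<delta> q') = \<delta> q * \<delta> q'" using \<delta>_K q \<sigma> by simp
  qed
  \<comment> \<open>Dividing by the common factor \<open>e\<close> leaves a rational square root of
    \<open>q * q'\<close>, which is integral.\<close>
  moreover define e where "e = 2 ^ j * m0 * twist_flag \<epsilon> q"
  ultimately have rat: "\<delta> q * \<delta> q' / of_nat e \<in> \<rat>" by simp
  have e0: "e > 0" using m0_pos twist_flag_pos by (simp add: e_def)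
  have flag: "twist_flag \<epsilon> q' = twist_flag \<epsilon> q" using q(4) by (simp add: f_def)
  have "twist_int j \<epsilon> q = - int (e * q)" "twist_int j \<epsilon> q' = - int (e * q')"
    by (simp_all add: twist_int_def e_def flag)
  hence "(\<delta> q * \<delta> q')\<^sup>2 = of_int (- int (e * q)) * of_int (- int (e * q'))"
    by (simp only: power_mult_distrib \<delta>2)
  also have "\<dots> = of_nat e ^ 2 * of_nat (q * q')" by (simp add: power2_eq_square)
  finally have sq: "(\<delta> q * \<delta> q' / of_nat e)\<^sup>2 = of_nat (q * q')"
    using e0 by (simp add: power_divide)
  have "algebraic_int (\<delta> q * \<delta> q' / of_nat e)"
    by (rule algebraic_int_square_root) (simp only: sq, rule int_imp_algebraic_int, simp)
  hence "\<delta> q * \<delta> q' / of_nat e \<in> \<int>" using rat by (rule rational_algebraic_int_is_int)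
  then obtain k where k: "\<delta> q * \<delta> q' / of_nat e = of_int k" by (rule Ints_cases)
  have "(of_int (k\<^sup>2) :: complex) = of_int (int (q * q'))" using sq unfolding k by simp
  hence kq: "k\<^sup>2 = int (q * q')" by (simp only: of_int_eq_iff)
  have pq: "prime (int q)" "prime (int q')" using q by (simp_all add: A_def)
  have "int q dvd k\<^sup>2" unfolding kq by simp
  hence "int q dvd k" using pq(1) by (rule prime_dvd_power[rotated])
  then obtain l where "k = int q * l" by (rule dvdE)
  hence "int q * (int q * l\<^sup>2) = int q * int q'" using kq by (simp add: power2_eq_square mult_ac)
  hence "int q * l\<^sup>2 = int q'" using pq(1) by simp
  hence "int q dvd int q'" by (metis dvd_triv_left)
  hence "q = q'" using pq by (simp add: primes_dvd_imp_eq)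
  thus False using q(3) by simp
qed

text \<open>Above 2, \<open>d\<close> is \<open>\<epsilon> * 2^j\<close> times a number congruent to
  1 modulo 4, so the congruence for \<open>\<epsilon> * 2^j\<close> carries over. Above an odd
  \<open>p\<close>, \<open>d\<close> is \<open>p\<close> times a unit, and so is
  \<open>1 / w^2\<close>; the product \<open>d * w^2\<close> is a unit.\<close>

lemma kummer_condition:
  assumes q: "prime q" "q \<noteq> 2" "q \<notin> odd_ramified" and \<epsilon>: "\<epsilon> \<in> {1, -1 :: int}"
    and two: "\<And>P \<tau>. ramified P \<tau> \<Longrightarrow> 2 \<in> P \<Longrightarrow>
    (\<exists>w\<in>K. \<tau> w = - w \<and> (\<exists>b\<in>OL - P. \<tau> b = b \<and> (\<exists>c\<in>OL. b * (of_int \<epsilon> * 2 ^ j * w\<^sup>2 - 1) = 4 * c)))"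
    and ram: "ramified P \<tau>"
  shows "\<exists>w\<in>K. \<tau> w = - w \<and>
        (if 2 \<in> P then \<exists>b\<in>OL - P. \<tau> b = b \<and> (\<exists>c\<in>OL. b * (of_int (twist_int j \<epsilon> q) * w\<^sup>2 - 1) = 4 * c)
         else of_int (twist_int j \<epsilon> q) * w\<^sup>2 \<in> OL - P)"
proof (cases "2 \<in> P")
  case True
  obtain w b c where wbc: "w \<in> K" "\<tau> w = - w" "b \<in> OL - P" "\<tau> b = b" "c \<in> OL"
    "b * (of_int \<epsilon> * 2 ^ j * w\<^sup>2 - 1) = 4 * c" using two[OF ram True] by blast
  have "odd q" using q(1,2) by (metis prime_odd_nat prime_ge_2_nat le_neq_implies_less)
  then obtain l where l: "- int (m0 * twist_flag \<epsilon> q * q) = \<epsilon> + 4 * l"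
    using twist_flag_cong \<epsilon> by blast
  have "twist_int j \<epsilon> q = 2 ^ j * (\<epsilon> + 4 * l)" unfolding twist_int_def l[symmetric] by simp
  also have "\<dots> = \<epsilon> * 2 ^ j * (1 + 4 * (l * \<epsilon>))" using \<epsilon> by (auto simp: algebra_simps)
  finally have d: "(of_int (twist_int j \<epsilon> q) :: complex) = of_int \<epsilon> * 2 ^ j * (1 + 4 * of_int (l * \<epsilon>))"
    by simp
  have "b * (of_int (twist_int j \<epsilon> q) * w\<^sup>2 - 1) =
      (b * (of_int \<epsilon> * 2 ^ j * w\<^sup>2 - 1)) * (1 + 4 * of_int (l * \<epsilon>)) + 4 * (b * of_int (l * \<epsilon>))"
    unfolding d by (simp add: algebra_simps)
  also have "\<dots> = 4 * (c * (1 + 4 * of_int (l * \<epsilon>)) + b * of_int (l * \<epsilon>))"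
    unfolding wbc(6) by (simp add: algebra_simps)
  finally have eq: "b * (of_int (twist_int j \<epsilon> q) * w\<^sup>2 - 1) =
      4 * (c * (1 + 4 * of_int (l * \<epsilon>)) + b * of_int (l * \<epsilon>))" .
  have "c * (1 + 4 * of_int (l * \<epsilon>)) + b * of_int (l * \<epsilon>) \<in> OL"
    using wbc by (intro OL_add OL_mult) simp_all
  with eq have "\<exists>c\<in>OL. b * (of_int (twist_int j \<epsilon> q) * w\<^sup>2 - 1) = 4 * c" by blast
  with True wbc(1-4) show ?thesis by (simp only: if_True) blast
next
  case False
  interpret P: inertia_of_order_two K P \<tau>
    by (rule ramified_imp_inertia_of_order_two[OF ram])
  define p where "p = P.res_char"
  have p: "prime p" "of_nat p \<in> P" "p \<noteq> 2"
    using P.prime_res_char P.res_char_in_Q False P.two_in_Q_iff by (auto simp: p_def)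
  have p_ram: "p \<in> odd_ramified" unfolding odd_ramified_def using p ram by blast
  define d' where "d' = - (2 ^ j * int (\<Prod>(odd_ramified - {p}) * twist_flag \<epsilon> q * q))"
  have "m0 = p * \<Prod>(odd_ramified - {p})"
    unfolding m0_def using finite_odd_ramified p_ram by (simp add: prod.remove)
  hence d: "twist_int j \<epsilon> q = int p * d'" by (simp add: twist_int_def d'_def)
  have "\<not> p dvd r" if "r \<in> odd_ramified - {p}" for r
    using that primes_dvd_imp_eq[OF p(1), of r] by (auto simp: odd_ramified_def)
  hence "\<not> p dvd \<Prod>(odd_ramified - {p})"
    using finite_odd_ramified p(1) by (auto simp: prime_dvd_prod_iff)
  moreover have "\<not> p dvd q" using primes_dvd_imp_eq[OF p(1) q(1)] q(3) p_ram by blast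
  moreover have "\<not> p dvd 2 ^ j"
    using prime_dvd_power[OF p(1), of 2 j] primes_dvd_imp_eq[OF p(1) two_is_prime_nat] p(3) by blast
  ultimately have "\<not> p dvd 2 ^ j * (\<Prod>(odd_ramified - {p}) * twist_flag \<epsilon> q * q)"
    using twist_flag_coprime[OF p_ram] p(1) by (simp add: prime_dvd_mult_iff)
  hence "\<not> int p dvd int (2 ^ j * (\<Prod>(odd_ramified - {p}) * twist_flag \<epsilon> q * q))"
    by (simp only: of_nat_dvd_iff not_False_eq_True)
  hence "\<not> int p dvd d'" by (simp add: d'_def)
  hence d'_notin: "of_int d' \<in> OL - P"
    by (simp add: P.of_int_in_Q_iff p_def)
  obtain w i where w: "w \<in> K" "i \<le> 1" "\<tau> w = - w" "of_nat p ^ i * w\<^sup>2 \<in> OL - P"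
    using P.exists_kummer_generator by (auto simp: p_def P.fixed_integers_iff)
  \<comment> \<open>With \<open>i = 0\<close> the generator \<open>w\<close> would be an integral
    local unit, and inertia would put \<open>\<tau> w - w = - 2 * w\<close> into \<open>P\<close>,
    although 2 is not in \<open>P\<close>.\<close>
  have "i \<noteq> 0"
  proof
    assume "i = 0"
    hence w2: "w\<^sup>2 \<in> OL" "w\<^sup>2 \<notin> P" using w(4) by simp_all
    hence w_OL: "w \<in> OL" using w(1) algebraic_int_square_root by (simp add: OL_iff)
    have "w \<notin> P" using w2 P.Q_power_iff[OF w_OL, of 2] by simp
    moreover have "- (2 * w) \<in> P" using P.\<tau>_inertia[OF w_OL] w(3) by simp
    hence "2 * w \<in> P" by (simp only: P.Q_minus_iff)
    ultimately show False using P.Q_prime[of 2 w] w_OL False by simp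
  qed
  hence "i = 1" using w(2) by simp
  hence "of_nat p * w\<^sup>2 \<in> OL - P" using w(4) by simp
  hence "of_int d' * (of_nat p * w\<^sup>2) \<in> OL - P"
    using d'_notin P.notin_mult[of "of_int d'" "of_nat p * w\<^sup>2"] OL_mult[of "of_int d'" "of_nat p * w\<^sup>2"] by blast
  moreover have "of_int (twist_int j \<epsilon> q) * w\<^sup>2 = of_int d' * (of_nat p * w\<^sup>2)"
    unfolding d by (simp add: mult_ac)
  ultimately have "of_int (twist_int j \<epsilon> q) * w\<^sup>2 \<in> OL - P" by (simp only:)
  with False w(1,3) show ?thesis by (simp only: if_False) blast
qed

theorem exists_unramified_quadratic_twist:
  "\<exists>E. quadratic_ext \<rat> E \<and> finite_galois_ext E (compositum K E) \<and>
     galois_group (compositum K E) E \<cong> galois_group K \<rat> \<and> unramified_everywhere E (compositum K E)"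
proof -
  obtain j \<epsilon> where \<epsilon>: "\<epsilon> \<in> {1, -1 :: int}" and two: "\<And>P \<tau>. ramified P \<tau> \<Longrightarrow> 2 \<in> P \<Longrightarrow>
    (\<exists>w\<in>K. \<tau> w = - w \<and> (\<exists>b\<in>OL - P. \<tau> b = b \<and> (\<exists>c\<in>OL. b * (of_int \<epsilon> * 2 ^ j * w\<^sup>2 - 1) = 4 * c)))"
    using exists_uniform_kummer_class_two by metis
  obtain q \<delta> where q: "prime q" "q \<noteq> 2" "q \<notin> odd_ramified" and \<delta>: "\<delta>\<^sup>2 = of_int (twist_int j \<epsilon> q)" "\<delta> \<notin> K"
    using exists_sqrt_notin by blast
  interpret T: quadratic_twist K \<delta> "twist_int j \<epsilon> q"
    by (intro quadratic_twist.intro finite_galois_axioms quadratic_twist_axioms.intro \<delta>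
        twist_int_neg prime_gt_0_nat q(1))
  have "unramified_everywhere T.quad T.twist"
  proof (rule T.unramified_twist)
    fix P \<tau> assume "P \<in> finite_primes K" "\<tau> \<in> G" "\<exists>x\<in>K. \<tau> x \<noteq> x" "\<And>x. x \<in> OL \<Longrightarrow> \<tau> x - x \<in> P"
    hence "ramified P \<tau>" unfolding ramified_def by blast
    thus "\<exists>w\<in>K. \<tau> w = - w \<and>
        (if 2 \<in> P then \<exists>b\<in>OL - P. \<tau> b = b \<and> (\<exists>c\<in>OL. b * (of_int (twist_int j \<epsilon> q) * w\<^sup>2 - 1) = 4 * c)
         else of_int (twist_int j \<epsilon> q) * w\<^sup>2 \<in> OL - P)"
      using kummer_condition[OF q \<epsilon> two] by blast
  qed
  thus ?thesis
    using T.quadratic_ext_quad T.finite_galois_ext_twist T.galois_group_twist_iso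
    unfolding T.compositum_eq[symmetric] by blast
qed

end

theorem mainTheorem2:
  fixes G :: "('g, 'm) monoid_scheme" and K :: "complex set"
  assumes "group G" and "finite (carrier G)"
    and "finite_galois_ext \<rat> K"
    and "galois_group K \<rat> \<cong> G"
    and "\<And>P. P \<in> finite_primes K \<Longrightarrow>
           inertia_group K \<rat> P \<noteq> {\<one>\<^bsub>galois_group K \<rat>\<^esub>} \<Longrightarrow> card (inertia_group K \<rat> P) = 2"
  shows "\<exists>E. quadratic_ext \<rat> E \<and>
             finite_galois_ext E (compositum K E) \<and>
             galois_group (compositum K E) E \<cong> G \<and>
             unramified_everywhere E (compositum K E)"
proof -
  have "finite (carrier (galois_group K \<rat>))"
    unfolding iso_finite[OF assms(4)] by (rule assms(2))
  hence "inertia_groups_order_two K"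
    by (intro inertia_groups_order_two.intro inertia_groups_order_two_axioms.intro
        finite_galois.intro assms(3,5))
  from inertia_groups_order_two.exists_unramified_quadratic_twist[OF this] show ?thesis
    using iso_trans[OF _ assms(4)] by blast
qed

end
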